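(* There exist an absolute constant $c>0$ and a fixed polynomial $\mathrm{poly}(\cdot)$ such that the following holds for any $\delta\in(0,1]$, any positive integers $S,A,O,K,H$, any integer $1\le m\le H$ and any $\alpha>0$. Run multi-step OMLE (defined in the context) for $K$ iterations with inputs $m,\alpha$ and $$\beta = c\left(H(S^2A+SO)\log(SAOHK)+\log(KH/\delta)\right).$$ Then for any POMDP with $S$ states, $A$ actions, $O$ observations and horizon $H$ whose $m$-step emission-action matrices satisfy $\min_{h\in[H-m+1]}\sigma_S(\mathbb M_h)\ge\alpha$, with probability at least $1-\delta$, $$\sum_{t=1}^k\left(V^\star-V^{\pi^t}\right)\le \mathrm{poly}\left(S,A^m,O,H,\alpha^{-1},\log(\delta^{-1}K)\right)\cdot\sqrt{k}\qquad\text{for all }k\in[K],$$ where $\pi^t$ is the optimistic policy computed by multi-step OMLE in iteration $t$.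
   Context: Notation: $[n]=\{1,\dots,n\}$; $\Delta_X$ is the set of probability distributions on a finite set $X$; $\sigma_j(M)$ is the $j$-th largest singular value of $M$ (equal to $0$ if $M$ has fewer than $j$ rows or columns). POMDP: a tuple $(\mathscr S,\mathscr A,\mathscr O;H,\mu_1,\mathbb T,\mathbb O;r)$ with finite sets of states, actions, observations of sizes $S,A,O$; horizon $H$; initial state distribution $\mu_1\in\Delta_{\mathscr S}$; transition matrices $\mathbb T_{h,a}\in\mathbb R^{S\times S}$ ($h\in[H-1],a\in\mathscr A$), where $\mathbb T_{h,a}(\cdot\mid s)$ is the distribution of the next state; emission matrices $\mathbb O_h\in\mathbb R^{O\times S}$ ($h\in[H]$), where $\mathbb O_h(\cdot\mid s)$ is the distribution of the observation; known rewards $r_h:\mathscr O\to[0,1]$. In an episode $s_1\sim\mu_1$; at step $h$ the learner sees $o_h\sim\mathbb O_h(\cdot\mid s_h)$, receives $r_h(o_h)$, takes $a_h$, and $s_{h+1}\sim\mathbb T_{h,a_h}(\cdot\mid s_h)$; the episode ends after $a_H$. States are never observed. A policy is $\pi=\{\pi_h\}_{h=1}^H$ with $\pi_h:(\mathscr O\times\mathscr A)^{h-1}\times\mathscr O\to\Delta_{\mathscr A}$. $V^\pi=\mathbb E_\pi[\sum_{h=1}^H r_h(o_h)]$, $V^\star=\sup_\pi V^\pi$. Values without a model argument refer to the true POMDP. $m$-step emission-action matrices: $\mathbb M_h\in\mathbb R^{(A^{m-1}O^m)\times S}$, $h\in[H-m+1]$, with entries $[\mathbb M_h]_{(\mathbf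 a,\mathbf o),s}=\mathbb P(o_{h:h+m-1}=\mathbf o\mid s_h=s,\ a_{h:h+m-2}=\mathbf a)$ for $\mathbf a\in\mathscr A^{m-1}$, $\mathbf o\in\mathscr O^m$, $s\in\mathscr S$, i.e. the probability of observing $\mathbf o$ when the fixed action sequence $\mathbf a$ is played from state $s$ at step $h$. Models: $\theta=(\mathbb T,\mathbb O,\mu_1)$, and $\Theta$ is the set of all such parameters for the given $S,A,O,H$; $V^\pi(\theta)$ is the value of $\pi$ under $\theta$, $\mathbb M_h(\theta)$ its $m$-step emission-action matrices, and $\mathbb P^\pi_\theta(\tau)$ the probability of the full trajectory $\tau=(o_1,a_1,\dots,o_H,a_H)$ under $\pi$ and $\theta$. Multi-step OMLE with inputs $m,\alpha,\beta$: set $\mathcal B^1=\{\hat\theta\in\Theta:\min_h\sigma_S(\mathbb M_h(\hat\theta))\ge\alpha\}$ and $\mathcal D=\emptyset$. For $k=1,\dots,K$: compute $(\theta^k,\pi^k)\in\arg\max_{\hat\theta\in\mathcal B^k,\pi}V^\pi(\hat\theta)$ (ties broken by a fixed deterministic rule; if $\mathcal B^k=\emptyset$ the choice is arbitrary); for each $h=0,\dots,H-m$, execute for one episode the policy $\pi^k_{1:h}\circ\mathrm{uniform}(\mathscr A)$ (follow $\pi^k$ in steps $1,\dots,h$, then choose actions uniformly at random in all remaining steps), collect the trajectory $\tau^{k,h}$ and add the pair $(\pi^k_{1:h}\circ\mathrm{uniform}(\mathscr A),\tau^{k,h})$ to $\mathcal D$; then set $$\mathcal B^{k+1}=\Big\{\hat\theta\in\Theta:\sum_{(\pi,\tau)\in\mathcal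 D}\log\mathbb P^\pi_{\hat\theta}(\tau)\ge\max_{\theta'\in\Theta}\sum_{(\pi,\tau)\in\mathcal D}\log\mathbb P^\pi_{\theta'}(\tau)-\beta\Big\}\cap\mathcal B^1.$$ *)

theory Defs
  imports "HOL-Probability.Probability" "Jordan_Normal_Form.Char_Poly"
begin

text \<open>
  Singular values are the square roots of the eigenvalues of \<open>M\<^sup>T M\<close>, counted with multiplicity.
  That matrix is symmetric, so its characteristic polynomial splits over the reals and \<open>proots\<close>
  yields all \<open>dim_col M\<close> eigenvalues.
\<close>

definition singular_value :: "nat \<Rightarrow> real mat \<Rightarrow> real" where
  "singular_value j M =
     (if 1 \<le> j \<and> j \<le> dim_row M \<and> j \<le> dim_col M
      then sqrt (rev (sorted_list_of_multiset (proots (char_poly (transpose_mat M * M)))) ! (j - 1))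
      else 0)"

text \<open>
  States, actions and observations are the numbers below \<open>nS\<close>, \<open>nA\<close>, \<open>nO\<close>; steps are numbered
  from 1. The values of these total functions outside the index ranges in \<open>params\<close> and
  \<open>policies\<close> below are never used.
\<close>

record param =
  init :: "nat pmf"
  trans :: "nat \<Rightarrow> nat \<Rightarrow> nat \<Rightarrow> nat pmf"  \<comment> \<open>step, action, state\<close>
  emit :: "nat \<Rightarrow> nat \<Rightarrow> nat pmf"  \<comment> \<open>step, state\<close>

definition params :: "nat \<Rightarrow> nat \<Rightarrow> nat \<Rightarrow> nat \<Rightarrow> param set" where
  "params nS nA nO H =
     {\<theta>. set_pmf (init \<theta>) \<subseteq> {..<nS} \<and>
         (\<forall>h\<in>{1..H - 1}. \<forall>a<nA. \<forall>s<nS. set_pmf (trans \<theta> h a s) \<subseteq> {..<nS}) \<and>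
         (\<forall>h\<in>{1..H}. \<forall>s<nS. set_pmf (emit \<theta> h s) \<subseteq> {..<nO})}"

text \<open>
  A history or trajectory is the chronological list of (observation, action) pairs. A policy maps
  the history of the first \<open>h - 1\<close> steps and the observation at step \<open>h\<close> to an action distribution;
  the step is determined by the length of the history.
\<close>

type_synonym history = "(nat \<times> nat) list"
type_synonym policy = "history \<Rightarrow> nat \<Rightarrow> nat pmf"
type_synonym dataset = "(policy \<times> history) list"

definition policies :: "nat \<Rightarrow> nat \<Rightarrow> nat \<Rightarrow> policy set" where
  "policies nA nO H =
     {\<pi>. \<forall>\<tau>\<in>lists ({..<nO} \<times> {..<nA}). \<forall>x<nO. length \<tau> < H \<longrightarrow> set_pmf (\<pi> \<tau> x) \<subseteq> {..<nA}}"

definition trajectories :: "nat \<Rightarrow> nat \<Rightarrow> nat \<Rightarrow> history set" where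
  "trajectories nA nO H = {\<tau>\<in>lists ({..<nO} \<times> {..<nA}). length \<tau> = H}"

text \<open>
  \<open>rollout \<theta> \<pi> n \<tau> s\<close> extends the history \<open>\<tau>\<close> by \<open>n\<close> more steps, the first of them taken in state
  \<open>s\<close>. There is no transition after the last step.
\<close>

fun rollout :: "param \<Rightarrow> policy \<Rightarrow> nat \<Rightarrow> history \<Rightarrow> nat \<Rightarrow> history pmf" where
  "rollout \<theta> \<pi> 0 \<tau> s = return_pmf \<tau>"
| "rollout \<theta> \<pi> (Suc n) \<tau> s =
     do {
       x \<leftarrow> emit \<theta> (length \<tau> + 1) s;
       a \<leftarrow> \<pi> \<tau> x;
       if n = 0 then return_pmf (\<tau> @ [(x, a)])
       else do {
         s' \<leftarrow> trans \<theta> (length \<tau> + 1) a s;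
         rollout \<theta> \<pi> n (\<tau> @ [(x, a)]) s'
       }
     }"

definition trajectory_pmf :: "nat \<Rightarrow> param \<Rightarrow> policy \<Rightarrow> history pmf" where
  "trajectory_pmf H \<theta> \<pi> = bind_pmf (init \<theta>) (rollout \<theta> \<pi> H [])"

definition policy_value :: "nat \<Rightarrow> (nat \<Rightarrow> nat \<Rightarrow> real) \<Rightarrow> param \<Rightarrow> policy \<Rightarrow> real" where
  "policy_value H r \<theta> \<pi> =
     measure_pmf.expectation (trajectory_pmf H \<theta> \<pi>) (\<lambda>\<tau>. \<Sum>h=1..H. r h (fst (\<tau> ! (h - 1))))"

definition optimal_value ::
    "nat \<Rightarrow> nat \<Rightarrow> nat \<Rightarrow> (nat \<Rightarrow> nat \<Rightarrow> real) \<Rightarrow> param \<Rightarrow> real" where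
  "optimal_value nA nO H r \<theta> = (SUP \<pi>\<in>policies nA nO H. policy_value H r \<theta> \<pi>)"

text \<open>
  \<open>observations_pmf \<theta> h s as\<close>: the \<open>length as + 1\<close> observations made from step \<open>h\<close> on when starting
  in state \<open>s\<close> and playing the fixed actions \<open>as\<close>.
\<close>

fun observations_pmf :: "param \<Rightarrow> nat \<Rightarrow> nat \<Rightarrow> nat list \<Rightarrow> nat list pmf" where
  "observations_pmf \<theta> h s [] = map_pmf (\<lambda>x. [x]) (emit \<theta> h s)"
| "observations_pmf \<theta> h s (a # as) =
     do {
       x \<leftarrow> emit \<theta> h s;
       s' \<leftarrow> trans \<theta> h a s;
       xs \<leftarrow> observations_pmf \<theta> (h + 1) s' as;
       return_pmf (x # xs)
     }"

text \<open>
  The row indices \<open>(\<a>, \<o>)\<close> are enumerated in an arbitrary fixed order, which does not affect the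
  singular values.
\<close>

definition emission_action_rows :: "nat \<Rightarrow> nat \<Rightarrow> nat \<Rightarrow> (nat list \<times> nat list) list" where
  "emission_action_rows nA nO m =
     List.product (List.n_lists (m - 1) [0..<nA]) (List.n_lists m [0..<nO])"

definition emission_action_matrix ::
    "nat \<Rightarrow> nat \<Rightarrow> nat \<Rightarrow> nat \<Rightarrow> param \<Rightarrow> nat \<Rightarrow> real mat" where
  "emission_action_matrix nS nA nO m \<theta> h =
     mat (nA ^ (m - 1) * nO ^ m) nS
       (\<lambda>(i, s). case emission_action_rows nA nO m ! i of
          (as, xs) \<Rightarrow> pmf (observations_pmf \<theta> h s as) xs)"

definition min_singular_value :: "nat \<Rightarrow> nat \<Rightarrow> nat \<Rightarrow> nat \<Rightarrow> nat \<Rightarrow> param \<Rightarrow> real" where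
  "min_singular_value nS nA nO H m \<theta> =
     (MIN h\<in>{1..H - m + 1}. singular_value nS (emission_action_matrix nS nA nO m \<theta> h))"

text \<open>Log-likelihoods are extended reals because \<open>ln 0 = 0\<close> in the type of reals.\<close>

definition log_prob :: "real \<Rightarrow> ereal" where
  "log_prob p = (if p = 0 then -\<infinity> else ereal (ln p))"

definition log_likelihood :: "nat \<Rightarrow> dataset \<Rightarrow> param \<Rightarrow> ereal" where
  "log_likelihood H D \<theta> = (\<Sum>(\<pi>, \<tau>)\<leftarrow>D. log_prob (pmf (trajectory_pmf H \<theta> \<pi>) \<tau>))"

text \<open>
  The confidence set in the iteration that starts with dataset \<open>D\<close>; only the first iteration
  starts with an empty one. The supremum is attained, since the model class is compact.
\<close>

definition confidence_set ::
    "nat \<Rightarrow> nat \<Rightarrow> nat \<Rightarrow> nat \<Rightarrow> nat \<Rightarrow> real \<Rightarrow> real \<Rightarrow> dataset \<Rightarrow> param set" where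
  "confidence_set nS nA nO H m \<alpha> \<beta> D =
     {\<theta>\<in>params nS nA nO H.
        D \<noteq> [] \<longrightarrow>
        log_likelihood H D \<theta> \<ge> (SUP \<theta>'\<in>params nS nA nO H. log_likelihood H D \<theta>') - ereal \<beta>} \<inter>
     {\<theta>\<in>params nS nA nO H. min_singular_value nS nA nO H m \<theta> \<ge> \<alpha>}"

text \<open>
  \<open>select\<close> is a deterministic planner: it maps the current dataset to the pair of an optimistic
  model and an optimistic policy, with ties (and the choice for an empty confidence set)
  resolved in an arbitrary way.
\<close>

definition optimistic_planner ::
    "nat \<Rightarrow> nat \<Rightarrow> nat \<Rightarrow> nat \<Rightarrow> (nat \<Rightarrow> nat \<Rightarrow> real) \<Rightarrow> nat \<Rightarrow> real \<Rightarrow> real \<Rightarrow>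
     (dataset \<Rightarrow> param \<times> policy) \<Rightarrow> bool" where
  "optimistic_planner nS nA nO H r m \<alpha> \<beta> select \<longleftrightarrow>
     (\<forall>D\<in>lists (policies nA nO H \<times> trajectories nA nO H).
        select D \<in> params nS nA nO H \<times> policies nA nO H \<and>
        (confidence_set nS nA nO H m \<alpha> \<beta> D \<noteq> {} \<longrightarrow>
         is_arg_max (\<lambda>(\<theta>, \<pi>). policy_value H r \<theta> \<pi>)
           (\<lambda>x. x \<in> confidence_set nS nA nO H m \<alpha> \<beta> D \<times> policies nA nO H) (select D)))"

definition then_uniform :: "nat \<Rightarrow> policy \<Rightarrow> nat \<Rightarrow> policy" where
  "then_uniform nA \<pi> h = (\<lambda>\<tau> x. if length \<tau> < h then \<pi> \<tau> x else pmf_of_set {..<nA})"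

fun collect_data :: "nat \<Rightarrow> nat \<Rightarrow> param \<Rightarrow> policy \<Rightarrow> nat list \<Rightarrow> dataset pmf" where
  "collect_data nA H \<theta> \<pi> [] = return_pmf []"
| "collect_data nA H \<theta> \<pi> (h # hs) =
     do {
       \<tau> \<leftarrow> trajectory_pmf H \<theta> (then_uniform nA \<pi> h);
       D \<leftarrow> collect_data nA H \<theta> \<pi> hs;
       return_pmf ((then_uniform nA \<pi> h, \<tau>) # D)
     }"

text \<open>
  Joint distribution, when the true model is \<open>\<theta>\<close>, of the policies \<open>\<pi>\<^sup>1, \<dots>, \<pi>\<^sup>k\<close> computed in the
  first \<open>k\<close> iterations and the dataset at the end of them. The inputs \<open>\<alpha>\<close> and \<open>\<beta>\<close> enter through
  the planner.
\<close>

fun omle :: "nat \<Rightarrow> nat \<Rightarrow> nat \<Rightarrow> (dataset \<Rightarrow> param \<times> policy) \<Rightarrow> param \<Rightarrow> nat \<Rightarrow>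
    (policy list \<times> dataset) pmf" where
  "omle nA H m select \<theta> 0 = return_pmf ([], [])"
| "omle nA H m select \<theta> (Suc k) =
     do {
       (\<pi>s, D) \<leftarrow> omle nA H m select \<theta> k;
       let \<pi> = snd (select D);
       D' \<leftarrow> collect_data nA H \<theta> \<pi> [0..<H - m + 1];
       return_pmf (\<pi>s @ [\<pi>], D @ D')
     }"

end

theory Submission
  imports Defs
begin

text \<open>
  Rounding all probabilities up to multiples of \<open>1 / N\<close> and renormalizing gives a finite set of models
  such that every model assigns to each trajectory at most \<open>1 + \<epsilon>\<close> times the probability that some
  model of the finite set assigns to it. For a fixed model \<open>\<theta>'\<close>, the product over the episodes of
  \<open>sqrt (P\<^sub>\<theta>\<^sub>' / P\<^sub>\<theta>) * exp (1 - affinity)\<close> has expectation at most 1. By Markov's inequality and a union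
  bound, with high probability the true model \<open>\<theta>\<close> lies in all confidence sets, and for every member of
  a confidence set the squared \<open>\<ell>\<^sub>1\<close>-errors on the past data policies sum up to \<open>O(\<beta>)\<close>.

  A left inverse of the \<open>m\<close>-step likelihood matrix of an optimistic model \<open>\<phi>\<close> translates state vectors
  of \<open>\<theta>\<close> into state vectors of \<open>\<phi>\<close>. The defect by which this translation fails to commute with the
  dynamics is linear in the state vector of \<open>\<theta>\<close>; its expectation under a past policy is bounded by the
  error on the data collected with that policy, and its expectation under the current policy bounds the
  current error. An elliptical potential argument for \<open>\<ell>\<^sub>1\<close>-sums bounds the sum of the latter by the
  former: adding \<open>x x\<^sup>T\<close> divided by the dual norm of \<open>x\<close>, instead of \<open>x x\<^sup>T\<close> itself, makes the
  determinant control sums of dual norms, without any dependence on the number of vectors.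
\<close>

section \<open>Quadratic forms and the elliptical potential\<close>

text \<open>The obstacle is the number of state vectors: at step \<open>h\<close> there is one for
  every history, exponentially many in \<open>h\<close>. A bound on current errors by past ones may
  therefore depend only on the dimension \<open>nS\<close> and on the total weighted mass of these
  vectors, which is at most 1 per iteration. The vectors belong to the fixed model \<theta>; across
  iterations only their weights (the policy probabilities) and the functionals (the defects of the
  optimistic model) change. Log-likelihoods are unbounded below, so an additive approximation of
  models would be useless. Rounding up keeps every support, and the multiplicative error stays below
  \<open>exp 1\<close> over all episodes. The square root of the likelihood ratio is used because
  its expectation, the Hellinger affinity, falls short of 1 by an amount that controls squared
  l1-distances: one event then bounds both the likelihood of wrong models and their distance from
  \<theta>. Uniform actions after step \<open>h\<close> cost a factor \<open>nA\<close> only for the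
  at most \<open>m + 1\<close> steps that the left inverse looks ahead, hence powers of
  \<open>nA ^ m\<close> and not of \<open>nA ^ H\<close>.\<close>

definition dot :: "nat \<Rightarrow> (nat \<Rightarrow> real) \<Rightarrow> (nat \<Rightarrow> real) \<Rightarrow> real" where
  "dot d g h = (\<Sum>i<d. g i * h i)"

definition mat_form :: "nat \<Rightarrow> real mat \<Rightarrow> (nat \<Rightarrow> real) \<Rightarrow> (nat \<Rightarrow> real) \<Rightarrow> real" where
  "mat_form d A g h = (\<Sum>i<d. \<Sum>j<d. g i * A $$ (i, j) * h j)"

lemma dot_commute: "dot d g h = dot d h g"
  by (simp add: dot_def mult.commute)

lemma dot_nonneg: "0 \<le> dot d g g"
  by (auto simp: dot_def intro: sum_nonneg)

lemma mat_form_diff: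
  "mat_form d A (\<lambda>i. g i - t * z i) (\<lambda>i. g i - t * z i) =
   mat_form d A g g - t * mat_form d A g z - t * mat_form d A z g + t\<^sup>2 * mat_form d A z z"
  by (simp add: mat_form_def sum_distrib_left sum_subtractf [symmetric] sum.distrib [symmetric]
      algebra_simps power2_eq_square)

lemma mat_form_commute:
  assumes "\<And>i j. i < d \<Longrightarrow> j < d \<Longrightarrow> A $$ (i, j) = A $$ (j, i)"
  shows "mat_form d A g h = mat_form d A h g"
  unfolding mat_form_def
  by (subst sum.swap, intro sum.cong refl) (use assms in \<open>auto simp: mult_ac\<close>)

text \<open>The form at \<open>g - t z\<close> is a nonnegative quadratic in \<open>t\<close>; its
  value at the minimizing \<open>t\<close> is the inequality. A separate argument covers vectors
  \<open>z\<close> on which the form vanishes, since it need not be definite.\<close>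

lemma mat_form_Cauchy_Schwarz:
  assumes sym: "\<And>i j. i < d \<Longrightarrow> j < d \<Longrightarrow> A $$ (i, j) = A $$ (j, i)"
    and psd: "\<And>g. 0 \<le> mat_form d A g g"
  shows "\<bar>mat_form d A g z\<bar> \<le> sqrt (mat_form d A g g) * sqrt (mat_form d A z z)"
proof -
  have *: "0 \<le> mat_form d A g g - 2 * t * mat_form d A g z + t\<^sup>2 * mat_form d A z z" for t
    using psd[of "\<lambda>i. g i - t * z i"] mat_form_commute[of d A z g] sym
    unfolding mat_form_diff by (simp add: algebra_simps)
  have "(mat_form d A g z)\<^sup>2 \<le> mat_form d A g g * mat_form d A z z"
  proof (cases "mat_form d A z z = 0")
    case True
    have "mat_form d A g z = 0"
    proof (rule ccontr)
      assume nz: "mat_form d A g z \<noteq> 0"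
      \<comment> \<open>The quadratic is affine in \<open>t\<close> here, and this \<open>t\<close>
        is the point where it takes the value -1.\<close>
      have "0 \<le> mat_form d A g g - 2 * ((mat_form d A g g + 1) / (2 * mat_form d A g z)) * mat_form d A g z"
        using *[of "(mat_form d A g g + 1) / (2 * mat_form d A g z)"] True by simp
      also have "\<dots> = -1" using nz by (simp add: field_simps)
      finally show False by simp
    qed
    then show ?thesis using True by simp
  next
    case False
    then have pos: "mat_form d A z z > 0" using psd[of z] by simp
    have "0 \<le> mat_form d A g g - (mat_form d A g z)\<^sup>2 / mat_form d A z z"
      using *[of "mat_form d A g z / mat_form d A z z"] pos
      by (simp add: power2_eq_square field_simps)
    then show ?thesis using pos by (simp add: field_simps)
  qed
  then have "sqrt ((mat_form d A g z)\<^sup>2) \<le> sqrt (mat_form d A g g * mat_form d A z z)"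
    by (rule real_sqrt_le_mono)
  then show ?thesis by (simp add: real_sqrt_mult)
qed

lemma mat_form_one: "mat_form d (1\<^sub>m d) g h = dot d g h"
  unfolding mat_form_def dot_def
  by (intro sum.cong refl) (auto simp: if_distrib if_distribR cong: if_cong)

lemma dot_Cauchy_Schwarz: "\<bar>dot d g h\<bar> \<le> sqrt (dot d g g) * sqrt (dot d h h)"
  using mat_form_Cauchy_Schwarz[of d "1\<^sub>m d" g h]
  by (simp add: mat_form_one dot_nonneg)

definition outer :: "nat \<Rightarrow> (nat \<Rightarrow> real) \<Rightarrow> (nat \<Rightarrow> real) \<Rightarrow> real mat" where
  "outer d z x = mat d d (\<lambda>(i, j). z i * x j)"

lemma outer_carrier [simp]: "outer d z x \<in> carrier_mat d d"
  by (simp add: outer_def)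

text \<open>The matrix determinant lemma. The bordered matrix \<open>B\<close> has blocks
  \<open>1, -c, r, 1\<close>; the unit triangular factors \<open>U\<close> and \<open>V\<close>
  clear a different off-diagonal block each, so \<open>det B\<close> equals both sides.\<close>

lemma det_one_add_outer: "det (1\<^sub>m d + outer d z x) = 1 + dot d z x"
proof -
  define c where "c = mat d 1 (\<lambda>(i, j). z i)"
  define r where "r = mat 1 d (\<lambda>(i, j). x j)"
  have c: "c \<in> carrier_mat d 1" and r: "r \<in> carrier_mat 1 d"
    by (auto simp: c_def r_def)
  have cr: "c * r = outer d z x"
    by (rule eq_matI) (auto simp: c_def r_def outer_def scalar_prod_def)
  have rc: "r * c = mat 1 1 (\<lambda>_. dot d z x)"
    by (rule eq_matI) (auto simp: c_def r_def scalar_prod_def dot_def lessThan_atLeast0 mult.commute)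
  define B where "B = four_block_mat (1\<^sub>m d) (- c) r (1\<^sub>m 1)"
  have B: "B \<in> carrier_mat (d + 1) (d + 1)" unfolding B_def by (rule four_block_carrier_mat) auto
  define U where "U = four_block_mat (1\<^sub>m d) (0\<^sub>m d 1) (- r) (1\<^sub>m 1)"
  define V where "V = four_block_mat (1\<^sub>m d) c (0\<^sub>m 1 d) (1\<^sub>m 1)"
  have U: "U \<in> carrier_mat (d + 1) (d + 1)" and V: "V \<in> carrier_mat (d + 1) (d + 1)"
    unfolding U_def V_def by (rule four_block_carrier_mat; simp)+
  have UB: "U * B = four_block_mat (1\<^sub>m d) (- c) (0\<^sub>m 1 d) (r * c + 1\<^sub>m 1)"
    unfolding U_def B_def using c r
    by (subst mult_four_block_mat[where ?nr1.0 = d and ?n1.0 = d and ?n2.0 = 1 and ?nr2.0 = 1 and ?nc1.0 = d and ?nc2.0 = 1])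
       (auto simp: uminus_l_inv_mat)
  have VB: "V * B = four_block_mat (1\<^sub>m d + c * r) (0\<^sub>m d 1) r (1\<^sub>m 1)"
    unfolding V_def B_def using c r
    by (subst mult_four_block_mat[where ?nr1.0 = d and ?n1.0 = d and ?n2.0 = 1 and ?nr2.0 = 1 and ?nc1.0 = d and ?nc2.0 = 1])
       (auto simp: uminus_l_inv_mat)
  have dU: "det U = 1" unfolding U_def
    by (subst det_four_block_mat_upper_right_zero[of _ d _ 1]) (use r in auto)
  have dV: "det V = 1" unfolding V_def
    by (subst det_four_block_mat_lower_left_zero[of _ d _ 1]) (use c in auto)
  have "det B = det (r * c + 1\<^sub>m 1)"
  proof -
    have "det B = det (U * B)" using det_mult[OF U B] dU by simp
    also have "\<dots> = det (r * c + 1\<^sub>m 1)" unfolding UB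
      by (subst det_four_block_mat_lower_left_zero[of _ d _ 1]) (use c r in auto)
    finally show ?thesis .
  qed
  moreover have "det B = det (1\<^sub>m d + c * r)"
  proof -
    have "det B = det (V * B)" using det_mult[OF V B] dV by simp
    also have "\<dots> = det (1\<^sub>m d + c * r)" unfolding VB
      by (subst det_four_block_mat_upper_right_zero[of _ d _ 1]) (use c r in auto)
    finally show ?thesis .
  qed
  moreover have "det (r * c + 1\<^sub>m 1) = 1 + dot d z x"
    unfolding rc by (subst det_single) auto
  ultimately show ?thesis using cr by simp
qed

lemma mat_inverse_entries:
  fixes A :: "real mat"
  assumes A: "A \<in> carrier_mat d d" and inj: "det A \<noteq> 0"
  shows "\<exists>N. \<forall>i<d. \<forall>k<d.
    (\<Sum>j<d. A $$ (i, j) * N j k) = (if i = k then 1 else 0) \<and>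
    (\<Sum>j<d. N i j * A $$ (j, k)) = (if i = k then 1 else 0)"
proof -
  from det_non_zero_imp_unit[OF A inj]
  obtain B where B: "B \<in> carrier_mat d d" and AB: "A * B = 1\<^sub>m d" and BA: "B * A = 1\<^sub>m d"
    unfolding Units_def by (auto simp: ring_mat_def)
  have 1: "(\<Sum>j<d. A $$ (i, j) * B $$ (j, k)) = (if i = k then 1 else 0)" if "i < d" "k < d" for i k
  proof -
    have "(\<Sum>j<d. A $$ (i, j) * B $$ (j, k)) = (A * B) $$ (i, k)"
      using A B that by (auto simp: scalar_prod_def lessThan_atLeast0)
    then show ?thesis using that by (simp add: AB)
  qed
  have 2: "(\<Sum>j<d. B $$ (i, j) * A $$ (j, k)) = (if i = k then 1 else 0)" if "i < d" "k < d" for i k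
  proof -
    have "(\<Sum>j<d. B $$ (i, j) * A $$ (j, k)) = (B * A) $$ (i, k)"
      using A B that by (auto simp: scalar_prod_def lessThan_atLeast0)
    then show ?thesis using that by (simp add: BA)
  qed
  from 1 2 show ?thesis by (intro exI[of _ "\<lambda>i j. B $$ (i, j)"]) simp
qed

lemma mat_solve:
  fixes A :: "real mat"
  assumes A: "A \<in> carrier_mat d d" and inj: "det A \<noteq> 0"
  obtains z where "\<And>i. i < d \<Longrightarrow> (\<Sum>j<d. A $$ (i, j) * z j) = x i"
proof -
  from mat_inverse_entries[OF A inj] obtain N where N: "\<forall>i<d. \<forall>k<d.
      (\<Sum>j<d. A $$ (i, j) * N j k) = (if i = k then 1 else 0) \<and>
      (\<Sum>j<d. N i j * A $$ (j, k)) = (if i = k then 1 else 0)" ..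
  have "(\<Sum>j<d. A $$ (i, j) * (\<Sum>k<d. N j k * x k)) = x i" if i: "i < d" for i
  proof -
    have "(\<Sum>j<d. A $$ (i, j) * (\<Sum>k<d. N j k * x k)) = (\<Sum>k<d. (\<Sum>j<d. A $$ (i, j) * N j k) * x k)"
      unfolding sum_distrib_left sum_distrib_right by (subst sum.swap) (simp add: mult_ac)
    also have "\<dots> = (\<Sum>k<d. (if i = k then 1 else 0) * x k)"
      using N i by (intro sum.cong refl) simp
    also have "\<dots> = x i" using i by (simp add: if_distrib if_distribR cong: if_cong)
    finally show ?thesis .
  qed
  then show ?thesis by (rule that)
qed

text \<open>Here \<open>q\<close> is the dual norm of \<open>x\<close>, that is
  \<open>q\<^sup>2 = x\<^sup>T A\<^sup>-\<^sup>1 x\<close>, and \<open>c = 1 / q\<close>. The update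
  multiplies the determinant by \<open>1 + c * q\<^sup>2 = 1 + q\<close>, so the dual norm enters
  linearly. The first bound is Cauchy-Schwarz in the form of \<open>A\<close>, the second is the
  first divided by \<open>q\<close>.\<close>

lemma rank_one_step:
  fixes A :: "real mat" and x :: "nat \<Rightarrow> real"
  assumes A: "A \<in> carrier_mat d d"
    and sym: "\<And>i j. i < d \<Longrightarrow> j < d \<Longrightarrow> A $$ (i, j) = A $$ (j, i)"
    and ge: "\<And>g. dot d g g \<le> mat_form d A g g"
    and detA: "det A > 0"
    and x: "dot d x x \<le> 1"
  obtains q c where "0 \<le> q" "q \<le> 1" "0 \<le> c"
    "\<And>g. \<bar>dot d g x\<bar> \<le> sqrt (mat_form d A g g) * q"
    "\<And>g. c * \<bar>dot d g x\<bar> \<le> sqrt (mat_form d A g g)"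
    "det (A + c \<cdot>\<^sub>m outer d x x) = det A * (1 + q)"
proof -
  have psd: "0 \<le> mat_form d A g g" for g using ge[of g] dot_nonneg[of d g] by linarith
  obtain z where z: "\<And>i. i < d \<Longrightarrow> (\<Sum>j<d. A $$ (i, j) * z j) = x i"
    using mat_solve[OF A] detA by (metis less_irrefl)
  have Qz: "mat_form d A g z = dot d g x" for g
    unfolding mat_form_def dot_def using z
    by (intro sum.cong refl) (simp add: sum_distrib_left[symmetric] mult.assoc)
  define q where "q = sqrt (mat_form d A z z)"
  have q0: "0 \<le> q" using psd by (simp add: q_def)
  have b1: "\<bar>dot d g x\<bar> \<le> sqrt (mat_form d A g g) * q" for g
    using mat_form_Cauchy_Schwarz[of d A g z] sym psd by (simp add: Qz q_def)
  have q2: "q\<^sup>2 = dot d z x" using psd[of z] by (simp add: q_def Qz)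
  \<comment> \<open>The form of \<open>A\<close> dominates the Euclidean one, so the Euclidean norm
    of \<open>z\<close> is at most \<open>q\<close>; hence
    \<open>q\<^sup>2 = z . x \<le> q\<close>.\<close>
  have q1: "q \<le> 1"
  proof -
    have "q\<^sup>2 \<le> sqrt (dot d z z) * sqrt (dot d x x)"
      using dot_Cauchy_Schwarz[of d z x] by (simp add: q2)
    also have "\<dots> \<le> q * 1"
      using ge[of z] x psd[of z] by (intro mult_mono) (auto simp: q_def dot_nonneg)
    finally have "q * q \<le> q * 1" by (simp add: power2_eq_square)
    then show ?thesis using q0 by (cases "q = 0") auto
  qed
  \<comment> \<open>If \<open>q = 0\<close>, then \<open>inverse 0 = 0\<close> makes the update
    void, and all claims remain true.\<close>
  define c where "c = inverse q"
  have c0: "0 \<le> c" using q0 by (simp add: c_def)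
  have b2: "c * \<bar>dot d g x\<bar> \<le> sqrt (mat_form d A g g)" for g
  proof (cases "q = 0")
    case False
    then show ?thesis using b1[of g] q0 by (simp add: c_def field_simps)
  qed (use psd in \<open>simp add: c_def\<close>)
  have "A + c \<cdot>\<^sub>m outer d x x = A * (1\<^sub>m d + outer d (\<lambda>i. c * z i) x)"
  proof -
    have "A * outer d (\<lambda>i. c * z i) x = c \<cdot>\<^sub>m outer d x x"
    proof (rule eq_matI)
      fix i j assume "i < dim_row (c \<cdot>\<^sub>m outer d x x)" "j < dim_col (c \<cdot>\<^sub>m outer d x x)"
      then have ij: "i < d" "j < d" by (auto simp: outer_def)
      have "(A * outer d (\<lambda>i. c * z i) x) $$ (i, j) = (\<Sum>k<d. A $$ (i, k) * (c * z k * x j))"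
        using A ij by (auto simp: scalar_prod_def outer_def lessThan_atLeast0)
      also have "\<dots> = c * x j * (\<Sum>k<d. A $$ (i, k) * z k)"
        by (simp add: sum_distrib_left mult_ac)
      finally show "(A * outer d (\<lambda>i. c * z i) x) $$ (i, j) = (c \<cdot>\<^sub>m outer d x x) $$ (i, j)"
        using z ij by (simp add: outer_def)
    qed (use A in \<open>auto simp: outer_def\<close>)
    then show ?thesis using A by (subst mult_add_distrib_mat[of _ d d _ d]) auto
  qed
  then have "det (A + c \<cdot>\<^sub>m outer d x x) = det A * det (1\<^sub>m d + outer d (\<lambda>i. c * z i) x)"
    using A by (simp add: det_mult[of _ d])
  also have "det (1\<^sub>m d + outer d (\<lambda>i. c * z i) x) = 1 + c * q\<^sup>2"
    by (simp add: det_one_add_outer q2 dot_def sum_distrib_left mult_ac)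
  also have "c * q\<^sup>2 = q" by (cases "q = 0") (auto simp: c_def power2_eq_square)
  finally have "det (A + c \<cdot>\<^sub>m outer d x x) = det A * (1 + q)" .
  then show ?thesis using that q0 q1 c0 b1 b2 by blast
qed


section \<open>Weighted Gram matrices and sums of dual norms\<close>

definition weighted_gram :: "nat \<Rightarrow> (nat \<Rightarrow> real) \<Rightarrow> (nat \<Rightarrow> nat \<Rightarrow> real) \<Rightarrow> nat \<Rightarrow> real mat" where
  "weighted_gram d c x n =
     mat d d (\<lambda>(i, j). (if i = j then 1 else 0) + (\<Sum>k<n. c k * (x k i * x k j)))"

lemma weighted_gram_carrier [simp]: "weighted_gram d c x n \<in> carrier_mat d d"
  by (simp add: weighted_gram_def)

lemma weighted_gram_cong:
  "(\<And>k. k < n \<Longrightarrow> c k = c' k) \<Longrightarrow> weighted_gram d c x n = weighted_gram d c' x n"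
  unfolding weighted_gram_def by (intro cong_mat refl) auto

lemma mat_form_weighted_gram:
  "mat_form d (weighted_gram d c x n) g h =
   dot d g h + (\<Sum>k<n. c k * (dot d g (x k) * dot d h (x k)))"
proof -
  have "mat_form d (weighted_gram d c x n) g h =
    (\<Sum>i<d. \<Sum>j<d. g i * (if i = j then 1 else 0) * h j + (\<Sum>k<n. c k * ((g i * x k i) * (h j * x k j))))"
    unfolding mat_form_def weighted_gram_def
    by (intro sum.cong refl) (simp add: algebra_simps sum_distrib_left sum_distrib_right)
  also have "\<dots> = mat_form d (1\<^sub>m d) g h + (\<Sum>i<d. \<Sum>j<d. \<Sum>k<n. c k * ((g i * x k i) * (h j * x k j)))"
    by (simp add: sum.distrib mat_form_def)
  also have "(\<Sum>i<d. \<Sum>j<d. \<Sum>k<n. c k * ((g i * x k i) * (h j * x k j))) =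
     (\<Sum>k<n. \<Sum>i<d. \<Sum>j<d. c k * ((g i * x k i) * (h j * x k j)))"
    by (subst (2) sum.swap, subst sum.swap) simp
  also have "\<dots> = (\<Sum>k<n. c k * (dot d g (x k) * dot d h (x k)))"
    unfolding dot_def sum_product by (simp add: sum_distrib_left)
  finally show ?thesis by (simp add: mat_form_one)
qed

lemma weighted_gram_Suc:
  "weighted_gram d c x (Suc n) = weighted_gram d c x n + c n \<cdot>\<^sub>m outer d (x n) (x n)"
  by (rule eq_matI) (auto simp: weighted_gram_def outer_def)

text \<open>
  Dividing each rank-one update by the current dual norm of its vector makes the growth of the
  determinant control the sum of the dual norms \<open>q k\<close> themselves instead of their squares.
\<close>

lemma l1_elliptic_weights:
  fixes x :: "nat \<Rightarrow> nat \<Rightarrow> real"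
  assumes x: "\<And>k. dot d (x k) (x k) \<le> 1"
  shows "\<exists>c q. (\<forall>k<n. 0 \<le> q k \<and> q k \<le> 1 \<and> 0 \<le> c k \<and>
      (\<forall>g. \<bar>dot d g (x k)\<bar> \<le> sqrt (mat_form d (weighted_gram d c x k) g g) * q k) \<and>
      (\<forall>g. c k * \<bar>dot d g (x k)\<bar> \<le> sqrt (mat_form d (weighted_gram d c x k) g g))) \<and>
    det (weighted_gram d c x n) = (\<Prod>k<n. 1 + q k)"
proof (induction n)
  case 0
  have "weighted_gram d c x 0 = 1\<^sub>m d" for c
    by (rule eq_matI) (auto simp: weighted_gram_def)
  then show ?case by (auto simp: det_one)
next
  case (Suc n)
  then obtain c q where IH: "\<forall>k<n. 0 \<le> q k \<and> q k \<le> 1 \<and> 0 \<le> c k \<and>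
      (\<forall>g. \<bar>dot d g (x k)\<bar> \<le> sqrt (mat_form d (weighted_gram d c x k) g g) * q k) \<and>
      (\<forall>g. c k * \<bar>dot d g (x k)\<bar> \<le> sqrt (mat_form d (weighted_gram d c x k) g g))"
    and detn: "det (weighted_gram d c x n) = (\<Prod>k<n. 1 + q k)" by blast
  let ?A = "weighted_gram d c x n"
  have sym: "?A $$ (i, j) = ?A $$ (j, i)" if "i < d" "j < d" for i j
    using that by (simp add: weighted_gram_def mult_ac)
  have ge: "dot d g g \<le> mat_form d ?A g g" for g
    unfolding mat_form_weighted_gram using IH by (auto intro!: sum_nonneg)
  have "det ?A > 0" unfolding detn using IH by (intro prod_pos) (auto simp: add_pos_nonneg)
  from rank_one_step[OF _ sym ge this x[of n]]
  obtain q' c' where *: "0 \<le> q'" "q' \<le> 1" "0 \<le> c'"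
    "\<And>g. \<bar>dot d g (x n)\<bar> \<le> sqrt (mat_form d ?A g g) * q'"
    "\<And>g. c' * \<bar>dot d g (x n)\<bar> \<le> sqrt (mat_form d ?A g g)"
    "det (?A + c' \<cdot>\<^sub>m outer d (x n) (x n)) = det ?A * (1 + q')" by auto
  define C Q where "C = c(n := c')" and "Q = q(n := q')"
  have CA: "weighted_gram d C x k = weighted_gram d c x k" if "k \<le> n" for k
    using that by (intro weighted_gram_cong) (auto simp: C_def)
  have 1: "0 \<le> Q k \<and> Q k \<le> 1 \<and> 0 \<le> C k \<and>
      (\<forall>g. \<bar>dot d g (x k)\<bar> \<le> sqrt (mat_form d (weighted_gram d C x k) g g) * Q k) \<and>
      (\<forall>g. C k * \<bar>dot d g (x k)\<bar> \<le> sqrt (mat_form d (weighted_gram d C x k) g g))"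
    if "k < Suc n" for k
  proof (cases "k = n")
    case True
    then show ?thesis using *(1-5) CA[of n] by (simp add: C_def Q_def)
  next
    case False
    then have k: "k < n" using that by simp
    have "C k = c k" "Q k = q k" using k by (simp_all add: C_def Q_def)
    then show ?thesis using IH k CA[of k] by simp
  qed
  have "det (weighted_gram d C x (Suc n)) = det ?A * (1 + q')"
    using *(6) CA[of n] by (simp add: weighted_gram_Suc) (simp add: C_def)
  also have "\<dots> = (\<Prod>k<Suc n. 1 + Q k)"
    unfolding detn by (simp add: Q_def)
  finally have 2: "det (weighted_gram d C x (Suc n)) = (\<Prod>k<Suc n. 1 + Q k)" .
  from 1 2 show ?case by blast
qed

text \<open>A crude Leibniz bound is good enough because only the logarithm of the determinant is
  used: the factorial costs no more than \<open>d\<^sup>2\<close> there.\<close>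

lemma abs_det_le:
  fixes A :: "real mat"
  assumes A: "A \<in> carrier_mat d d" and T: "\<And>i j. i < d \<Longrightarrow> j < d \<Longrightarrow> \<bar>A $$ (i, j)\<bar> \<le> T"
  shows "\<bar>det A\<bar> \<le> fact d * T ^ d"
proof -
  have "\<bar>det A\<bar> \<le> (\<Sum>p\<in>{p. p permutes {0..<d}}. \<bar>signof p * (\<Prod>i = 0..<d. A $$ (i, p i))\<bar>)"
    using A by (auto simp: det_def intro: sum_abs)
  also have "\<dots> \<le> (\<Sum>p\<in>{p. p permutes {0..<d}}. T ^ d)"
  proof (intro sum_mono)
    fix p assume "p \<in> {p. p permutes {0..<d}}"
    then have p: "p permutes {0..<d}" by simp
    have "\<bar>signof p * (\<Prod>i = 0..<d. A $$ (i, p i))\<bar> = (\<Prod>i = 0..<d. \<bar>A $$ (i, p i)\<bar>)"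
      by (simp add: abs_mult abs_prod sign_def)
    also have "\<dots> \<le> (\<Prod>i = 0..<d. T)"
      using T permutes_in_image[OF p] by (intro prod_mono) auto
    finally show "\<bar>signof p * (\<Prod>i = 0..<d. A $$ (i, p i))\<bar> \<le> T ^ d" by simp
  qed
  also have "\<dots> = fact d * T ^ d"
    by (simp add: card_permutations[of _ d])
  finally show ?thesis .
qed

text \<open>Two facts about the weighted Gram matrix. The norm of \<open>g\<close> in it is at most
  the Euclidean norm plus the l1-sum of past pairings, since an update adds at most
  \<open>sqrt Q * u\<close> to the squared norm \<open>Q\<close> when the pairing has size
  \<open>u\<close>. Its entries are bounded by the total Euclidean mass of the vectors, so the
  number \<open>n\<close> never enters the bound on the determinant.\<close>

lemma l1_elliptic:
  fixes x :: "nat \<Rightarrow> nat \<Rightarrow> real"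
  assumes x: "\<And>k. dot d (x k) (x k) \<le> 1"
  obtains q where
    "\<And>k. k < n \<Longrightarrow> 0 \<le> q k"
    "\<And>k g. k < n \<Longrightarrow> \<bar>dot d g (x k)\<bar> \<le> (sqrt (dot d g g) + (\<Sum>j<k. \<bar>dot d g (x j)\<bar>)) * q k"
    "(\<Sum>k<n. q k) \<le> 2 * (real d ^ 2 + 2 * real d * ln (1 + (\<Sum>k<n. sqrt (dot d (x k) (x k)))))"
proof -
  obtain c q where cq: "\<And>k. k < n \<Longrightarrow> 0 \<le> q k" "\<And>k. k < n \<Longrightarrow> q k \<le> 1" "\<And>k. k < n \<Longrightarrow> 0 \<le> c k"
     "\<And>k g. k < n \<Longrightarrow> \<bar>dot d g (x k)\<bar> \<le> sqrt (mat_form d (weighted_gram d c x k) g g) * q k"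
     "\<And>k g. k < n \<Longrightarrow> c k * \<bar>dot d g (x k)\<bar> \<le> sqrt (mat_form d (weighted_gram d c x k) g g)"
    and det: "det (weighted_gram d c x n) = (\<Prod>k<n. 1 + q k)"
    using l1_elliptic_weights[where d = d and x = x and n = n, OF x] by blast
  have form: "0 \<le> mat_form d (weighted_gram d c x k) g g \<and>
      sqrt (mat_form d (weighted_gram d c x k) g g) \<le> sqrt (dot d g g) + (\<Sum>j<k. \<bar>dot d g (x j)\<bar>)"
    if "k \<le> n" for k g
    using that
  proof (induction k)
    case 0
    then show ?case by (simp add: mat_form_weighted_gram dot_nonneg)
  next
    case (Suc k)
    let ?Q = "mat_form d (weighted_gram d c x k) g g" and ?u = "\<bar>dot d g (x k)\<bar>"
    have k: "k < n" and Q0: "0 \<le> ?Q"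
      and Q1: "sqrt ?Q \<le> sqrt (dot d g g) + (\<Sum>j<k. \<bar>dot d g (x j)\<bar>)"
      using Suc by simp_all
    have eq: "mat_form d (weighted_gram d c x (Suc k)) g g = ?Q + c k * ?u * ?u"
      by (simp add: mat_form_weighted_gram abs_mult_self_eq mult.assoc)
    have "?Q + c k * ?u * ?u \<le> ?Q + sqrt ?Q * ?u"
      using cq(5)[OF k, of g] by (intro add_left_mono mult_right_mono) auto
    also have "\<dots> \<le> (sqrt ?Q + ?u)\<^sup>2"
      using Q0 by (simp add: power2_sum)
    finally have "sqrt (?Q + c k * ?u * ?u) \<le> sqrt ?Q + ?u"
      using Q0 by (intro real_le_lsqrt) auto
    moreover have "0 \<le> ?Q + c k * ?u * ?u" using Q0 cq(3)[OF k] by simp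
    ultimately show ?case using Q1 eq by simp
  qed
  have q0: "0 \<le> q k" if "k < n" for k using cq(1) that .
  have b: "\<bar>dot d g (x k)\<bar> \<le> (sqrt (dot d g g) + (\<Sum>j<k. \<bar>dot d g (x j)\<bar>)) * q k" if "k < n" for k g
    using cq(4)[OF that, of g] mult_right_mono[OF _ q0[OF that]] form[of k g] that
    by (meson less_imp_le order_trans)
  define X where "X = (\<Sum>k<n. sqrt (dot d (x k) (x k)))"
  have X0: "0 \<le> X" by (auto simp: X_def dot_nonneg intro!: sum_nonneg)
  \<comment> \<open>The weight \<open>c k\<close> may be huge for vectors of small dual norm. The
    second weight bound with \<open>g = x k\<close> controls \<open>c k\<close> times the squared
    norm of \<open>x k\<close>, which is all that the entries need.\<close>
  have entry: "\<bar>weighted_gram d c x n $$ (i, j)\<bar> \<le> (1 + X)\<^sup>2" if ij: "i < d" "j < d" for i j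
  proof -
    have "\<bar>c k * (x k i * x k j)\<bar> \<le> sqrt (dot d (x k) (x k)) * (1 + X)" if k: "k < n" for k
    proof -
      have sq: "(x k i)\<^sup>2 \<le> dot d (x k) (x k)" if "i < d" for i
        unfolding dot_def power2_eq_square using that
        by (intro member_le_sum[where f = "\<lambda>i. x k i * x k i"]) auto
      have "\<bar>x k i * x k j\<bar> \<le> dot d (x k) (x k)"
      proof -
        have "2 * \<bar>x k i * x k j\<bar> \<le> (x k i)\<^sup>2 + (x k j)\<^sup>2"
          using sum_squares_bound[of "\<bar>x k i\<bar>" "\<bar>x k j\<bar>"] by (simp add: abs_mult)
        then show ?thesis using sq[of i] sq[of j] ij by simp
      qed
      then have "\<bar>c k * (x k i * x k j)\<bar> \<le> c k * \<bar>dot d (x k) (x k)\<bar>"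
        using cq(3)[OF k] dot_nonneg[of d "x k"]
        by (simp add: abs_mult mult_left_mono)
      also have "\<dots> \<le> sqrt (dot d (x k) (x k)) + (\<Sum>j<k. \<bar>dot d (x k) (x j)\<bar>)"
        using cq(5)[OF k, of "x k"] form[of k "x k"] k by force
      also have "\<dots> \<le> sqrt (dot d (x k) (x k)) + (\<Sum>j<k. sqrt (dot d (x k) (x k)) * sqrt (dot d (x j) (x j)))"
        by (intro add_left_mono sum_mono dot_Cauchy_Schwarz)
      also have "\<dots> \<le> sqrt (dot d (x k) (x k)) + (\<Sum>j<n. sqrt (dot d (x k) (x k)) * sqrt (dot d (x j) (x j)))"
        using k by (intro add_left_mono sum_mono2) (auto simp: dot_nonneg)
      also have "\<dots> = sqrt (dot d (x k) (x k)) * (1 + X)"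
        by (simp add: X_def sum_distrib_left algebra_simps)
      finally show ?thesis .
    qed
    then have "(\<Sum>k<n. \<bar>c k * (x k i * x k j)\<bar>) \<le> (\<Sum>k<n. sqrt (dot d (x k) (x k)) * (1 + X))"
      by (intro sum_mono) auto
    also have "\<dots> = X * (1 + X)" by (simp add: X_def sum_distrib_right)
    finally have s: "(\<Sum>k<n. \<bar>c k * (x k i * x k j)\<bar>) \<le> X * (1 + X)" .
    have "\<bar>weighted_gram d c x n $$ (i, j)\<bar> \<le> 1 + \<bar>\<Sum>k<n. c k * (x k i * x k j)\<bar>"
      using ij abs_triangle_ineq[of 1 "\<Sum>k<n. c k * (x k i * x k j)"]
      by (auto simp: weighted_gram_def)
    also have "\<dots> \<le> 1 + (\<Sum>k<n. \<bar>c k * (x k i * x k j)\<bar>)"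
      by (intro add_left_mono sum_abs)
    also have "\<dots> \<le> (1 + X)\<^sup>2" using s X0 by (simp add: power2_eq_square algebra_simps)
    finally show ?thesis .
  qed
  have "(\<Prod>k<n. 1 + q k) \<le> fact d * ((1 + X)\<^sup>2) ^ d"
    using abs_det_le[OF weighted_gram_carrier entry] det by simp
  also have "\<dots> \<le> exp (real d) ^ d * ((1 + X)\<^sup>2) ^ d"
  proof (intro mult_right_mono)
    have "(fact d :: real) \<le> real d ^ d" using fact_le_power[of d] by simp
    also have "\<dots> \<le> exp (real d) ^ d"
      using exp_ge_add_one_self[of "real d"] by (intro power_mono) linarith+
    finally show "fact d \<le> exp (real d) ^ d" .
  qed auto
  finally have prod: "(\<Prod>k<n. 1 + q k) \<le> exp (real d) ^ d * ((1 + X)\<^sup>2) ^ d" .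
  have pos: "0 < (\<Prod>k<n. 1 + q k)" using q0 by (intro prod_pos) (auto simp: add_pos_nonneg)
  have nz: "1 + q k \<noteq> 0" if "k < n" for k using q0[OF that] by linarith
  \<comment> \<open>The comparison of \<open>q\<close> with \<open>2 * ln (1 + q)\<close> uses
    \<open>q \<le> 1\<close>, which goes back to the norm bound on the vectors.\<close>
  have "(\<Sum>k<n. q k) \<le> (\<Sum>k<n. 2 * ln (1 + q k))"
  proof (intro sum_mono)
    fix k assume "k \<in> {..<n}"
    then have k: "0 \<le> q k" "q k \<le> 1" using cq by auto
    have "q k / 2 \<le> q k / (1 + q k)" using k by (intro frac_le) auto
    also have "\<dots> = 1 - inverse (1 + q k)" using k by (simp add: field_simps)
    also have "\<dots> \<le> ln (1 + q k)"
      using ln_le_minus_one[of "inverse (1 + q k)"] k by (simp add: ln_inverse)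
    finally show "q k \<le> 2 * ln (1 + q k)" by simp
  qed
  also have "\<dots> = 2 * ln (\<Prod>k<n. 1 + q k)"
    using nz by (subst ln_prod) (auto simp: sum_distrib_left)
  also have "\<dots> \<le> 2 * ln (exp (real d) ^ d * ((1 + X)\<^sup>2) ^ d)"
    using prod pos by simp
  also have "\<dots> = 2 * (real d ^ 2 + 2 * real d * ln (1 + X))"
  proof -
    have e: "exp (real d) ^ d * ((1 + X)\<^sup>2) ^ d = exp (real d * real d) * (1 + X) ^ (2 * d)"
      by (simp only: exp_of_nat_mult power_mult)
    show ?thesis unfolding e using X0 by (simp add: ln_mult ln_realpow power2_eq_square)
  qed
  finally show ?thesis using that[of q] q0 b unfolding X_def by blast
qed

section \<open>Singular values and left inverses\<close>

text \<open>Gives the boundedness on the unit sphere that the infimum of the Rayleigh quotient and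
  the form of an inverse matrix require.\<close>

lemma mat_form_abs_le:
  assumes "dot d g g \<le> 1"
  shows "\<bar>mat_form d A g g\<bar> \<le> (\<Sum>i<d. \<Sum>j<d. \<bar>A $$ (i, j)\<bar>)"
proof -
  have g: "\<bar>g i\<bar> \<le> 1" if "i < d" for i
  proof -
    have "g i * g i \<le> dot d g g" unfolding dot_def
      using that by (intro member_le_sum[where f = "\<lambda>i. g i * g i"]) auto
    then have "(g i)\<^sup>2 \<le> 1" using assms by (simp add: power2_eq_square)
    then show ?thesis by (simp add: abs_square_le_1)
  qed
  have "\<bar>g i * A $$ (i, j) * g j\<bar> \<le> \<bar>A $$ (i, j)\<bar>" if "i < d" "j < d" for i j
  proof -
    have "\<bar>g i * A $$ (i, j) * g j\<bar> = \<bar>g i\<bar> * \<bar>A $$ (i, j)\<bar> * \<bar>g j\<bar>" by (simp add: abs_mult)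
    also have "\<dots> \<le> 1 * \<bar>A $$ (i, j)\<bar> * 1" using g that by (intro mult_mono) auto
    finally show ?thesis by simp
  qed
  then show ?thesis unfolding mat_form_def
    by (intro order_trans[OF sum_abs] sum_mono) auto
qed

text \<open>
  The infimum of the Rayleigh quotient is an eigenvalue: otherwise the shifted matrix would be
  invertible, and a positive semidefinite invertible form is bounded away from 0 on the unit sphere.
\<close>

lemma symmetric_mat_form_ge:
  fixes B :: "real mat"
  assumes B: "B \<in> carrier_mat d d"
    and sym: "\<And>i j. i < d \<Longrightarrow> j < d \<Longrightarrow> B $$ (i, j) = B $$ (j, i)"
    and ev: "\<And>k. eigenvalue B k \<Longrightarrow> a \<le> k"
  shows "a * dot d v v \<le> mat_form d B v v"
proof (cases "d = 0")
  case True
  then show ?thesis by (simp add: dot_def mat_form_def)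
next
  case False
  define U where "U = {g. dot d g g = 1}"
  define l where "l = (INF g\<in>U. mat_form d B g g)"
  have "(\<lambda>i. if i = 0 then 1 else 0) \<in> U"
    using False by (simp add: U_def dot_def if_distrib if_distribR cong: if_cong)
  then have ne: "U \<noteq> {}" by blast
  have bdd: "bdd_below ((\<lambda>g. mat_form d B g g) ` U)"
  proof (intro bdd_belowI2)
    fix g assume "g \<in> U"
    then show "- (\<Sum>i<d. \<Sum>j<d. \<bar>B $$ (i, j)\<bar>) \<le> mat_form d B g g"
      using mat_form_abs_le[of d g B] by (simp add: U_def abs_le_iff)
  qed
  have scale: "mat_form d A (\<lambda>i. c * g i) (\<lambda>i. c * g i) = c\<^sup>2 * mat_form d A g g" for A c g
    unfolding mat_form_def sum_distrib_left
    by (intro sum.cong refl) (simp add: power2_eq_square mult_ac)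
  have dscale: "dot d (\<lambda>i. c * g i) (\<lambda>i. c * g i) = c\<^sup>2 * dot d g g" for c g
    unfolding dot_def sum_distrib_left
    by (intro sum.cong refl) (simp add: power2_eq_square mult_ac)
  have lower: "l * dot d g g \<le> mat_form d B g g" for g
  proof (cases "dot d g g = 0")
    case True
    then have "g i = 0" if "i < d" for i
      using that by (simp add: dot_def sum_nonneg_eq_0_iff)
    then show ?thesis using True by (simp add: mat_form_def)
  next
    case False
    define c where "c = 1 / sqrt (dot d g g)"
    have pos: "dot d g g > 0" using False dot_nonneg[of d g] by simp
    then have c2: "c\<^sup>2 = 1 / dot d g g" by (simp add: c_def power_divide)
    have "(\<lambda>i. c * g i) \<in> U" using pos by (simp add: U_def dscale c2)
    then have "l \<le> c\<^sup>2 * mat_form d B g g"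
      unfolding l_def scale[symmetric] by (rule cINF_lower[OF bdd])
    then show ?thesis using pos by (simp add: c2 field_simps)
  qed
  define C where "C = B + (- l) \<cdot>\<^sub>m 1\<^sub>m d"
  have C: "C \<in> carrier_mat d d" using B by (simp add: C_def)
  have Cform: "mat_form d C g h = mat_form d B g h - l * dot d g h" for g h
  proof -
    have "mat_form d C g h = (\<Sum>i<d. \<Sum>j<d. g i * B $$ (i, j) * h j - l * (g i * (1\<^sub>m d) $$ (i, j) * h j))"
      unfolding mat_form_def C_def using B
      by (intro sum.cong refl) (auto simp: algebra_simps)
    also have "\<dots> = mat_form d B g h - l * mat_form d (1\<^sub>m d) g h"
      by (simp add: mat_form_def sum_subtractf sum_distrib_left)
    finally show ?thesis by (simp add: mat_form_one)
  qed
  have Cpsd: "0 \<le> mat_form d C g g" for g using lower[of g] by (simp add: Cform)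
  have Csym: "C $$ (i, j) = C $$ (j, i)" if "i < d" "j < d" for i j
    using that B sym[OF that] by (auto simp: C_def)
  have "det C = 0"
  proof (rule ccontr)
    assume "det C \<noteq> 0"
    from mat_inverse_entries[OF C this] obtain N where N: "\<forall>i<d. \<forall>k<d.
        (\<Sum>j<d. C $$ (i, j) * N j k) = (if i = k then 1 else 0) \<and>
        (\<Sum>j<d. N i j * C $$ (j, k)) = (if i = k then 1 else 0)" ..
    \<comment> \<open>An upper bound for the form of the inverse of \<open>C\<close> on the unit
      sphere; the summand 1 makes it positive.\<close>
    define b where "b = (\<Sum>i<d. \<Sum>j<d. \<bar>mat d d (\<lambda>(i, j). N i j) $$ (i, j)\<bar>) + 1"
    have b: "b > 0" by (auto simp: b_def intro!: add_nonneg_pos sum_nonneg)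
    \<comment> \<open>With \<open>u\<close> the preimage of \<open>w\<close> under \<open>C\<close>,
      the number \<open>1 = w . w\<close> is the pairing of \<open>w\<close> and \<open>u\<close> in
      the form of \<open>C\<close>. Cauchy-Schwarz bounds it by the two forms, and the form of
      \<open>C\<close> at \<open>u\<close> is that of the inverse at \<open>w\<close>, hence at most
      \<open>b\<close>.\<close>
    have "1 / b \<le> mat_form d C w w" if w: "w \<in> U" for w
    proof -
      define u where "u j = (\<Sum>k<d. N j k * w k)" for j
      have Cu: "(\<Sum>j<d. C $$ (i, j) * u j) = w i" if "i < d" for i
      proof -
        have "(\<Sum>j<d. C $$ (i, j) * u j) = (\<Sum>k<d. (\<Sum>j<d. C $$ (i, j) * N j k) * w k)"
          unfolding u_def sum_distrib_left sum_distrib_right by (subst sum.swap) (simp add: mult_ac)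
        also have "\<dots> = (\<Sum>k<d. (if i = k then 1 else 0) * w k)"
          using N that by (intro sum.cong refl) simp
        also have "\<dots> = w i" using that by (simp add: if_distrib if_distribR cong: if_cong)
        finally show ?thesis .
      qed
      have Q: "mat_form d C g u = dot d g w" for g
        unfolding mat_form_def dot_def mult.assoc sum_distrib_left[symmetric] using Cu
        by (intro sum.cong refl) simp
      have "dot d u w = mat_form d (mat d d (\<lambda>(i, j). N i j)) w w"
      proof -
        have "dot d u w = (\<Sum>i<d. \<Sum>j<d. w i * N i j * w j)"
          by (simp add: dot_def u_def sum_distrib_left sum_distrib_right mult_ac)
        then show ?thesis by (simp add: mat_form_def)
      qed
      then have le: "mat_form d C u u \<le> b"
        using mat_form_abs_le[of d w "mat d d (\<lambda>(i, j). N i j)"] w Q[of u]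
        by (simp add: U_def b_def)
      have "1 = \<bar>mat_form d C w u\<bar>" using w by (simp add: Q U_def)
      also have "\<dots> \<le> sqrt (mat_form d C w w) * sqrt (mat_form d C u u)"
        by (rule mat_form_Cauchy_Schwarz[OF Csym Cpsd])
      also have "\<dots> \<le> sqrt (mat_form d C w w) * sqrt b"
        using le Cpsd by (intro mult_left_mono) auto
      finally have "1 \<le> sqrt (mat_form d C w w * b)" by (simp add: real_sqrt_mult)
      then have "1 \<le> mat_form d C w w * b" by simp
      then show ?thesis using b by (simp add: field_simps)
    qed
    then have "l + 1 / b \<le> l"
      unfolding l_def[symmetric] using ne
      by (subst (2) l_def, intro cINF_greatest) (force simp: Cform U_def)+
    then show False using b by simp
  qed
  then have "eigenvalue B l"
    using B by (simp add: eigenvalue_det[OF B] char_matrix_def C_def)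
  then have "a * dot d v v \<le> l * dot d v v" using ev dot_nonneg by (intro mult_right_mono) auto
  then show ?thesis using lower[of v] by linarith
qed

text \<open>Split an eigenvector into real part \<open>p\<close> and imaginary part
  \<open>q\<close>. By symmetry the form takes the same value at \<open>(p, q)\<close> and
  \<open>(q, p)\<close>; evaluating both by the eigenvalue equation leaves \<open>Im k\<close> times
  the squared norm of the vector equal to 0.\<close>

lemma symmetric_real_eigenvalue:
  fixes B :: "real mat" and k :: complex
  assumes B: "B \<in> carrier_mat d d"
    and sym: "\<And>i j. i < d \<Longrightarrow> j < d \<Longrightarrow> B $$ (i, j) = B $$ (j, i)"
    and ev: "eigenvalue (map_mat complex_of_real B) k"
  shows "Im k = 0"
proof -
  from ev obtain v where v: "v \<in> carrier_vec d" "v \<noteq> 0\<^sub>v d"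
    and e: "map_mat complex_of_real B *\<^sub>v v = k \<cdot>\<^sub>v v"
    unfolding eigenvalue_def eigenvector_def using B by auto
  define p q where "p i = Re (v $ i)" and "q i = Im (v $ i)" for i
  have row: "(\<Sum>j<d. complex_of_real (B $$ (i, j)) * v $ j) = k * v $ i" if "i < d" for i
  proof -
    have "(map_mat complex_of_real B *\<^sub>v v) $ i = k * v $ i"
      using e that v by simp
    then show ?thesis using that v B by (simp add: scalar_prod_def lessThan_atLeast0)
  qed
  have re: "(\<Sum>j<d. B $$ (i, j) * p j) = Re k * p i - Im k * q i" if "i < d" for i
    using arg_cong[OF row[OF that], of Re] by (simp add: p_def q_def)
  have im: "(\<Sum>j<d. B $$ (i, j) * q j) = Re k * q i + Im k * p i" if "i < d" for i
    using arg_cong[OF row[OF that], of Im] by (simp add: p_def q_def)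
  have 1: "mat_form d B q p = Re k * dot d q p - Im k * dot d q q"
  proof -
    have "mat_form d B q p = (\<Sum>i<d. q i * (\<Sum>j<d. B $$ (i, j) * p j))"
      by (simp add: mat_form_def sum_distrib_left mult_ac)
    also have "\<dots> = (\<Sum>i<d. Re k * (q i * p i) - Im k * (q i * q i))"
      by (intro sum.cong refl) (simp only: re lessThan_iff, simp add: algebra_simps)
    finally show ?thesis by (simp add: dot_def sum_subtractf sum_distrib_left)
  qed
  have 2: "mat_form d B p q = Re k * dot d p q + Im k * dot d p p"
  proof -
    have "mat_form d B p q = (\<Sum>i<d. p i * (\<Sum>j<d. B $$ (i, j) * q j))"
      by (simp add: mat_form_def sum_distrib_left mult_ac)
    also have "\<dots> = (\<Sum>i<d. Re k * (p i * q i) + Im k * (p i * p i))"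
      by (intro sum.cong refl) (simp only: im lessThan_iff, simp add: algebra_simps)
    finally show ?thesis by (simp add: dot_def sum.distrib sum_distrib_left)
  qed
  have "Im k * (dot d p p + dot d q q) = 0"
    using 1 2 mat_form_commute[of d B p q] sym dot_commute[of d p q] by (simp add: algebra_simps)
  moreover have "dot d p p + dot d q q \<noteq> 0"
  proof
    assume "dot d p p + dot d q q = 0"
    then have "dot d p p = 0" "dot d q q = 0" using dot_nonneg[of d p] dot_nonneg[of d q] by linarith+
    then have "v $ i = 0" if "i < d" for i
      using that by (simp add: dot_def sum_nonneg_eq_0_iff p_def q_def complex_eq_iff)
    then have "v = 0\<^sub>v d" using v by (intro eq_vecI) auto
    with v show False by simp
  qed
  ultimately show ?thesis by simp
qed

lemma proots_linear_factors:
  fixes as :: "real list"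
  shows "proots (\<Prod>a\<leftarrow>as. [:- a, 1:]) = mset as"
proof (induction as)
  case (Cons a as)
  have "(\<Prod>a\<leftarrow>as. [:- a, 1:]) \<noteq> (0 :: real poly)"
    unfolding prod_list_zero_iff by auto
  then have "proots ([:- a, 1:] * (\<Prod>a\<leftarrow>as. [:- a, 1:])) = proots [:- a, 1:] + mset as"
    using Cons by (subst proots_mult) auto
  then show ?case by (simp only: list.map prod_list.Cons) simp
qed simp

text \<open>\<open>proots\<close> sees only real roots, so the length of the eigenvalue list is a
  claim: the polynomial splits over the complex numbers and all its roots are real. The index
  \<open>d - 1\<close> in \<open>singular_value\<close> then points at the smallest
  eigenvalue.\<close>

lemma symmetric_size_proots:
  fixes B :: "real mat"
  assumes B: "B \<in> carrier_mat d d"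
    and sym: "\<And>i j. i < d \<Longrightarrow> j < d \<Longrightarrow> B $$ (i, j) = B $$ (j, i)"
  shows "size (proots (char_poly B)) = d"
proof -
  let ?c = "map_mat complex_of_real B"
  interpret h: map_poly_inj_comm_ring_hom complex_of_real ..
  have c: "?c \<in> carrier_mat d d" using B by simp
  obtain as where as: "char_poly ?c = (\<Prod>a\<leftarrow>as. [:- a, 1:])" "length as = d"
    using char_poly_factorized[OF c] by blast
  have hom: "char_poly ?c = map_poly complex_of_real (char_poly B)"
    by (rule of_real_hom.char_poly_hom[OF B])
  have real: "complex_of_real (Re a) = a" if "a \<in> set as" for a
  proof -
    have "poly (char_poly ?c) a = 0"
      unfolding as(1) using that by (induction as) auto
    then have "eigenvalue ?c a" using eigenvalue_root_char_poly[OF c] by simp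
    from symmetric_real_eigenvalue[OF B sym this] show ?thesis by (simp add: complex_eq_iff)
  qed
  have "map_poly complex_of_real (\<Prod>a\<leftarrow>map Re as. [:- a, 1:]) = (\<Prod>a\<leftarrow>as. [:- a, 1:])"
    using real
  proof (induction as)
    case (Cons a as)
    have "map_poly complex_of_real (\<Prod>a\<leftarrow>map Re (a # as). [:- a, 1:]) =
      map_poly complex_of_real [:- Re a, 1:] * map_poly complex_of_real (\<Prod>a\<leftarrow>map Re as. [:- a, 1:])"
      by (simp only: list.map prod_list.Cons h.hom_mult)
    also have "map_poly complex_of_real [:- Re a, 1:] = [:- a, 1:]"
      using Cons.prems by simp
    finally show ?case using Cons by simp
  qed simp
  then have "map_poly complex_of_real (char_poly B) = map_poly complex_of_real (\<Prod>a\<leftarrow>map Re as. [:- a, 1:])"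
    using as(1) hom by simp
  then have "char_poly B = (\<Prod>a\<leftarrow>map Re as. [:- a, 1:])"
    by (metis h.injectivity)
  then show ?thesis using proots_linear_factors[of "map Re as"] as(2) by simp
qed

text \<open>With \<open>d\<close> columns the \<open>d\<close>-th largest singular value is the
  smallest one. Positivity of \<open>a\<close> rules out the default value 0 that
  \<open>singular_value\<close> has for too few rows.\<close>

lemma singular_value_bound:
  fixes M :: "real mat"
  assumes M: "M \<in> carrier_mat r d" and d: "1 \<le> d" and sv: "a \<le> singular_value d M" and a: "0 < a"
  shows "a\<^sup>2 * dot d v v \<le> (\<Sum>i<r. (\<Sum>j<d. M $$ (i, j) * v j)\<^sup>2)"
proof -
  define B where "B = transpose_mat M * M"
  have B: "B \<in> carrier_mat d d" using M by (simp add: B_def)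
  have Bij: "B $$ (i, j) = (\<Sum>k<r. M $$ (k, i) * M $$ (k, j))" if "i < d" "j < d" for i j
    using that M by (auto simp: B_def scalar_prod_def lessThan_atLeast0)
  have sym: "B $$ (i, j) = B $$ (j, i)" if "i < d" "j < d" for i j
    using that by (simp add: Bij mult.commute)
  define L where "L = sorted_list_of_multiset (proots (char_poly B))"
  have lenL: "length L = d"
    using symmetric_size_proots[OF B sym] unfolding L_def
    by (metis mset_sorted_list_of_multiset size_mset)
  have sortL: "sorted L" by (simp add: L_def)
  have "a \<le> sqrt (rev L ! (d - 1))"
    using sv a M unfolding singular_value_def B_def[symmetric] L_def[symmetric]
    by (auto split: if_splits)
  moreover have "rev L ! (d - 1) = L ! 0" using d lenL by (simp add: rev_nth)
  ultimately have aL: "a \<le> sqrt (L ! 0)" by simp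
  then have "0 < sqrt (L ! 0)" using a by linarith
  then have "0 < L ! 0" by simp
  then have a2: "a\<^sup>2 \<le> L ! 0" using power_mono[OF aL, of 2] a by simp
  have ev: "a\<^sup>2 \<le> k" if "eigenvalue B k" for k
  proof -
    have "char_poly B \<noteq> 0" using degree_monic_char_poly[OF B] by auto
    then have "k \<in># proots (char_poly B)"
      using that eigenvalue_root_char_poly[OF B] by simp
    then have "k \<in> set L" by (simp add: L_def)
    then obtain i where "i < length L" "L ! i = k" by (auto simp: in_set_conv_nth)
    then have "L ! 0 \<le> k" using sorted_nth_mono[OF sortL, of 0 i] by simp
    then show ?thesis using a2 by simp
  qed
  have "a\<^sup>2 * dot d v v \<le> mat_form d B v v"
    by (rule symmetric_mat_form_ge[OF B sym ev])
  also have "mat_form d B v v = (\<Sum>i<d. \<Sum>j<d. \<Sum>k<r. (M $$ (k, i) * v i) * (M $$ (k, j) * v j))"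
    unfolding mat_form_def
    by (intro sum.cong refl) (simp add: Bij sum_distrib_left sum_distrib_right mult_ac)
  also have "\<dots> = (\<Sum>k<r. \<Sum>i<d. \<Sum>j<d. (M $$ (k, i) * v i) * (M $$ (k, j) * v j))"
    by (subst (2) sum.swap, subst sum.swap) simp
  also have "\<dots> = (\<Sum>k<r. (\<Sum>j<d. M $$ (k, j) * v j)\<^sup>2)"
    by (simp add: power2_eq_square sum_product)
  finally show ?thesis .
qed

text \<open>\<open>N\<close> is the pseudoinverse
  \<open>(m\<^sup>T m)\<^sup>-\<^sup>1 m\<^sup>T\<close>. Its l1-bound is free of the number of
  rows: \<open>z = m N x\<close> is the orthogonal projection of \<open>x\<close>, so the squared
  norm of \<open>z\<close> equals \<open>z . x\<close> and is at most the norm of \<open>z\<close>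
  times the l1-norm of \<open>x\<close>; the lower bound on \<open>m\<close> then passes from
  \<open>z\<close> to \<open>N x\<close>.\<close>

lemma bounded_left_inverse:
  fixes m :: "'r \<Rightarrow> nat \<Rightarrow> real"
  assumes R: "finite R" and a: "0 < a"
    and lb: "\<And>v. a\<^sup>2 * dot d v v \<le> (\<Sum>i\<in>R. (\<Sum>j<d. m i j * v j)\<^sup>2)"
  shows "\<exists>N. (\<forall>s<d. \<forall>s'<d. (\<Sum>i\<in>R. N s i * m i s') = (if s = s' then 1 else 0)) \<and>
    (\<forall>x. (\<Sum>s<d. \<bar>\<Sum>i\<in>R. N s i * x i\<bar>) \<le> real d / a * (\<Sum>i\<in>R. \<bar>x i\<bar>))"
proof -
  define W where "W = mat d d (\<lambda>(s, s'). \<Sum>i\<in>R. m i s * m i s')"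
  have W: "W \<in> carrier_mat d d" by (simp add: W_def)
  have Wform: "mat_form d W u v = (\<Sum>i\<in>R. (\<Sum>j<d. m i j * u j) * (\<Sum>j<d. m i j * v j))" for u v
  proof -
    have "mat_form d W u v = (\<Sum>s<d. \<Sum>s'<d. \<Sum>i\<in>R. (m i s * u s) * (m i s' * v s'))"
      unfolding mat_form_def W_def
      by (intro sum.cong refl) (simp add: sum_distrib_left sum_distrib_right mult_ac)
    also have "\<dots> = (\<Sum>i\<in>R. \<Sum>s<d. \<Sum>s'<d. (m i s * u s) * (m i s' * v s'))"
      by (subst (2) sum.swap, subst sum.swap) simp
    finally show ?thesis by (simp add: sum_product)
  qed
  have det: "det W \<noteq> 0"
  proof
    assume "det W = 0"
    then obtain w where w: "w \<in> carrier_vec d" "w \<noteq> 0\<^sub>v d" "W *\<^sub>v w = 0\<^sub>v d"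
      using det_0_iff_vec_prod_zero[OF W] by auto
    have "(\<Sum>j<d. W $$ (i, j) * w $ j) = 0" if "i < d" for i
    proof -
      have "(W *\<^sub>v w) $ i = (\<Sum>j<d. W $$ (i, j) * w $ j)"
        using that w(1) W by (simp add: scalar_prod_def lessThan_atLeast0)
      moreover have "(W *\<^sub>v w) $ i = 0" unfolding w(3) using that by simp
      ultimately show ?thesis by (rule subst)
    qed
    then have "(\<Sum>i<d. w $ i * (\<Sum>j<d. W $$ (i, j) * w $ j)) = 0"
      by (intro sum.neutral) simp
    then have "mat_form d W (\<lambda>i. w $ i) (\<lambda>i. w $ i) = 0"
      by (simp only: mat_form_def mult.assoc sum_distrib_left)
    then have "a\<^sup>2 * dot d (\<lambda>i. w $ i) (\<lambda>i. w $ i) \<le> 0"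
      using lb[of "\<lambda>i. w $ i"] by (simp add: Wform power2_eq_square)
    then have "dot d (\<lambda>i. w $ i) (\<lambda>i. w $ i) = 0"
      using a dot_nonneg[of d "\<lambda>i. w $ i"] by (simp add: mult_le_0_iff zero_less_power2)
    then have "w $ i = 0" if "i < d" for i
      using that by (simp add: dot_def sum_nonneg_eq_0_iff)
    then have "w = 0\<^sub>v d" using w by (intro eq_vecI) auto
    with w show False by simp
  qed
  from mat_inverse_entries[OF W det] obtain J where J: "\<forall>i<d. \<forall>k<d.
      (\<Sum>j<d. W $$ (i, j) * J j k) = (if i = k then 1 else 0) \<and>
      (\<Sum>j<d. J i j * W $$ (j, k)) = (if i = k then 1 else 0)" ..
  define N where "N s i = (\<Sum>s'<d. J s s' * m i s')" for s i
  have 1: "(\<Sum>i\<in>R. N s i * m i s') = (if s = s' then 1 else 0)" if "s < d" "s' < d" for s s'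
  proof -
    have "(\<Sum>i\<in>R. N s i * m i s') = (\<Sum>i\<in>R. \<Sum>k<d. J s k * (m i k * m i s'))"
      by (simp add: N_def sum_distrib_left sum_distrib_right mult_ac)
    also have "\<dots> = (\<Sum>k<d. J s k * W $$ (k, s'))"
      using that by (subst sum.swap) (simp add: W_def sum_distrib_left)
    finally show ?thesis using J that by simp
  qed
  have 2: "(\<Sum>s<d. \<bar>\<Sum>i\<in>R. N s i * x i\<bar>) \<le> real d / a * (\<Sum>i\<in>R. \<bar>x i\<bar>)" for x
  proof -
    define v where "v s = (\<Sum>i\<in>R. N s i * x i)" for s
    define y where "y s = (\<Sum>i\<in>R. m i s * x i)" for s
    have v: "v s = (\<Sum>k<d. J s k * y k)" for s
      unfolding v_def N_def y_def
      by (simp add: sum_distrib_left sum_distrib_right mult_ac) (subst sum.swap, simp)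
    have Wv: "(\<Sum>j<d. W $$ (i, j) * v j) = y i" if "i < d" for i
    proof -
      have "(\<Sum>j<d. W $$ (i, j) * v j) = (\<Sum>k<d. (\<Sum>j<d. W $$ (i, j) * J j k) * y k)"
        unfolding v sum_distrib_left sum_distrib_right by (subst sum.swap) (simp add: mult_ac)
      also have "\<dots> = (\<Sum>k<d. (if i = k then 1 else 0) * y k)"
        using J that by (intro sum.cong refl) simp
      also have "\<dots> = y i" using that by (simp add: if_distrib if_distribR cong: if_cong)
      finally show ?thesis .
    qed
    define z where "z i = (\<Sum>j<d. m i j * v j)" for i
    define Z where "Z = (\<Sum>i\<in>R. (z i)\<^sup>2)"
    have Z0: "0 \<le> Z" by (auto simp: Z_def intro: sum_nonneg)
    have X0: "0 \<le> (\<Sum>i\<in>R. \<bar>x i\<bar>)" by (auto intro: sum_nonneg)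
    have "Z = mat_form d W v v" by (simp add: Z_def Wform z_def power2_eq_square)
    also have "\<dots> = (\<Sum>s<d. v s * y s)"
      unfolding mat_form_def mult.assoc sum_distrib_left[symmetric] using Wv
      by (intro sum.cong refl) simp
    also have "\<dots> = (\<Sum>i\<in>R. z i * x i)"
      unfolding y_def z_def sum_distrib_left sum_distrib_right by (subst sum.swap) (simp add: mult_ac)
    also have "\<dots> \<le> (\<Sum>i\<in>R. sqrt Z * \<bar>x i\<bar>)"
    proof (intro sum_mono)
      fix i assume "i \<in> R"
      then have "(z i)\<^sup>2 \<le> Z" unfolding Z_def using R by (intro member_le_sum) auto
      then have "\<bar>z i\<bar> \<le> sqrt Z" by (metis real_sqrt_abs real_sqrt_le_mono)
      then have "\<bar>z i\<bar> * \<bar>x i\<bar> \<le> sqrt Z * \<bar>x i\<bar>" by (intro mult_right_mono) auto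
      then show "z i * x i \<le> sqrt Z * \<bar>x i\<bar>" by (metis abs_ge_self abs_mult order_trans)
    qed
    also have "\<dots> = sqrt Z * (\<Sum>i\<in>R. \<bar>x i\<bar>)" by (simp add: sum_distrib_left)
    finally have "sqrt Z * sqrt Z \<le> sqrt Z * (\<Sum>i\<in>R. \<bar>x i\<bar>)" using Z0 by simp
    then have Zx: "sqrt Z \<le> (\<Sum>i\<in>R. \<bar>x i\<bar>)"
      using X0 Z0 mult_left_le_imp_le[of "sqrt Z" "sqrt Z"] by (cases "Z = 0") auto
    have "a * sqrt (dot d v v) \<le> sqrt Z"
      using real_sqrt_le_mono[OF lb[of v]] a by (simp add: Z_def z_def real_sqrt_mult)
    then have vx: "sqrt (dot d v v) \<le> (\<Sum>i\<in>R. \<bar>x i\<bar>) / a"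
      using Zx a by (simp add: field_simps)
    have "(\<Sum>s<d. \<bar>v s\<bar>) \<le> (\<Sum>s<d. sqrt (dot d v v))"
    proof (intro sum_mono)
      fix s assume "s \<in> {..<d}"
      then have "v s * v s \<le> dot d v v" unfolding dot_def
        by (intro member_le_sum[where f = "\<lambda>i. v i * v i"]) auto
      then show "\<bar>v s\<bar> \<le> sqrt (dot d v v)" by (metis real_sqrt_abs2 real_sqrt_le_mono)
    qed
    also have "\<dots> \<le> real d * ((\<Sum>i\<in>R. \<bar>x i\<bar>) / a)"
      using mult_left_mono[OF vx, of "real d"] by simp
    finally show ?thesis by (simp add: v_def)
  qed
  from 1 2 show ?thesis by blast
qed

section \<open>Likelihoods of trajectories\<close>

abbreviation l1 :: "nat \<Rightarrow> (nat \<Rightarrow> real) \<Rightarrow> real" where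
  "l1 d v \<equiv> (\<Sum>s<d. \<bar>v s\<bar>)"

section \<open>Histories of a fixed length\<close>

lemma finite_trajectories [simp]: "finite (trajectories nA nO n)"
proof -
  have "trajectories nA nO n = {\<tau>. set \<tau> \<subseteq> {..<nO} \<times> {..<nA} \<and> length \<tau> = n}"
    unfolding trajectories_def lists_eq_set by blast
  then show ?thesis by (simp only:) (rule finite_lists_length_eq, simp)
qed

lemma trajectories_0 [simp]: "trajectories nA nO 0 = {[]}"
  by (auto simp: trajectories_def)

lemma Nil_trajectories_iff [simp]: "[] \<in> trajectories nA nO n \<longleftrightarrow> n = 0"
  by (auto simp: trajectories_def)

lemma Cons_trajectories_iff [simp]:
  "(x, a) # \<tau> \<in> trajectories nA nO n \<longleftrightarrow> x < nO \<and> a < nA \<and> 0 < n \<and> \<tau> \<in> trajectories nA nO (n - 1)"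
  by (cases n) (auto simp: trajectories_def)

lemma length_trajectories: "\<tau> \<in> trajectories nA nO n \<Longrightarrow> length \<tau> = n"
  by (simp add: trajectories_def)

lemma sum_trajectories_Suc:
  "(\<Sum>\<tau>\<in>trajectories nA nO (Suc n). f \<tau>) =
   (\<Sum>x<nO. \<Sum>a<nA. \<Sum>\<tau>\<in>trajectories nA nO n. f ((x, a) # \<tau>))"
proof -
  have "trajectories nA nO (Suc n) = (\<lambda>(x, a, \<tau>). (x, a) # \<tau>) ` ({..<nO} \<times> {..<nA} \<times> trajectories nA nO n)"
  proof (intro equalityI subsetI)
    fix \<tau> assume "\<tau> \<in> trajectories nA nO (Suc n)"
    then show "\<tau> \<in> (\<lambda>(x, a, \<tau>). (x, a) # \<tau>) ` ({..<nO} \<times> {..<nA} \<times> trajectories nA nO n)"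
    proof (cases \<tau>)
      case (Cons p \<tau>')
      obtain x a where "p = (x, a)" by (cases p)
      with Cons \<open>\<tau> \<in> _\<close> show ?thesis by (intro image_eqI[of _ _ "(x, a, \<tau>')"]) auto
    qed auto
  qed auto
  moreover have "inj_on (\<lambda>(x, a, \<tau>). (x, a) # \<tau>) ({..<nO} \<times> {..<nA} \<times> trajectories nA nO n)"
    by (auto simp: inj_on_def)
  ultimately show ?thesis
    by (simp add: sum.reindex sum.cartesian_product case_prod_unfold)
qed

lemma sum_trajectories_add:
  "(\<Sum>\<tau>\<in>trajectories nA nO (n + k). f \<tau>) =
   (\<Sum>\<tau>1\<in>trajectories nA nO n. \<Sum>\<tau>2\<in>trajectories nA nO k. f (\<tau>1 @ \<tau>2))"
  by (induction n arbitrary: f) (simp_all add: sum_trajectories_Suc)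

section \<open>Trajectory probabilities as a policy factor times a model factor\<close>

fun obs_lik :: "nat \<Rightarrow> param \<Rightarrow> nat \<Rightarrow> nat \<Rightarrow> history \<Rightarrow> real" where
  "obs_lik nS \<theta> h s [] = 1"
| "obs_lik nS \<theta> h s ((x, a) # \<tau>) =
     pmf (emit \<theta> h s) x *
     (if \<tau> = [] then 1 else \<Sum>s'<nS. pmf (trans \<theta> h a s) s' * obs_lik nS \<theta> (Suc h) s' \<tau>)"

fun pol_prob :: "policy \<Rightarrow> history \<Rightarrow> history \<Rightarrow> real" where
  "pol_prob \<pi> \<tau>0 [] = 1"
| "pol_prob \<pi> \<tau>0 ((x, a) # \<tau>) = pmf (\<pi> \<tau>0 x) a * pol_prob \<pi> (\<tau>0 @ [(x, a)]) \<tau>"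

definition obs_prob :: "nat \<Rightarrow> param \<Rightarrow> history \<Rightarrow> real" where
  "obs_prob nS \<theta> \<tau> = (\<Sum>s<nS. pmf (init \<theta>) s * obs_lik nS \<theta> 1 s \<tau>)"

text \<open>One step of the filter without normalization: \<open>v\<close> carries joint weights of
  history and current state, which keeps the map linear in \<open>v\<close>.\<close>

definition belief_step :: "nat \<Rightarrow> param \<Rightarrow> nat \<Rightarrow> nat \<Rightarrow> nat \<Rightarrow> (nat \<Rightarrow> real) \<Rightarrow> nat \<Rightarrow> real" where
  "belief_step nS \<theta> h x a v s' = (\<Sum>s<nS. v s * pmf (emit \<theta> h s) x * pmf (trans \<theta> h a s) s')"

fun belief :: "nat \<Rightarrow> param \<Rightarrow> nat \<Rightarrow> (nat \<Rightarrow> real) \<Rightarrow> history \<Rightarrow> nat \<Rightarrow> real" where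
  "belief nS \<theta> h v [] = v"
| "belief nS \<theta> h v ((x, a) # \<tau>) = belief nS \<theta> (Suc h) (belief_step nS \<theta> h x a v) \<tau>"

lemma obs_lik_nonneg [simp]: "0 \<le> obs_lik nS \<theta> h s \<tau>"
  by (induction nS \<theta> h s \<tau> rule: obs_lik.induct) (auto intro!: sum_nonneg mult_nonneg_nonneg)

lemma obs_prob_nonneg [simp]: "0 \<le> obs_prob nS \<theta> \<tau>"
  by (auto simp: obs_prob_def intro!: sum_nonneg)

lemma pol_prob_nonneg [simp]: "0 \<le> pol_prob \<pi> \<tau>0 \<tau>"
  by (induction \<pi> \<tau>0 \<tau> rule: pol_prob.induct) auto

lemma pol_prob_le_1: "pol_prob \<pi> \<tau>0 \<tau> \<le> 1"
  by (induction \<pi> \<tau>0 \<tau> rule: pol_prob.induct) (auto intro!: mult_le_one pmf_le_1)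

lemma pol_prob_append: "pol_prob \<pi> \<tau>0 (\<tau>1 @ \<tau>2) = pol_prob \<pi> \<tau>0 \<tau>1 * pol_prob \<pi> (\<tau>0 @ \<tau>1) \<tau>2"
  by (induction \<pi> \<tau>0 \<tau>1 rule: pol_prob.induct) auto

lemma rollout_prefix:
  "y \<in> set_pmf (rollout \<theta> \<pi> n \<tau> s) \<Longrightarrow> take (length \<tau>) y = \<tau> \<and> length y = length \<tau> + n"
proof (induction \<theta> \<pi> n \<tau> s arbitrary: y rule: rollout.induct)
  case (2 \<theta> \<pi> n \<tau> s)
  show ?case
  proof (cases "n = 0")
    case True
    then show ?thesis using "2.prems" by auto
  next
    case False
    then obtain x a s' where "x \<in> set_pmf (emit \<theta> (length \<tau> + 1) s)" "a \<in> set_pmf (\<pi> \<tau> x)"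
      "s' \<in> set_pmf (trans \<theta> (length \<tau> + 1) a s)" "y \<in> set_pmf (rollout \<theta> \<pi> n (\<tau> @ [(x, a)]) s')"
      using "2.prems" by auto
    from "2.IH"[OF this(1,2) False this(3,4)]
    have t: "take (length (\<tau> @ [(x, a)])) y = \<tau> @ [(x, a)]" "length y = length (\<tau> @ [(x, a)]) + n"
      by auto
    have "take (length \<tau>) y = take (length \<tau>) (take (length (\<tau> @ [(x, a)])) y)"
      by simp
    also have "\<dots> = \<tau>" unfolding t by simp
    finally show ?thesis using t by simp
  qed
qed simp

lemma pmf_bind_single:
  assumes "\<And>x'. x' \<noteq> x \<Longrightarrow> pmf (f x') y = 0"
  shows "pmf (bind_pmf p f) y = pmf p x * pmf (f x) y"
proof -
  have "pmf (bind_pmf p f) y = (LINT x'|measure_pmf p. pmf (f x') y)"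
    by (simp add: pmf_bind)
  also have "\<dots> = (\<Sum>x'\<in>{x}. pmf (f x') y * pmf p x')"
    by (rule integral_measure_pmf_real) (use assms in auto)
  finally show ?thesis by simp
qed

lemma pmf_bind_finite:
  assumes "set_pmf p \<subseteq> A" "finite A"
  shows "pmf (bind_pmf p f) y = (\<Sum>x\<in>A. pmf p x * pmf (f x) y)"
proof -
  have "pmf (bind_pmf p f) y = (LINT x'|measure_pmf p. pmf (f x') y)"
    by (simp add: pmf_bind)
  also have "\<dots> = (\<Sum>x'\<in>A. pmf (f x') y * pmf p x')"
    by (rule integral_measure_pmf_real) (use assms in auto)
  finally show ?thesis by (simp add: mult.commute)
qed

lemma trans_supp: "\<theta> \<in> params nS nA nO H \<Longrightarrow> 1 \<le> h \<Longrightarrow> h < H \<Longrightarrow> a < nA \<Longrightarrow> s < nS \<Longrightarrow>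
    set_pmf (trans \<theta> h a s) \<subseteq> {..<nS}"
  by (auto simp: params_def)

lemma emit_supp: "\<theta> \<in> params nS nA nO H \<Longrightarrow> 1 \<le> h \<Longrightarrow> h \<le> H \<Longrightarrow> s < nS \<Longrightarrow>
    set_pmf (emit \<theta> h s) \<subseteq> {..<nO}"
  by (auto simp: params_def)

lemma init_supp: "\<theta> \<in> params nS nA nO H \<Longrightarrow> set_pmf (init \<theta>) \<subseteq> {..<nS}"
  by (auto simp: params_def)

lemma policy_supp: "\<pi> \<in> policies nA nO H \<Longrightarrow> \<tau> \<in> trajectories nA nO n \<Longrightarrow> n < H \<Longrightarrow> x < nO \<Longrightarrow>
    set_pmf (\<pi> \<tau> x) \<subseteq> {..<nA}"
  by (auto simp: policies_def trajectories_def)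

text \<open>A trajectory records all observations and actions, so in both outer binds a single
  outcome contributes; only the sum over the hidden next state survives. The policy sees no states,
  hence its factor comes out of that sum.\<close>

lemma pmf_rollout:
  assumes \<theta>: "\<theta> \<in> params nS nA nO H"
  shows "s < nS \<Longrightarrow> \<tau> \<in> trajectories nA nO n \<Longrightarrow> length \<tau>0 + n \<le> H \<Longrightarrow>
    pmf (rollout \<theta> \<pi> n \<tau>0 s) (\<tau>0 @ \<tau>) = pol_prob \<pi> \<tau>0 \<tau> * obs_lik nS \<theta> (Suc (length \<tau>0)) s \<tau>"
proof (induction \<tau> arbitrary: n \<tau>0 s)
  case (Cons p \<tau>)
  obtain x a where p: "p = (x, a)" by (cases p)
  obtain k where n: "n = Suc k" using Cons.prems by (cases n) (auto simp: p)
  have xa: "x < nO" "a < nA" and \<tau>: "\<tau> \<in> trajectories nA nO k" using Cons.prems by (auto simp: p n)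
  define y where "y = \<tau>0 @ (x, a) # \<tau>"
  define K where "K x' a' = (if k = 0 then return_pmf (\<tau>0 @ [(x', a')])
     else bind_pmf (trans \<theta> (length \<tau>0 + 1) a' s) (rollout \<theta> \<pi> k (\<tau>0 @ [(x', a')])))" for x' a'
  have K0: "pmf (K x' a') y = 0" if "(x', a') \<noteq> (x, a)" for x' a'
  proof -
    have "y \<notin> set_pmf (K x' a')"
    proof
      assume "y \<in> set_pmf (K x' a')"
      then have "take (length (\<tau>0 @ [(x', a')])) y = \<tau>0 @ [(x', a')]"
        by (auto simp: K_def split: if_splits dest!: rollout_prefix)
      then show False using that by (simp add: y_def)
    qed
    then show ?thesis by (simp add: pmf_eq_0_set_pmf)
  qed
  have "pmf (rollout \<theta> \<pi> n \<tau>0 s) y =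
    pmf (bind_pmf (emit \<theta> (length \<tau>0 + 1) s) (\<lambda>x'. bind_pmf (\<pi> \<tau>0 x') (\<lambda>a'. K x' a'))) y"
    by (simp add: n K_def)
  also have "\<dots> = pmf (emit \<theta> (length \<tau>0 + 1) s) x * pmf (bind_pmf (\<pi> \<tau>0 x) (\<lambda>a'. K x a')) y"
  proof (rule pmf_bind_single)
    fix x' assume "x' \<noteq> x"
    then show "pmf (bind_pmf (\<pi> \<tau>0 x') (\<lambda>a'. K x' a')) y = 0"
      by (subst pmf_bind_single[of a]) (auto simp: K0)
  qed
  also have "pmf (bind_pmf (\<pi> \<tau>0 x) (\<lambda>a'. K x a')) y = pmf (\<pi> \<tau>0 x) a * pmf (K x a) y"
    by (rule pmf_bind_single) (simp add: K0)
  also have "pmf (K x a) y = pol_prob \<pi> (\<tau>0 @ [(x, a)]) \<tau> *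
     (if \<tau> = [] then 1 else \<Sum>s'<nS. pmf (trans \<theta> (Suc (length \<tau>0)) a s) s' * obs_lik nS \<theta> (Suc (Suc (length \<tau>0))) s' \<tau>)"
  proof (cases "k = 0")
    case True
    then show ?thesis using \<tau> by (simp add: K_def y_def)
  next
    case False
    then have ne: "\<tau> \<noteq> []" using \<tau> by auto
    have "pmf (K x a) y = (\<Sum>s'<nS. pmf (trans \<theta> (length \<tau>0 + 1) a s) s' * pmf (rollout \<theta> \<pi> k (\<tau>0 @ [(x, a)]) s') y)"
      unfolding K_def using False trans_supp[OF \<theta>, of "Suc (length \<tau>0)" a s] xa Cons.prems n
      by (simp add: pmf_bind_finite[of _ "{..<nS}"])
    also have "\<dots> = (\<Sum>s'<nS. pmf (trans \<theta> (length \<tau>0 + 1) a s) s' *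
        (pol_prob \<pi> (\<tau>0 @ [(x, a)]) \<tau> * obs_lik nS \<theta> (Suc (Suc (length \<tau>0))) s' \<tau>))"
    proof (intro sum.cong refl)
      fix s' assume "s' \<in> {..<nS}"
      then show "pmf (trans \<theta> (length \<tau>0 + 1) a s) s' * pmf (rollout \<theta> \<pi> k (\<tau>0 @ [(x, a)]) s') y =
        pmf (trans \<theta> (length \<tau>0 + 1) a s) s' *
        (pol_prob \<pi> (\<tau>0 @ [(x, a)]) \<tau> * obs_lik nS \<theta> (Suc (Suc (length \<tau>0))) s' \<tau>)"
        using Cons.IH[of s' k "\<tau>0 @ [(x, a)]"] \<tau> Cons.prems n by (simp add: y_def)
    qed
    finally show ?thesis using ne by (simp add: sum_distrib_left mult_ac)
  qed
  finally show ?case by (simp add: p y_def)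
qed simp

lemma rollout_lists:
  assumes \<theta>: "\<theta> \<in> params nS nA nO H" and \<pi>: "\<pi> \<in> policies nA nO H"
  shows "s < nS \<Longrightarrow> \<tau>0 \<in> lists ({..<nO} \<times> {..<nA}) \<Longrightarrow> length \<tau>0 + n \<le> H \<Longrightarrow>
    set_pmf (rollout \<theta> \<pi> n \<tau>0 s) \<subseteq> lists ({..<nO} \<times> {..<nA})"
proof (induction n arbitrary: \<tau>0 s)
  case (Suc n)
  show ?case
  proof
    fix y assume "y \<in> set_pmf (rollout \<theta> \<pi> (Suc n) \<tau>0 s)"
    then obtain x a where x: "x \<in> set_pmf (emit \<theta> (Suc (length \<tau>0)) s)" and a: "a \<in> set_pmf (\<pi> \<tau>0 x)"
      and y: "y \<in> set_pmf (if n = 0 then return_pmf (\<tau>0 @ [(x, a)])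
         else bind_pmf (trans \<theta> (length \<tau>0 + 1) a s) (rollout \<theta> \<pi> n (\<tau>0 @ [(x, a)])))"
      by auto
    have x: "x < nO" using emit_supp[OF \<theta>, of "Suc (length \<tau>0)" s] x Suc.prems by auto
    then have a: "a < nA" using policy_supp[OF \<pi>, of \<tau>0 "length \<tau>0" x] a Suc.prems
      by (auto simp: trajectories_def)
    show "y \<in> lists ({..<nO} \<times> {..<nA})"
    proof (cases "n = 0")
      case True
      then show ?thesis using y x a Suc.prems by simp
    next
      case False
      then obtain s' where s': "s' \<in> set_pmf (trans \<theta> (length \<tau>0 + 1) a s)"
        and y: "y \<in> set_pmf (rollout \<theta> \<pi> n (\<tau>0 @ [(x, a)]) s')" using y by auto
      have "s' < nS" using trans_supp[OF \<theta>, of "Suc (length \<tau>0)" a s] s' a Suc.prems False by auto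
      then show ?thesis using Suc.IH[of s' "\<tau>0 @ [(x, a)]"] y x a Suc.prems by auto
    qed
  qed
qed auto

lemma set_trajectory_pmf:
  assumes \<theta>: "\<theta> \<in> params nS nA nO H" and \<pi>: "\<pi> \<in> policies nA nO H"
  shows "set_pmf (trajectory_pmf H \<theta> \<pi>) \<subseteq> trajectories nA nO H"
proof
  fix \<tau> assume "\<tau> \<in> set_pmf (trajectory_pmf H \<theta> \<pi>)"
  then obtain s where s: "s \<in> set_pmf (init \<theta>)" and \<tau>: "\<tau> \<in> set_pmf (rollout \<theta> \<pi> H [] s)"
    by (auto simp: trajectory_pmf_def)
  have "s < nS" using s init_supp[OF \<theta>] by auto
  then have "\<tau> \<in> lists ({..<nO} \<times> {..<nA})" using rollout_lists[OF \<theta> \<pi>, of s "[]" H] \<tau> by auto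
  moreover have "length \<tau> = H" using rollout_prefix[OF \<tau>] by simp
  ultimately show "\<tau> \<in> trajectories nA nO H" by (simp add: trajectories_def)
qed

lemma pmf_trajectory:
  assumes \<theta>: "\<theta> \<in> params nS nA nO H" and \<tau>: "\<tau> \<in> trajectories nA nO H"
  shows "pmf (trajectory_pmf H \<theta> \<pi>) \<tau> = pol_prob \<pi> [] \<tau> * obs_prob nS \<theta> \<tau>"
proof -
  have "pmf (trajectory_pmf H \<theta> \<pi>) \<tau> = (\<Sum>s<nS. pmf (init \<theta>) s * pmf (rollout \<theta> \<pi> H [] s) \<tau>)"
    unfolding trajectory_pmf_def using init_supp[OF \<theta>] by (intro pmf_bind_finite) auto
  also have "\<dots> = (\<Sum>s<nS. pmf (init \<theta>) s * (pol_prob \<pi> [] \<tau> * obs_lik nS \<theta> 1 s \<tau>))"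
    using pmf_rollout[OF \<theta> _ \<tau>, of _ "[]" \<pi>] by (intro sum.cong refl) simp
  finally show ?thesis by (simp add: obs_prob_def sum_distrib_left mult_ac)
qed

text \<open>The history \<open>\<tau>0\<close> merely feeds the policy and is not tied to the state
  \<open>s\<close>; this freedom lets the statement be used conditionally on any past.\<close>

lemma pol_prob_obs_lik_total:
  assumes \<theta>: "\<theta> \<in> params nS nA nO H" and \<pi>: "\<pi> \<in> policies nA nO H"
  shows "s < nS \<Longrightarrow> \<tau>0 \<in> trajectories nA nO h \<Longrightarrow> h + n \<le> H \<Longrightarrow>
    (\<Sum>\<tau>\<in>trajectories nA nO n. pol_prob \<pi> \<tau>0 \<tau> * obs_lik nS \<theta> (Suc h) s \<tau>) = 1"
proof (induction n arbitrary: \<tau>0 s h)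
  case (Suc n)
  have E: "(\<Sum>x<nO. pmf (emit \<theta> (Suc h) s) x) = 1"
    using emit_supp[OF \<theta>, of "Suc h" s] Suc.prems by (intro sum_pmf_eq_1) auto
  have P: "(\<Sum>a<nA. pmf (\<pi> \<tau>0 x) a) = 1" if "x < nO" for x
    using policy_supp[OF \<pi> Suc.prems(2)] Suc.prems that by (intro sum_pmf_eq_1) auto
  have inner: "(\<Sum>\<tau>\<in>trajectories nA nO n. pol_prob \<pi> \<tau>0 ((x, a) # \<tau>) * obs_lik nS \<theta> (Suc h) s ((x, a) # \<tau>))
     = pmf (\<pi> \<tau>0 x) a * pmf (emit \<theta> (Suc h) s) x" if xa: "x < nO" "a < nA" for x a
  proof (cases "n = 0")
    case True
    then show ?thesis by simp
  next
    case False
    have T: "(\<Sum>s'<nS. pmf (trans \<theta> (Suc h) a s) s') = 1"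
      using trans_supp[OF \<theta>, of "Suc h" a s] Suc.prems False xa by (intro sum_pmf_eq_1) auto
    have app: "\<tau>0 @ [(x, a)] \<in> trajectories nA nO (Suc h)"
      using Suc.prems xa by (auto simp: trajectories_def)
    have "(\<Sum>\<tau>\<in>trajectories nA nO n. pol_prob \<pi> \<tau>0 ((x, a) # \<tau>) * obs_lik nS \<theta> (Suc h) s ((x, a) # \<tau>))
      = (\<Sum>\<tau>\<in>trajectories nA nO n. \<Sum>s'<nS. pmf (\<pi> \<tau>0 x) a * pmf (emit \<theta> (Suc h) s) x * pmf (trans \<theta> (Suc h) a s) s' *
           (pol_prob \<pi> (\<tau>0 @ [(x, a)]) \<tau> * obs_lik nS \<theta> (Suc (Suc h)) s' \<tau>))"
      using False by (intro sum.cong refl) (auto simp: sum_distrib_left mult_ac)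
    also have "\<dots> = (\<Sum>s'<nS. pmf (\<pi> \<tau>0 x) a * pmf (emit \<theta> (Suc h) s) x * pmf (trans \<theta> (Suc h) a s) s' *
           (\<Sum>\<tau>\<in>trajectories nA nO n. pol_prob \<pi> (\<tau>0 @ [(x, a)]) \<tau> * obs_lik nS \<theta> (Suc (Suc h)) s' \<tau>))"
      by (subst sum.swap) (simp add: sum_distrib_left)
    also have "\<dots> = (\<Sum>s'<nS. pmf (\<pi> \<tau>0 x) a * pmf (emit \<theta> (Suc h) s) x * pmf (trans \<theta> (Suc h) a s) s')"
      using Suc.IH[OF _ app] Suc.prems by (intro sum.cong refl) simp
    also have "\<dots> = pmf (\<pi> \<tau>0 x) a * pmf (emit \<theta> (Suc h) s) x"
      using T by (simp add: sum_distrib_left[symmetric])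
    finally show ?thesis .
  qed
  have "(\<Sum>\<tau>\<in>trajectories nA nO (Suc n). pol_prob \<pi> \<tau>0 \<tau> * obs_lik nS \<theta> (Suc h) s \<tau>)
    = (\<Sum>x<nO. \<Sum>a<nA. pmf (\<pi> \<tau>0 x) a * pmf (emit \<theta> (Suc h) s) x)"
    unfolding sum_trajectories_Suc using inner by (intro sum.cong refl) (simp del: pol_prob.simps obs_lik.simps)
  also have "\<dots> = (\<Sum>x<nO. pmf (emit \<theta> (Suc h) s) x)"
    using P by (intro sum.cong refl) (simp add: sum_distrib_right[symmetric])
  finally show ?case using E by simp
qed simp

text \<open>The future sums out because emissions, transitions and policy are normalized. The last
  recorded step needs care: \<open>obs_lik\<close> has no transition after it, but gains one as soon
  as further steps follow.\<close>

lemma pol_prob_obs_lik_marginal: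
  assumes \<theta>: "\<theta> \<in> params nS nA nO H" and \<pi>: "\<pi> \<in> policies nA nO H"
  shows "s < nS \<Longrightarrow> \<tau>0 \<in> trajectories nA nO h \<Longrightarrow> \<tau>1 \<in> trajectories nA nO n \<Longrightarrow> 0 < n \<Longrightarrow> h + n + k \<le> H \<Longrightarrow>
    (\<Sum>\<tau>2\<in>trajectories nA nO k. pol_prob \<pi> (\<tau>0 @ \<tau>1) \<tau>2 * obs_lik nS \<theta> (Suc h) s (\<tau>1 @ \<tau>2)) =
    obs_lik nS \<theta> (Suc h) s \<tau>1"
proof (induction \<tau>1 arbitrary: \<tau>0 s h n)
  case (Cons p \<tau>1)
  obtain x a where p: "p = (x, a)" by (cases p)
  obtain n' where n: "n = Suc n'" using Cons.prems by (cases n) auto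
  have xa: "x < nO" "a < nA" and \<tau>1: "\<tau>1 \<in> trajectories nA nO n'" using Cons.prems by (auto simp: p n)
  have app: "\<tau>0 @ [(x, a)] \<in> trajectories nA nO (Suc h)"
    using Cons.prems xa by (auto simp: trajectories_def)
  show ?case
  proof (cases "\<tau>1 = [] \<and> k = 0")
    case True
    then show ?thesis by (simp add: p)
  next
    case False
    then have ne: "\<tau>1 @ \<tau>2 \<noteq> []" if "\<tau>2 \<in> trajectories nA nO k" for \<tau>2
      using that by auto
    have pos: "0 < n' + k" using False \<tau>1 by (cases n') auto
    have T: "(\<Sum>s'<nS. pmf (trans \<theta> (Suc h) a s) s') = 1"
      using trans_supp[OF \<theta>, of "Suc h" a s] Cons.prems pos xa n by (intro sum_pmf_eq_1) auto
    have "(\<Sum>\<tau>2\<in>trajectories nA nO k. pol_prob \<pi> (\<tau>0 @ p # \<tau>1) \<tau>2 * obs_lik nS \<theta> (Suc h) s ((p # \<tau>1) @ \<tau>2))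
      = (\<Sum>\<tau>2\<in>trajectories nA nO k. \<Sum>s'<nS. pmf (emit \<theta> (Suc h) s) x * pmf (trans \<theta> (Suc h) a s) s' *
          (pol_prob \<pi> (\<tau>0 @ p # \<tau>1) \<tau>2 * obs_lik nS \<theta> (Suc (Suc h)) s' (\<tau>1 @ \<tau>2)))"
      using ne by (intro sum.cong refl) (auto simp: p sum_distrib_left mult_ac)
    also have "\<dots> = (\<Sum>s'<nS. pmf (emit \<theta> (Suc h) s) x * pmf (trans \<theta> (Suc h) a s) s' *
        (\<Sum>\<tau>2\<in>trajectories nA nO k. pol_prob \<pi> ((\<tau>0 @ [(x, a)]) @ \<tau>1) \<tau>2 * obs_lik nS \<theta> (Suc (Suc h)) s' (\<tau>1 @ \<tau>2)))"
      by (subst sum.swap) (simp add: sum_distrib_left p)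
    also have "\<dots> = (\<Sum>s'<nS. pmf (emit \<theta> (Suc h) s) x * pmf (trans \<theta> (Suc h) a s) s' * obs_lik nS \<theta> (Suc (Suc h)) s' \<tau>1)"
    proof (intro sum.cong refl)
      fix s' assume s': "s' \<in> {..<nS}"
      have "(\<Sum>\<tau>2\<in>trajectories nA nO k. pol_prob \<pi> ((\<tau>0 @ [(x, a)]) @ \<tau>1) \<tau>2 * obs_lik nS \<theta> (Suc (Suc h)) s' (\<tau>1 @ \<tau>2))
        = obs_lik nS \<theta> (Suc (Suc h)) s' \<tau>1"
      proof (cases "\<tau>1 = []")
        case True
        then show ?thesis
          using pol_prob_obs_lik_total[OF \<theta> \<pi> _ app, of s' k] s' Cons.prems n by simp
      next
        case False
        then have "0 < n'" using \<tau>1 by (cases n') auto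
        then show ?thesis using Cons.IH[OF _ app \<tau>1] s' Cons.prems n by simp
      qed
      then show "pmf (emit \<theta> (Suc h) s) x * pmf (trans \<theta> (Suc h) a s) s' *
        (\<Sum>\<tau>2\<in>trajectories nA nO k. pol_prob \<pi> ((\<tau>0 @ [(x, a)]) @ \<tau>1) \<tau>2 * obs_lik nS \<theta> (Suc (Suc h)) s' (\<tau>1 @ \<tau>2))
        = pmf (emit \<theta> (Suc h) s) x * pmf (trans \<theta> (Suc h) a s) s' * obs_lik nS \<theta> (Suc (Suc h)) s' \<tau>1"
        by simp
    qed
    also have "\<dots> = obs_lik nS \<theta> (Suc h) s (p # \<tau>1)"
    proof (cases "\<tau>1 = []")
      case True
      then show ?thesis using T by (simp add: p sum_distrib_left[symmetric])
    next
      case False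
      then show ?thesis by (simp add: p sum_distrib_left mult.assoc)
    qed
    finally show ?thesis by simp
  qed
qed simp

lemma obs_prob_marginal:
  assumes \<theta>: "\<theta> \<in> params nS nA nO H" and \<pi>: "\<pi> \<in> policies nA nO H"
    and \<tau>1: "\<tau>1 \<in> trajectories nA nO n" and n: "0 < n" "n + k \<le> H"
  shows "(\<Sum>\<tau>2\<in>trajectories nA nO k. pol_prob \<pi> \<tau>1 \<tau>2 * obs_prob nS \<theta> (\<tau>1 @ \<tau>2)) = obs_prob nS \<theta> \<tau>1"
proof -
  have "(\<Sum>\<tau>2\<in>trajectories nA nO k. pol_prob \<pi> \<tau>1 \<tau>2 * obs_prob nS \<theta> (\<tau>1 @ \<tau>2)) =
    (\<Sum>s<nS. pmf (init \<theta>) s * (\<Sum>\<tau>2\<in>trajectories nA nO k. pol_prob \<pi> \<tau>1 \<tau>2 * obs_lik nS \<theta> 1 s (\<tau>1 @ \<tau>2)))"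
    unfolding obs_prob_def sum_distrib_left by (subst sum.swap) (simp add: mult_ac)
  also have "\<dots> = (\<Sum>s<nS. pmf (init \<theta>) s * obs_lik nS \<theta> 1 s \<tau>1)"
    using pol_prob_obs_lik_marginal[OF \<theta> \<pi> _ _ \<tau>1 n(1), of _ "[]" 0 k] n by (intro sum.cong refl) simp
  finally show ?thesis by (simp add: obs_prob_def)
qed

section \<open>The l1-distance between the trajectory distributions of two models\<close>

definition l1_dist :: "nat \<Rightarrow> nat \<Rightarrow> nat \<Rightarrow> param \<Rightarrow> param \<Rightarrow> policy \<Rightarrow> nat \<Rightarrow> real" where
  "l1_dist nS nA nO \<theta> \<theta>' \<pi> n =
     (\<Sum>\<tau>\<in>trajectories nA nO n. pol_prob \<pi> [] \<tau> * \<bar>obs_prob nS \<theta> \<tau> - obs_prob nS \<theta>' \<tau>\<bar>)"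

lemma l1_dist_nonneg: "0 \<le> l1_dist nS nA nO \<theta> \<theta>' \<pi> n"
  by (auto simp: l1_dist_def intro!: sum_nonneg)

text \<open>Data processing: the first \<open>n\<close> steps are a marginal of the episode, and the
  triangle inequality moves the sum over continuations out of the absolute value.\<close>

lemma l1_dist_mono:
  assumes \<theta>: "\<theta> \<in> params nS nA nO H" and \<theta>': "\<theta>' \<in> params nS nA nO H" and \<pi>: "\<pi> \<in> policies nA nO H"
    and n: "0 < n" "n \<le> H"
  shows "l1_dist nS nA nO \<theta> \<theta>' \<pi> n \<le> l1_dist nS nA nO \<theta> \<theta>' \<pi> H"
proof -
  obtain k where H: "H = n + k" using n le_Suc_ex by blast
  have "l1_dist nS nA nO \<theta> \<theta>' \<pi> n \<le> (\<Sum>\<tau>1\<in>trajectories nA nO n. \<Sum>\<tau>2\<in>trajectories nA nO k.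
      pol_prob \<pi> [] (\<tau>1 @ \<tau>2) * \<bar>obs_prob nS \<theta> (\<tau>1 @ \<tau>2) - obs_prob nS \<theta>' (\<tau>1 @ \<tau>2)\<bar>)"
    unfolding l1_dist_def
  proof (intro sum_mono)
    fix \<tau>1 assume \<tau>1: "\<tau>1 \<in> trajectories nA nO n"
    have "\<bar>obs_prob nS \<theta> \<tau>1 - obs_prob nS \<theta>' \<tau>1\<bar> =
      \<bar>\<Sum>\<tau>2\<in>trajectories nA nO k. pol_prob \<pi> \<tau>1 \<tau>2 * (obs_prob nS \<theta> (\<tau>1 @ \<tau>2) - obs_prob nS \<theta>' (\<tau>1 @ \<tau>2))\<bar>"
      using obs_prob_marginal[OF \<theta> \<pi> \<tau>1 n(1), of k] obs_prob_marginal[OF \<theta>' \<pi> \<tau>1 n(1), of k] H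
      by (simp add: right_diff_distrib sum_subtractf)
    also have "\<dots> \<le> (\<Sum>\<tau>2\<in>trajectories nA nO k. pol_prob \<pi> \<tau>1 \<tau>2 * \<bar>obs_prob nS \<theta> (\<tau>1 @ \<tau>2) - obs_prob nS \<theta>' (\<tau>1 @ \<tau>2)\<bar>)"
      by (rule order_trans[OF sum_abs]) (simp add: abs_mult)
    finally have "pol_prob \<pi> [] \<tau>1 * \<bar>obs_prob nS \<theta> \<tau>1 - obs_prob nS \<theta>' \<tau>1\<bar> \<le> pol_prob \<pi> [] \<tau>1 *
      (\<Sum>\<tau>2\<in>trajectories nA nO k. pol_prob \<pi> \<tau>1 \<tau>2 * \<bar>obs_prob nS \<theta> (\<tau>1 @ \<tau>2) - obs_prob nS \<theta>' (\<tau>1 @ \<tau>2)\<bar>)"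
      by (rule mult_left_mono) simp
    then show "pol_prob \<pi> [] \<tau>1 * \<bar>obs_prob nS \<theta> \<tau>1 - obs_prob nS \<theta>' \<tau>1\<bar> \<le> (\<Sum>\<tau>2\<in>trajectories nA nO k.
      pol_prob \<pi> [] (\<tau>1 @ \<tau>2) * \<bar>obs_prob nS \<theta> (\<tau>1 @ \<tau>2) - obs_prob nS \<theta>' (\<tau>1 @ \<tau>2)\<bar>)"
      by (simp add: pol_prob_append sum_distrib_left mult_ac)
  qed
  then show ?thesis unfolding H by (simp add: l1_dist_def sum_trajectories_add)
qed

section \<open>Unnormalized beliefs and their l1-norms\<close>

lemma belief_append: "belief nS \<theta> h v (\<tau>1 @ \<tau>2) = belief nS \<theta> (h + length \<tau>1) (belief nS \<theta> h v \<tau>1) \<tau>2"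
  by (induction nS \<theta> h v \<tau>1 rule: belief.induct) auto

lemma sum_belief_step:
  "(\<Sum>s'<nS. belief_step nS \<theta> h x a v s' * f s') =
   (\<Sum>s<nS. v s * pmf (emit \<theta> h s) x * (\<Sum>s'<nS. pmf (trans \<theta> h a s) s' * f s'))"
  unfolding belief_step_def sum_distrib_left sum_distrib_right
  by (subst sum.swap) (simp add: mult_ac)

text \<open>The continuation must be nonempty: \<open>belief\<close> makes a transition after every
  recorded step, while \<open>obs_lik\<close> omits the one after the last.\<close>

lemma obs_lik_belief:
  "\<tau>2 \<noteq> [] \<Longrightarrow> (\<Sum>s<nS. v s * obs_lik nS \<theta> h s (\<tau>1 @ \<tau>2)) =
    (\<Sum>s<nS. belief nS \<theta> h v \<tau>1 s * obs_lik nS \<theta> (h + length \<tau>1) s \<tau>2)"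
proof (induction \<tau>1 arbitrary: h v)
  case (Cons p \<tau>1)
  obtain x a where p: "p = (x, a)" by (cases p)
  have "(\<Sum>s<nS. v s * obs_lik nS \<theta> h s ((p # \<tau>1) @ \<tau>2)) =
    (\<Sum>s'<nS. belief_step nS \<theta> h x a v s' * obs_lik nS \<theta> (Suc h) s' (\<tau>1 @ \<tau>2))"
    using Cons.prems by (simp add: p sum_belief_step mult_ac)
  also have "\<dots> = (\<Sum>s<nS. belief nS \<theta> (Suc h) (belief_step nS \<theta> h x a v) \<tau>1 s * obs_lik nS \<theta> (Suc h + length \<tau>1) s \<tau>2)"
    by (rule Cons.IH[OF Cons.prems])
  finally show ?case by (simp add: p)
qed simp

text \<open>Signed vectors are allowed on purpose: the bound is later applied to differences of
  state vectors.\<close>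

lemma belief_step_l1:
  assumes \<theta>: "\<theta> \<in> params nS nA nO H" and h: "1 \<le> h" "h < H" and a: "a < nA"
  shows "l1 nS (belief_step nS \<theta> h x a v) \<le> (\<Sum>s<nS. \<bar>v s\<bar> * pmf (emit \<theta> h s) x)"
proof -
  have "l1 nS (belief_step nS \<theta> h x a v) \<le>
    (\<Sum>s'<nS. \<Sum>s<nS. \<bar>v s\<bar> * pmf (emit \<theta> h s) x * pmf (trans \<theta> h a s) s')"
    unfolding belief_step_def by (intro sum_mono order_trans[OF sum_abs]) (simp add: abs_mult)
  also have "\<dots> = (\<Sum>s<nS. \<bar>v s\<bar> * pmf (emit \<theta> h s) x * (\<Sum>s'<nS. pmf (trans \<theta> h a s) s'))"
    by (subst sum.swap) (simp add: sum_distrib_left)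
  also have "\<dots> = (\<Sum>s<nS. \<bar>v s\<bar> * pmf (emit \<theta> h s) x)"
  proof (intro sum.cong refl)
    fix s assume "s \<in> {..<nS}"
    then have "(\<Sum>s'<nS. pmf (trans \<theta> h a s) s') = 1"
      using trans_supp[OF \<theta> h a] by (intro sum_pmf_eq_1) auto
    then show "\<bar>v s\<bar> * pmf (emit \<theta> h s) x * (\<Sum>s'<nS. pmf (trans \<theta> h a s) s') = \<bar>v s\<bar> * pmf (emit \<theta> h s) x"
      by simp
  qed
  finally show ?thesis .
qed

lemma sum_emit:
  assumes \<theta>: "\<theta> \<in> params nS nA nO H" and h: "1 \<le> h" "h \<le> H"
  shows "(\<Sum>x<nO. \<Sum>s<nS. c s * pmf (emit \<theta> h s) x) = (\<Sum>s<nS. c s)"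
proof -
  have "(\<Sum>x<nO. \<Sum>s<nS. c s * pmf (emit \<theta> h s) x) = (\<Sum>s<nS. c s * (\<Sum>x<nO. pmf (emit \<theta> h s) x))"
    by (subst sum.swap) (simp add: sum_distrib_left)
  also have "\<dots> = (\<Sum>s<nS. c s)"
  proof (intro sum.cong refl)
    fix s assume "s \<in> {..<nS}"
    then have "(\<Sum>x<nO. pmf (emit \<theta> h s) x) = 1"
      using emit_supp[OF \<theta> h] by (intro sum_pmf_eq_1) auto
    then show "c s * (\<Sum>x<nO. pmf (emit \<theta> h s) x) = c s" by simp
  qed
  finally show ?thesis .
qed

text \<open>Actions are summed without weights, which costs the factor \<open>nA\<close>; with
  policy weights, as in \<open>belief_step_policy_l1\<close>, a step does not expand the
  l1-norm.\<close>

lemma belief_step_all_l1: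
  assumes \<theta>: "\<theta> \<in> params nS nA nO H" and h: "1 \<le> h" "h < H"
  shows "(\<Sum>x<nO. \<Sum>a<nA. \<Sum>s'<nS. \<bar>belief_step nS \<theta> h x a v s'\<bar>) \<le> real nA * l1 nS v"
proof -
  have "(\<Sum>x<nO. \<Sum>a<nA. \<Sum>s'<nS. \<bar>belief_step nS \<theta> h x a v s'\<bar>) \<le>
    (\<Sum>x<nO. \<Sum>a<nA. \<Sum>s<nS. \<bar>v s\<bar> * pmf (emit \<theta> h s) x)"
    by (rule sum_mono, rule sum_mono, rule belief_step_l1[OF \<theta> h]) auto
  also have "\<dots> = real nA * (\<Sum>x<nO. \<Sum>s<nS. \<bar>v s\<bar> * pmf (emit \<theta> h s) x)"
    by (simp add: sum_distrib_left)
  also have "\<dots> = real nA * l1 nS v"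
    using sum_emit[OF \<theta>, of h "\<lambda>s. \<bar>v s\<bar>"] h by simp
  finally show ?thesis .
qed

lemma belief_step_policy_l1:
  assumes \<theta>: "\<theta> \<in> params nS nA nO H" and \<pi>: "\<pi> \<in> policies nA nO H"
    and \<tau>0: "\<tau>0 \<in> trajectories nA nO h" and h: "Suc h < H"
  shows "(\<Sum>x<nO. \<Sum>a<nA. pmf (\<pi> \<tau>0 x) a * l1 nS (belief_step nS \<theta> (Suc h) x a v)) \<le> l1 nS v"
proof -
  have "(\<Sum>x<nO. \<Sum>a<nA. pmf (\<pi> \<tau>0 x) a * l1 nS (belief_step nS \<theta> (Suc h) x a v)) \<le>
    (\<Sum>x<nO. \<Sum>a<nA. pmf (\<pi> \<tau>0 x) a * (\<Sum>s<nS. \<bar>v s\<bar> * pmf (emit \<theta> (Suc h) s) x))"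
    by (rule sum_mono, rule sum_mono, rule mult_left_mono, rule belief_step_l1[OF \<theta> _ h]) auto
  also have "\<dots> = (\<Sum>x<nO. (\<Sum>a<nA. pmf (\<pi> \<tau>0 x) a) * (\<Sum>s<nS. \<bar>v s\<bar> * pmf (emit \<theta> (Suc h) s) x))"
    by (simp add: sum_distrib_right)
  also have "\<dots> = (\<Sum>x<nO. \<Sum>s<nS. \<bar>v s\<bar> * pmf (emit \<theta> (Suc h) s) x)"
  proof (intro sum.cong refl)
    fix x assume "x \<in> {..<nO}"
    then have "(\<Sum>a<nA. pmf (\<pi> \<tau>0 x) a) = 1"
      using policy_supp[OF \<pi> \<tau>0] h by (intro sum_pmf_eq_1) auto
    then show "(\<Sum>a<nA. pmf (\<pi> \<tau>0 x) a) * (\<Sum>s<nS. \<bar>v s\<bar> * pmf (emit \<theta> (Suc h) s) x) =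
      (\<Sum>s<nS. \<bar>v s\<bar> * pmf (emit \<theta> (Suc h) s) x)" by simp
  qed
  also have "\<dots> = l1 nS v"
    using sum_emit[OF \<theta>, of "Suc h" "\<lambda>s. \<bar>v s\<bar>"] h by simp
  finally show ?thesis .
qed

lemma belief_l1:
  assumes \<theta>: "\<theta> \<in> params nS nA nO H" and \<pi>: "\<pi> \<in> policies nA nO H"
  shows "\<tau>0 \<in> trajectories nA nO h \<Longrightarrow> h + n < H \<Longrightarrow>
    (\<Sum>\<tau>\<in>trajectories nA nO n. pol_prob \<pi> \<tau>0 \<tau> * l1 nS (belief nS \<theta> (Suc h) v \<tau>)) \<le> l1 nS v"
proof (induction n arbitrary: \<tau>0 h v)
  case (Suc n)
  have "(\<Sum>\<tau>\<in>trajectories nA nO (Suc n). pol_prob \<pi> \<tau>0 \<tau> * l1 nS (belief nS \<theta> (Suc h) v \<tau>)) =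
    (\<Sum>x<nO. \<Sum>a<nA. pmf (\<pi> \<tau>0 x) a * (\<Sum>\<tau>\<in>trajectories nA nO n. pol_prob \<pi> (\<tau>0 @ [(x, a)]) \<tau> *
      l1 nS (belief nS \<theta> (Suc (Suc h)) (belief_step nS \<theta> (Suc h) x a v) \<tau>)))"
    by (simp add: sum_trajectories_Suc sum_distrib_left mult.assoc)
  also have "\<dots> \<le> (\<Sum>x<nO. \<Sum>a<nA. pmf (\<pi> \<tau>0 x) a * l1 nS (belief_step nS \<theta> (Suc h) x a v))"
  proof (intro sum_mono mult_left_mono)
    fix x a assume "x \<in> {..<nO}" "a \<in> {..<nA}"
    then have "\<tau>0 @ [(x, a)] \<in> trajectories nA nO (Suc h)"
      using Suc.prems by (auto simp: trajectories_def)
    from Suc.IH[OF this] Suc.prems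
    show "(\<Sum>\<tau>\<in>trajectories nA nO n. pol_prob \<pi> (\<tau>0 @ [(x, a)]) \<tau> *
      l1 nS (belief nS \<theta> (Suc (Suc h)) (belief_step nS \<theta> (Suc h) x a v) \<tau>)) \<le>
      l1 nS (belief_step nS \<theta> (Suc h) x a v)" by simp
  qed simp
  also have "\<dots> \<le> l1 nS v"
    using belief_step_policy_l1[OF \<theta> \<pi> Suc.prems(1)] Suc.prems by simp
  finally show ?case .
qed simp

section \<open>Policies that switch to uniform actions\<close>

lemma then_uniform_policies:
  assumes \<pi>: "\<pi> \<in> policies nA nO H" and nA: "1 \<le> nA"
  shows "then_uniform nA \<pi> h \<in> policies nA nO H"
proof -
  have "set_pmf (pmf_of_set {..<nA}) = {..<nA}" using nA by (intro set_pmf_of_set) (auto simp: lessThan_empty_iff)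
  then show ?thesis using \<pi> by (auto simp: policies_def then_uniform_def)
qed

lemma pol_prob_then_uniform_before:
  "length \<tau>0 + length \<tau> \<le> h \<Longrightarrow> pol_prob (then_uniform nA \<pi> h) \<tau>0 \<tau> = pol_prob \<pi> \<tau>0 \<tau>"
  by (induction \<pi> \<tau>0 \<tau> rule: pol_prob.induct) (auto simp: then_uniform_def)

lemma pol_prob_then_uniform_after:
  assumes nA: "1 \<le> nA"
  shows "h \<le> length \<tau>0 \<Longrightarrow> \<tau> \<in> trajectories nA nO n \<Longrightarrow>
    pol_prob (then_uniform nA \<pi> h) \<tau>0 \<tau> = (1 / real nA) ^ n"
proof (induction \<tau> arbitrary: \<tau>0 n)
  case (Cons p \<tau>)
  obtain x a where p: "p = (x, a)" by (cases p)
  obtain k where n: "n = Suc k" using Cons.prems by (cases n) auto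
  have "pmf (pmf_of_set {..<nA}) a = 1 / real nA"
    using Cons.prems by (subst pmf_of_set) (auto simp: p lessThan_empty_iff)
  then show ?case using Cons.IH[of "\<tau>0 @ [(x, a)]" k] Cons.prems
    by (auto simp: p n then_uniform_def)
qed simp

text \<open>Under uniform actions all action sequences have the same weight, so total probability 1
  turns into a count of action sequences. The dummy history of length \<open>h - 1\<close> only sets
  the step number.\<close>

lemma obs_lik_total:
  assumes \<theta>: "\<theta> \<in> params nS nA nO H" and \<pi>: "\<pi> \<in> policies nA nO H"
    and nA: "1 \<le> nA" and nO: "1 \<le> nO" and s: "s < nS" and h: "1 \<le> h" "h + n \<le> Suc H"
  shows "(\<Sum>\<tau>\<in>trajectories nA nO n. obs_lik nS \<theta> h s \<tau>) = real nA ^ n"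
proof -
  define \<tau>0 :: history where "\<tau>0 = replicate (h - 1) (0, 0)"
  have \<tau>0: "\<tau>0 \<in> trajectories nA nO (h - 1)"
    using nA nO by (auto simp: \<tau>0_def trajectories_def)
  have "1 = (\<Sum>\<tau>\<in>trajectories nA nO n. pol_prob (then_uniform nA \<pi> 0) \<tau>0 \<tau> * obs_lik nS \<theta> (Suc (h - 1)) s \<tau>)"
    using pol_prob_obs_lik_total[OF \<theta> then_uniform_policies[OF \<pi> nA] s \<tau>0, of n] h by simp
  also have "\<dots> = (\<Sum>\<tau>\<in>trajectories nA nO n. (1 / real nA) ^ n * obs_lik nS \<theta> h s \<tau>)"
    using pol_prob_then_uniform_after[OF nA, of 0 \<tau>0] h by (intro sum.cong refl) simp
  also have "\<dots> = (\<Sum>\<tau>\<in>trajectories nA nO n. obs_lik nS \<theta> h s \<tau>) / real nA ^ n"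
    by (simp add: sum_divide_distrib power_divide)
  finally show ?thesis using nA by (simp add: field_simps)
qed

lemma policy_value_eq:
  assumes \<theta>: "\<theta> \<in> params nS nA nO H" and \<pi>: "\<pi> \<in> policies nA nO H"
  shows "policy_value H r \<theta> \<pi> =
    (\<Sum>\<tau>\<in>trajectories nA nO H. pol_prob \<pi> [] \<tau> * obs_prob nS \<theta> \<tau> * (\<Sum>h=1..H. r h (fst (\<tau> ! (h - 1)))))"
proof -
  have "policy_value H r \<theta> \<pi> = (\<Sum>\<tau>\<in>trajectories nA nO H. (\<Sum>h=1..H. r h (fst (\<tau> ! (h - 1)))) * pmf (trajectory_pmf H \<theta> \<pi>) \<tau>)"
    unfolding policy_value_def
    using set_trajectory_pmf[OF \<theta> \<pi>] by (intro integral_measure_pmf_real) auto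
  also have "\<dots> = (\<Sum>\<tau>\<in>trajectories nA nO H. pol_prob \<pi> [] \<tau> * obs_prob nS \<theta> \<tau> * (\<Sum>h=1..H. r h (fst (\<tau> ! (h - 1)))))"
    using pmf_trajectory[OF \<theta>] by (intro sum.cong refl) (simp add: mult_ac)
  finally show ?thesis .
qed

lemma total_reward_bounds:
  assumes r: "\<forall>h\<in>{1..H}. \<forall>x<nO. 0 \<le> r h x \<and> r h x \<le> 1" and \<tau>: "\<tau> \<in> trajectories nA nO H"
  shows "0 \<le> (\<Sum>h=1..H. r h (fst (\<tau> ! (h - 1))))" "(\<Sum>h=1..H. r h (fst (\<tau> ! (h - 1)))) \<le> real H"
proof -
  have *: "0 \<le> r h (fst (\<tau> ! (h - 1))) \<and> r h (fst (\<tau> ! (h - 1))) \<le> 1" if h: "h \<in> {1..H}" for h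
  proof -
    have "\<tau> ! (h - 1) \<in> set \<tau>" using \<tau> h by (intro nth_mem) (auto simp: trajectories_def)
    then have "\<tau> ! (h - 1) \<in> {..<nO} \<times> {..<nA}" using \<tau> by (auto simp: trajectories_def lists_eq_set)
    then show ?thesis using r h by auto
  qed
  show "0 \<le> (\<Sum>h=1..H. r h (fst (\<tau> ! (h - 1))))" using * by (intro sum_nonneg) auto
  have "(\<Sum>h=1..H. r h (fst (\<tau> ! (h - 1)))) \<le> (\<Sum>h=1..H. 1)" using * by (intro sum_mono) auto
  then show "(\<Sum>h=1..H. r h (fst (\<tau> ! (h - 1)))) \<le> real H" by simp
qed

lemma policy_value_diff:
  assumes \<theta>: "\<theta> \<in> params nS nA nO H" and \<theta>': "\<theta>' \<in> params nS nA nO H" and \<pi>: "\<pi> \<in> policies nA nO H"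
    and r: "\<forall>h\<in>{1..H}. \<forall>x<nO. 0 \<le> r h x \<and> r h x \<le> 1"
  shows "\<bar>policy_value H r \<theta> \<pi> - policy_value H r \<theta>' \<pi>\<bar> \<le> real H * l1_dist nS nA nO \<theta> \<theta>' \<pi> H"
proof -
  let ?R = "\<lambda>\<tau> :: history. \<Sum>h=1..H. r h (fst (\<tau> ! (h - 1)))"
  have "policy_value H r \<theta> \<pi> - policy_value H r \<theta>' \<pi> =
    (\<Sum>\<tau>\<in>trajectories nA nO H. pol_prob \<pi> [] \<tau> * (obs_prob nS \<theta> \<tau> - obs_prob nS \<theta>' \<tau>) * ?R \<tau>)"
    unfolding policy_value_eq[OF \<theta> \<pi>] policy_value_eq[OF \<theta>' \<pi>]
    by (simp add: sum_subtractf[symmetric] left_diff_distrib right_diff_distrib)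
  also have "\<bar>\<dots>\<bar> \<le> (\<Sum>\<tau>\<in>trajectories nA nO H. real H * (pol_prob \<pi> [] \<tau> * \<bar>obs_prob nS \<theta> \<tau> - obs_prob nS \<theta>' \<tau>\<bar>))"
  proof (intro order_trans[OF sum_abs] sum_mono)
    fix \<tau> assume \<tau>: "\<tau> \<in> trajectories nA nO H"
    have "\<bar>pol_prob \<pi> [] \<tau> * (obs_prob nS \<theta> \<tau> - obs_prob nS \<theta>' \<tau>) * ?R \<tau>\<bar> =
      ?R \<tau> * (pol_prob \<pi> [] \<tau> * \<bar>obs_prob nS \<theta> \<tau> - obs_prob nS \<theta>' \<tau>\<bar>)"
      using total_reward_bounds(1)[OF r \<tau>] by (simp only: abs_mult abs_of_nonneg pol_prob_nonneg mult_ac)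
    also have "\<dots> \<le> real H * (pol_prob \<pi> [] \<tau> * \<bar>obs_prob nS \<theta> \<tau> - obs_prob nS \<theta>' \<tau>\<bar>)"
      using total_reward_bounds(2)[OF r \<tau>] by (intro mult_right_mono) auto
    finally show "\<bar>pol_prob \<pi> [] \<tau> * (obs_prob nS \<theta> \<tau> - obs_prob nS \<theta>' \<tau>) * ?R \<tau>\<bar> \<le>
      real H * (pol_prob \<pi> [] \<tau> * \<bar>obs_prob nS \<theta> \<tau> - obs_prob nS \<theta>' \<tau>\<bar>)" .
  qed
  finally show ?thesis by (simp add: l1_dist_def sum_distrib_left)
qed

text \<open>Histories pair every observation with an action, whereas a row of the emission-action
  matrix has one action less. The missing one comes after the last observation and has no influence,
  so any \<open>b\<close> serves.\<close>

lemma pmf_observations: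
  assumes \<theta>: "\<theta> \<in> params nS nA nO H"
  shows "s < nS \<Longrightarrow> as \<in> lists {..<nA} \<Longrightarrow> length xs = Suc (length as) \<Longrightarrow> 1 \<le> h \<Longrightarrow> h + length as \<le> H \<Longrightarrow>
    pmf (observations_pmf \<theta> h s as) xs = obs_lik nS \<theta> h s (zip xs (as @ [b]))"
proof (induction as arbitrary: h s xs)
  case Nil
  then obtain x where "xs = [x]" by (auto simp: length_Suc_conv)
  moreover have "pmf (map_pmf (\<lambda>x. [x]) (emit \<theta> h s)) [x] = pmf (emit \<theta> h s) x"
    by (rule pmf_map_inj'[where f = "\<lambda>x. [x]"]) (auto simp: inj_def)
  ultimately show ?case by simp
next
  case (Cons a as)
  then obtain x xs' where xs: "xs = x # xs'" "length xs' = Suc (length as)"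
    by (auto simp: length_Suc_conv)
  have ne: "zip xs' (as @ [b]) \<noteq> []" using xs by (cases xs'; cases as) auto
  have a: "a < nA" and as: "as \<in> lists {..<nA}" using Cons.prems by auto
  define K where "K x' = bind_pmf (trans \<theta> h a s) (\<lambda>s'. map_pmf ((#) x') (observations_pmf \<theta> (h + 1) s' as))" for x'
  have "observations_pmf \<theta> h s (a # as) = bind_pmf (emit \<theta> h s) K"
    by (simp add: K_def[abs_def] map_pmf_def bind_assoc_pmf bind_return_pmf)
  also have "pmf (bind_pmf (emit \<theta> h s) K) xs = pmf (emit \<theta> h s) x * pmf (K x) xs"
  proof (rule pmf_bind_single)
    fix x' assume "x' \<noteq> x"
    then have "xs \<notin> set_pmf (K x')" by (auto simp: K_def xs)
    then show "pmf (K x') xs = 0" by (simp add: pmf_eq_0_set_pmf)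
  qed
  also have "pmf (K x) xs = (\<Sum>s'<nS. pmf (trans \<theta> h a s) s' * pmf (map_pmf ((#) x) (observations_pmf \<theta> (h + 1) s' as)) xs)"
    unfolding K_def using trans_supp[OF \<theta>, of h a s] Cons.prems a by (intro pmf_bind_finite) auto
  also have "\<dots> = (\<Sum>s'<nS. pmf (trans \<theta> h a s) s' * obs_lik nS \<theta> (Suc h) s' (zip xs' (as @ [b])))"
  proof (intro sum.cong refl)
    fix s' assume s': "s' \<in> {..<nS}"
    have "pmf (map_pmf ((#) x) (observations_pmf \<theta> (h + 1) s' as)) xs = pmf (observations_pmf \<theta> (h + 1) s' as) xs'"
      unfolding xs by (rule pmf_map_inj'[where f = "(#) x"]) (auto simp: inj_def)
    also have "\<dots> = obs_lik nS \<theta> (Suc h) s' (zip xs' (as @ [b]))"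
      using Cons.IH[of s' xs' "Suc h"] s' as xs Cons.prems by simp
    finally show "pmf (trans \<theta> h a s) s' * pmf (map_pmf ((#) x) (observations_pmf \<theta> (h + 1) s' as)) xs =
      pmf (trans \<theta> h a s) s' * obs_lik nS \<theta> (Suc h) s' (zip xs' (as @ [b]))" by simp
  qed
  finally show ?case using ne by (simp add: xs)
qed

text \<open>The rows of the emission-action matrix inject into the histories of length
  \<open>m\<close> whose last action is 0; the other histories only add squares.\<close>

lemma obs_lik_lower_bound:
  assumes \<theta>: "\<theta> \<in> params nS nA nO H" and dims: "1 \<le> nS" "1 \<le> nA" and m: "1 \<le> m" "m \<le> H"
    and \<alpha>: "0 < \<alpha>" "\<alpha> \<le> min_singular_value nS nA nO H m \<theta>" and h: "1 \<le> h" "h \<le> H - m + 1"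
  shows "\<alpha>\<^sup>2 * dot nS v v \<le> (\<Sum>\<tau>\<in>trajectories nA nO m. (\<Sum>s<nS. obs_lik nS \<theta> h s \<tau> * v s)\<^sup>2)"
proof -
  let ?rows = "emission_action_rows nA nO m"
  have len: "length ?rows = nA ^ (m - 1) * nO ^ m"
    by (simp add: emission_action_rows_def length_n_lists)
  have dist: "distinct ?rows"
    unfolding emission_action_rows_def by (intro distinct_product distinct_n_lists) auto
  let ?M = "emission_action_matrix nS nA nO m \<theta> h"
  have M: "?M \<in> carrier_mat (nA ^ (m - 1) * nO ^ m) nS" by (simp add: emission_action_matrix_def)
  have "\<alpha> \<le> singular_value nS ?M"
    using \<alpha>(2) h unfolding min_singular_value_def by (subst (asm) Min_ge_iff) auto
  from singular_value_bound[OF M dims(1) this \<alpha>(1), of v]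
  have "\<alpha>\<^sup>2 * dot nS v v \<le> (\<Sum>i<nA ^ (m - 1) * nO ^ m. (\<Sum>j<nS. ?M $$ (i, j) * v j)\<^sup>2)" .
  also have "\<dots> = (\<Sum>i<length ?rows. (\<Sum>j<nS. pmf (observations_pmf \<theta> h j (fst (?rows ! i))) (snd (?rows ! i)) * v j)\<^sup>2)"
    unfolding len by (intro sum.cong refl arg_cong[where f = "\<lambda>x. x\<^sup>2"])
      (simp add: emission_action_matrix_def case_prod_unfold)
  also have "\<dots> = (\<Sum>p\<in>set ?rows. (\<Sum>j<nS. pmf (observations_pmf \<theta> h j (fst p)) (snd p) * v j)\<^sup>2)"
    using sum.reindex_bij_betw[OF bij_betw_nth[OF dist refl refl],
        of "\<lambda>p. (\<Sum>j<nS. pmf (observations_pmf \<theta> h j (fst p)) (snd p) * v j)\<^sup>2"] by simp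
  also have "\<dots> = (\<Sum>p\<in>set ?rows. (\<Sum>j<nS. obs_lik nS \<theta> h j (zip (snd p) (fst p @ [0])) * v j)\<^sup>2)"
  proof (intro sum.cong refl arg_cong[where f = "\<lambda>x. x\<^sup>2"])
    fix p j assume p: "p \<in> set ?rows" and j: "j \<in> {..<nS}"
    have "fst p \<in> lists {..<nA}" "length (fst p) = m - 1" "length (snd p) = m"
      using p by (auto simp: emission_action_rows_def set_n_lists lists_eq_set)
    then show "pmf (observations_pmf \<theta> h j (fst p)) (snd p) * v j = obs_lik nS \<theta> h j (zip (snd p) (fst p @ [0])) * v j"
      using pmf_observations[OF \<theta>, of j "fst p" "snd p" h 0] j h m by simp
  qed
  also have "\<dots> = (\<Sum>\<tau>\<in>(\<lambda>p. zip (snd p) (fst p @ [0])) ` set ?rows. (\<Sum>j<nS. obs_lik nS \<theta> h j \<tau> * v j)\<^sup>2)"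
  proof (subst sum.reindex)
    show "inj_on (\<lambda>p. zip (snd p) (fst p @ [0])) (set ?rows)"
    proof (rule inj_onI)
      fix p q assume pq: "p \<in> set ?rows" "q \<in> set ?rows" and eq: "zip (snd p) (fst p @ [0]) = zip (snd q) (fst q @ [0])"
      have l: "length (fst p @ [0]) = length (snd p)" "length (fst q @ [0]) = length (snd q)"
        using pq m by (auto simp: emission_action_rows_def set_n_lists)
      have "snd p = snd q" using arg_cong[OF eq, of "map fst"] l by (simp add: map_fst_zip)
      moreover have "fst p @ [0] = fst q @ [0]" using arg_cong[OF eq, of "map snd"] l by (simp add: map_snd_zip)
      ultimately show "p = q" by (simp add: prod_eq_iff)
    qed
  qed simp
  also have "\<dots> \<le> (\<Sum>\<tau>\<in>trajectories nA nO m. (\<Sum>s<nS. obs_lik nS \<theta> h s \<tau> * v s)\<^sup>2)"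
  proof (intro sum_mono2)
    show "(\<lambda>p. zip (snd p) (fst p @ [0])) ` set ?rows \<subseteq> trajectories nA nO m"
    proof (intro image_subsetI)
      fix p assume "p \<in> set ?rows"
      then have p: "set (fst p) \<subseteq> {..<nA}" "length (fst p) = m - 1" "set (snd p) \<subseteq> {..<nO}" "length (snd p) = m"
        by (auto simp: emission_action_rows_def set_n_lists)
      have "set (zip (snd p) (fst p @ [0])) \<subseteq> set (snd p) \<times> set (fst p @ [0])"
        by (auto dest: set_zip_leftD set_zip_rightD)
      also have "\<dots> \<subseteq> {..<nO} \<times> {..<nA}" using p dims by auto
      finally show "zip (snd p) (fst p @ [0]) \<in> trajectories nA nO m"
        using p m by (simp add: trajectories_def lists_eq_set)
    qed
  qed auto
  finally show ?thesis .
qed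

section \<open>A finite one-sided cover of the models\<close>

text \<open>If all numerators vanish, the function does not sum to 1 and \<open>embed_pmf\<close>
  gives an unspecified distribution.\<close>

definition code_pmf :: "nat \<Rightarrow> (nat \<Rightarrow> nat) \<Rightarrow> nat pmf" where
  "code_pmf d w = embed_pmf (\<lambda>i. if i < d then real (w i) / real (\<Sum>j<d. w j) else 0)"

lemma pmf_code_pmf:
  assumes "0 < (\<Sum>j<d. w j)"
  shows "pmf (code_pmf d w) i = (if i < d then real (w i) / real (\<Sum>j<d. w j) else 0)"
proof -
  define W where "W = (\<Sum>j<d. w j)"
  let ?f = "\<lambda>i. if i < d then real (w i) / real W else 0"
  have W: "0 < W" using assms by (simp add: W_def)
  have "(\<integral>\<^sup>+ i. ennreal (?f i) \<partial>count_space UNIV) = (\<Sum>i<d. ennreal (?f i))"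
    by (rule nn_integral_count_space') auto
  also have "\<dots> = ennreal (\<Sum>i<d. ?f i)" by (rule sum_ennreal) auto
  also have "(\<Sum>i<d. ?f i) = (\<Sum>i<d. real (w i)) / real W"
    unfolding sum_divide_distrib by (intro sum.cong refl) auto
  also have "(\<Sum>i<d. real (w i)) = real W" by (simp add: W_def)
  finally have "(\<integral>\<^sup>+ i. ennreal (?f i) \<partial>count_space UNIV) = 1" using W by simp
  then have "pmf (embed_pmf ?f) i = ?f i" by (intro pmf_embed_pmf) auto
  then show ?thesis by (simp only: code_pmf_def W_def)
qed

definition pmf_code :: "nat \<Rightarrow> nat pmf \<Rightarrow> nat \<Rightarrow> nat" where
  "pmf_code N p i = nat \<lceil>real N * pmf p i\<rceil>"

lemma pmf_code_le: "pmf_code N p i \<le> N"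
proof -
  have "real N * pmf p i \<le> real N" by (simp add: mult_left_le pmf_le_1)
  then have "\<lceil>real N * pmf p i\<rceil> \<le> int N" unfolding ceiling_le_iff by simp
  then show ?thesis unfolding pmf_code_def nat_le_iff .
qed

text \<open>Rounding up makes \<open>w i / N\<close> at least \<open>p i\<close>. Each ceiling adds
  at most 1, so normalization divides by at most \<open>N + d\<close> instead of
  \<open>N\<close>.\<close>

lemma pmf_code_cover:
  assumes p: "set_pmf p \<subseteq> {..<d}" and N: "1 \<le> N"
  shows "set_pmf (code_pmf d (pmf_code N p)) \<subseteq> {..<d}"
    and "pmf p i \<le> (1 + real d / real N) * pmf (code_pmf d (pmf_code N p)) i"
proof -
  let ?w = "pmf_code N p"
  have lo: "real N * pmf p j \<le> real (?w j)" for j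
    unfolding pmf_code_def by (rule real_nat_ceiling_ge)
  have hi: "real (?w j) \<le> real N * pmf p j + 1" for j
  proof -
    have "0 \<le> real N * pmf p j" by simp
    then have "0 \<le> \<lceil>real N * pmf p j\<rceil>" by linarith
    then show ?thesis unfolding pmf_code_def using of_int_ceiling_le_add_one[of "real N * pmf p j"] by simp
  qed
  have one: "(\<Sum>j<d. pmf p j) = 1" using p by (intro sum_pmf_eq_1) auto
  have "real N * (\<Sum>j<d. pmf p j) \<le> (\<Sum>j<d. real (?w j))"
    unfolding sum_distrib_left using lo by (intro sum_mono)
  then have "real N \<le> real (\<Sum>j<d. ?w j)" using one by simp
  then have "0 < real (\<Sum>j<d. ?w j)" using N by linarith
  then have pos: "0 < (\<Sum>j<d. ?w j)" by (simp only: of_nat_0_less_iff)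
  have "(\<Sum>j<d. real (?w j)) \<le> (\<Sum>j<d. real N * pmf p j + 1)" using hi by (intro sum_mono)
  also have "\<dots> = real N + real d" using one by (simp add: sum.distrib sum_distrib_left[symmetric])
  finally have W: "real (\<Sum>j<d. ?w j) \<le> real N + real d" by simp
  note pmf_eq = pmf_code_pmf[OF pos]
  show "set_pmf (code_pmf d ?w) \<subseteq> {..<d}"
  proof
    fix i assume "i \<in> set_pmf (code_pmf d ?w)"
    then have "pmf (code_pmf d ?w) i \<noteq> 0" by (simp add: set_pmf_iff)
    then show "i \<in> {..<d}" by (auto simp: pmf_eq split: if_splits)
  qed
  show "pmf p i \<le> (1 + real d / real N) * pmf (code_pmf d ?w) i"
  proof (cases "i < d")
    case True
    have "pmf p i \<le> real (?w i) / real N" using lo[of i] N by (simp add: field_simps)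
    also have "\<dots> = (real N + real d) / real N * (real (?w i) / (real N + real d))"
      using N by simp
    also have "\<dots> \<le> (real N + real d) / real N * (real (?w i) / real (\<Sum>j<d. ?w j))"
      using W pos N by (intro mult_left_mono divide_left_mono mult_pos_pos) (auto simp del: of_nat_sum)
    also have "\<dots> = (1 + real d / real N) * pmf (code_pmf d ?w) i"
      using True N by (simp add: pmf_eq field_simps del: of_nat_sum)
    finally show ?thesis .
  next
    case False
    then have "pmf p i = 0" using p by (auto simp: set_pmf_iff)
    then show ?thesis by (simp add: pmf_eq False)
  qed
qed

text \<open>A code is a table of numerators; the first component of an index tells initial, transition
  and emission entries apart.\<close>

definition code_index :: "nat \<Rightarrow> nat \<Rightarrow> nat \<Rightarrow> nat \<Rightarrow> (nat \<times> nat \<times> nat \<times> nat \<times> nat) set" where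
  "code_index nS nA nO H =
     {0} \<times> {0} \<times> {0} \<times> {0} \<times> {..<nS} \<union>
     {1} \<times> {1..H - 1} \<times> {..<nA} \<times> {..<nS} \<times> {..<nS} \<union>
     {2} \<times> {1..H} \<times> {0} \<times> {..<nS} \<times> {..<nO}"

definition decode :: "nat \<Rightarrow> nat \<Rightarrow> (nat \<times> nat \<times> nat \<times> nat \<times> nat \<Rightarrow> nat) \<Rightarrow> param" where
  "decode nS nO q = \<lparr>init = code_pmf nS (\<lambda>i. q (0, 0, 0, 0, i)),
     trans = (\<lambda>h a s. code_pmf nS (\<lambda>i. q (1, h, a, s, i))),
     emit = (\<lambda>h s. code_pmf nO (\<lambda>i. q (2, h, 0, s, i)))\<rparr>"

text \<open>Every table counts, also those with vanishing rows, so a member need not lie in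
  \<open>params\<close>; comparisons with a given model use a member that does.\<close>

definition cover :: "nat \<Rightarrow> nat \<Rightarrow> nat \<Rightarrow> nat \<Rightarrow> nat \<Rightarrow> param set" where
  "cover nS nA nO H N = decode nS nO ` (\<Pi>\<^sub>E i\<in>code_index nS nA nO H. {..N})"

lemma finite_code_index [simp]: "finite (code_index nS nA nO H)"
  by (simp add: code_index_def)

lemma card_code_index: "card (code_index nS nA nO H) \<le> nS + H * nA * nS * nS + H * nS * nO"
proof -
  have "card (code_index nS nA nO H) \<le> card ({0::nat} \<times> {0::nat} \<times> {0::nat} \<times> {0::nat} \<times> {..<nS}) +
     card ({1::nat} \<times> {1..H - 1} \<times> {..<nA} \<times> {..<nS} \<times> {..<nS}) +
     card ({2::nat} \<times> {1..H} \<times> {0::nat} \<times> {..<nS} \<times> {..<nO})"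
    unfolding code_index_def by (meson add_mono card_Un_le order_refl order_trans)
  also have "\<dots> = nS + (H - 1) * (nA * (nS * nS)) + H * (nS * nO)"
    by (simp add: card_cartesian_product)
  also have "\<dots> \<le> nS + H * (nA * (nS * nS)) + H * (nS * nO)" by simp
  finally show ?thesis by (simp add: mult.assoc)
qed

lemma finite_cover [simp]: "finite (cover nS nA nO H N)"
  unfolding cover_def by (intro finite_imageI finite_PiE) auto

lemma cover_nonempty: "cover nS nA nO H N \<noteq> {}"
  by (simp add: cover_def PiE_eq_empty_iff)

lemma card_cover: "card (cover nS nA nO H N) \<le> (N + 1) ^ card (code_index nS nA nO H)"
proof -
  have "card (cover nS nA nO H N) \<le> card (\<Pi>\<^sub>E i\<in>code_index nS nA nO H. {..N})"
    unfolding cover_def by (intro card_image_le finite_PiE) auto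
  also have "\<dots> = (N + 1) ^ card (code_index nS nA nO H)" by (simp add: card_PiE)
  finally show ?thesis .
qed

definition dominates :: "nat \<Rightarrow> nat \<Rightarrow> nat \<Rightarrow> real \<Rightarrow> param \<Rightarrow> param \<Rightarrow> bool" where
  "dominates nS nA H c \<theta>' \<theta> \<longleftrightarrow>
     (\<forall>s. pmf (init \<theta>) s \<le> c * pmf (init \<theta>') s) \<and>
     (\<forall>h\<in>{1..H - 1}. \<forall>a<nA. \<forall>s<nS. \<forall>s'. pmf (trans \<theta> h a s) s' \<le> c * pmf (trans \<theta>' h a s) s') \<and>
     (\<forall>h\<in>{1..H}. \<forall>s<nS. \<forall>x. pmf (emit \<theta> h s) x \<le> c * pmf (emit \<theta>' h s) x)"

lemma cover_dominates:
  assumes \<theta>: "\<theta> \<in> params nS nA nO H" and N: "1 \<le> N"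
  obtains \<theta>' where "\<theta>' \<in> cover nS nA nO H N" "\<theta>' \<in> params nS nA nO H"
    "dominates nS nA H (1 + real (nS + nO) / real N) \<theta>' \<theta>"
proof -
  define raw where "raw = (\<lambda>(t :: nat, h :: nat, a :: nat, s :: nat, i :: nat).
     if t = 0 then pmf_code N (init \<theta>) i
     else if t = 1 then pmf_code N (trans \<theta> h a s) i else pmf_code N (emit \<theta> h s) i)"
  define q where "q = restrict raw (code_index nS nA nO H)"
  define \<theta>' where "\<theta>' = decode nS nO q"
  have q: "q \<in> (\<Pi>\<^sub>E i\<in>code_index nS nA nO H. {..N})"
    by (auto simp: q_def raw_def pmf_code_le)
  have cong: "code_pmf d w = code_pmf d w'" if "\<And>i. i < d \<Longrightarrow> w i = w' i" for d w w'
    unfolding code_pmf_def using that by (intro arg_cong[where f = embed_pmf] ext) auto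
  have i: "init \<theta>' = code_pmf nS (pmf_code N (init \<theta>))"
    by (auto simp: \<theta>'_def decode_def q_def raw_def code_index_def intro!: cong)
  have t: "trans \<theta>' h a s = code_pmf nS (pmf_code N (trans \<theta> h a s))"
    if "h \<in> {1..H - 1}" "a < nA" "s < nS" for h a s
    using that by (auto simp: \<theta>'_def decode_def q_def raw_def code_index_def intro!: cong)
  have e: "emit \<theta>' h s = code_pmf nO (pmf_code N (emit \<theta> h s))"
    if "h \<in> {1..H}" "s < nS" for h s
    using that by (auto simp: \<theta>'_def decode_def q_def raw_def code_index_def intro!: cong)
  have c: "pmf p x \<le> (1 + real (nS + nO) / real N) * pmf p' x"
    if "pmf p x \<le> (1 + real d / real N) * pmf p' x" "d \<le> nS + nO" for p p' :: "nat pmf" and x d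
    using that(2) N by (intro order_trans[OF that(1)] mult_right_mono add_left_mono divide_right_mono) auto
  note supp = init_supp[OF \<theta>]
  have sT: "set_pmf (trans \<theta> h a s) \<subseteq> {..<nS}" if "h \<in> {1..H - 1}" "a < nA" "s < nS" for h a s
    using \<theta> that by (auto simp: params_def)
  have sE: "set_pmf (emit \<theta> h s) \<subseteq> {..<nO}" if "h \<in> {1..H}" "s < nS" for h s
    using \<theta> that by (auto simp: params_def)
  have "\<theta>' \<in> params nS nA nO H"
    unfolding params_def using pmf_code_cover(1)[OF supp N] pmf_code_cover(1)[OF sT N] pmf_code_cover(1)[OF sE N]
    by (simp add: i t e)
  moreover have "dominates nS nA H (1 + real (nS + nO) / real N) \<theta>' \<theta>"
    unfolding dominates_def
  proof (intro conjI ballI allI impI)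
    fix s show "pmf (init \<theta>) s \<le> (1 + real (nS + nO) / real N) * pmf (init \<theta>') s"
      unfolding i by (rule c[OF pmf_code_cover(2)[OF supp N]]) simp
  next
    fix h a s s' assume *: "h \<in> {1..H - 1}" "a < nA" "s < nS"
    show "pmf (trans \<theta> h a s) s' \<le> (1 + real (nS + nO) / real N) * pmf (trans \<theta>' h a s) s'"
      unfolding t[OF *] by (rule c[OF pmf_code_cover(2)[OF sT[OF *] N]]) simp
  next
    fix h s x assume *: "h \<in> {1..H}" "s < nS"
    show "pmf (emit \<theta> h s) x \<le> (1 + real (nS + nO) / real N) * pmf (emit \<theta>' h s) x"
      unfolding e[OF *] by (rule c[OF pmf_code_cover(2)[OF sE[OF *] N]]) simp
  qed
  moreover have "\<theta>' \<in> cover nS nA nO H N" using q by (auto simp: \<theta>'_def cover_def)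
  ultimately show ?thesis using that by blast
qed

text \<open>Every step contributes at most one emission and one transition, hence the exponent
  \<open>2 * n\<close>.\<close>

lemma dominates_obs_lik:
  assumes dom: "dominates nS nA H c \<theta>' \<theta>" and c: "1 \<le> c"
  shows "s < nS \<Longrightarrow> 1 \<le> h \<Longrightarrow> \<tau> \<in> trajectories nA nO n \<Longrightarrow> h + n \<le> Suc H \<Longrightarrow>
    obs_lik nS \<theta> h s \<tau> \<le> c ^ (2 * n) * obs_lik nS \<theta>' h s \<tau>"
proof (induction \<tau> arbitrary: h s n)
  case (Cons p \<tau>)
  obtain x a where p: "p = (x, a)" by (cases p)
  obtain k where n: "n = Suc k" using Cons.prems by (cases n) auto
  have \<tau>: "\<tau> \<in> trajectories nA nO k" and a: "a < nA" using Cons.prems by (auto simp: p n)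
  have e: "pmf (emit \<theta> h s) x \<le> c * pmf (emit \<theta>' h s) x"
    using dom Cons.prems n by (auto simp: dominates_def)
  have rest: "(if \<tau> = [] then 1 else \<Sum>s'<nS. pmf (trans \<theta> h a s) s' * obs_lik nS \<theta> (Suc h) s' \<tau>) \<le>
     c * c ^ (2 * k) * (if \<tau> = [] then 1 else \<Sum>s'<nS. pmf (trans \<theta>' h a s) s' * obs_lik nS \<theta>' (Suc h) s' \<tau>)"
  proof (cases "\<tau> = []")
    case True
    have "1 * 1 \<le> c * c ^ (2 * k)" using c by (intro mult_mono one_le_power) auto
    then show ?thesis using True by simp
  next
    case False
    then have "0 < k" using \<tau> by (cases k) auto
    then have h: "h \<in> {1..H - 1}" using Cons.prems n by auto
    have "(\<Sum>s'<nS. pmf (trans \<theta> h a s) s' * obs_lik nS \<theta> (Suc h) s' \<tau>) \<le>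
      (\<Sum>s'<nS. (c * pmf (trans \<theta>' h a s) s') * (c ^ (2 * k) * obs_lik nS \<theta>' (Suc h) s' \<tau>))"
    proof (intro sum_mono mult_mono)
      fix s' assume "s' \<in> {..<nS}"
      then show "obs_lik nS \<theta> (Suc h) s' \<tau> \<le> c ^ (2 * k) * obs_lik nS \<theta>' (Suc h) s' \<tau>"
        using Cons.IH[OF _ _ \<tau>, of s' "Suc h"] Cons.prems n by auto
      show "pmf (trans \<theta> h a s) s' \<le> c * pmf (trans \<theta>' h a s) s'"
        using dom h a Cons.prems by (auto simp: dominates_def)
    qed (use c in auto)
    then show ?thesis using False by (simp add: sum_distrib_left mult_ac)
  qed
  have "obs_lik nS \<theta> h s (p # \<tau>) \<le> (c * pmf (emit \<theta>' h s) x) *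
     (c * c ^ (2 * k) * (if \<tau> = [] then 1 else \<Sum>s'<nS. pmf (trans \<theta>' h a s) s' * obs_lik nS \<theta>' (Suc h) s' \<tau>))"
    unfolding p obs_lik.simps using c
    by (intro mult_mono e rest) (auto intro!: sum_nonneg)
  then show ?case by (simp add: p n mult_ac)
qed simp

lemma dominates_obs_prob:
  assumes dom: "dominates nS nA H c \<theta>' \<theta>" and c: "1 \<le> c" and \<tau>: "\<tau> \<in> trajectories nA nO H" and H: "1 \<le> H"
  shows "obs_prob nS \<theta> \<tau> \<le> c ^ (3 * H) * obs_prob nS \<theta>' \<tau>"
proof -
  have "obs_prob nS \<theta> \<tau> \<le> (\<Sum>s<nS. (c * pmf (init \<theta>') s) * (c ^ (2 * H) * obs_lik nS \<theta>' 1 s \<tau>))"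
    unfolding obs_prob_def using c dom dominates_obs_lik[OF dom c _ _ \<tau>, of _ 1]
    by (intro sum_mono mult_mono) (auto simp: dominates_def)
  also have "\<dots> = c ^ (2 * H + 1) * obs_prob nS \<theta>' \<tau>"
    by (simp add: obs_prob_def sum_distrib_left mult_ac)
  also have "\<dots> \<le> c ^ (3 * H) * obs_prob nS \<theta>' \<tau>"
    using c H by (intro mult_right_mono power_increasing) auto
  finally show ?thesis .
qed

text \<open>Domination in one direction bounds the distance because both models have mass 1: the
  positive and the negative part of the difference weigh the same, and the positive one at most
  \<open>E - 1\<close>. Formally, \<open>\<bar>y\<bar> \<le> 2 * z - y\<close> whenever
  \<open>y \<le> z\<close> and \<open>0 \<le> z\<close>, and the sum of \<open>y\<close>
  vanishes.\<close>

lemma dominates_l1_dist: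
  assumes \<theta>: "\<theta> \<in> params nS nA nO H" and \<theta>': "\<theta>' \<in> params nS nA nO H" and \<pi>: "\<pi> \<in> policies nA nO H"
    and E: "\<And>\<tau>. \<tau> \<in> trajectories nA nO H \<Longrightarrow> obs_prob nS \<theta> \<tau> \<le> E * obs_prob nS \<theta>' \<tau>" and E1: "1 \<le> E"
  shows "l1_dist nS nA nO \<theta> \<theta>' \<pi> H \<le> 2 * (E - 1)"
proof -
  have total: "(\<Sum>\<tau>\<in>trajectories nA nO H. pol_prob \<pi> [] \<tau> * obs_prob nS \<phi> \<tau>) = 1"
    if \<phi>: "\<phi> \<in> params nS nA nO H" for \<phi>
  proof -
    have "(\<Sum>\<tau>\<in>trajectories nA nO H. pmf (trajectory_pmf H \<phi> \<pi>) \<tau>) = 1"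
      using set_trajectory_pmf[OF \<phi> \<pi>] by (intro sum_pmf_eq_1) auto
    then show ?thesis using pmf_trajectory[OF \<phi>] by simp
  qed
  have "l1_dist nS nA nO \<theta> \<theta>' \<pi> H \<le> (\<Sum>\<tau>\<in>trajectories nA nO H. pol_prob \<pi> [] \<tau> *
     (2 * (E - 1) * obs_prob nS \<theta>' \<tau> - (obs_prob nS \<theta> \<tau> - obs_prob nS \<theta>' \<tau>)))"
    unfolding l1_dist_def
  proof (intro sum_mono mult_left_mono)
    fix \<tau> assume "\<tau> \<in> trajectories nA nO H"
    from E[OF this] have "obs_prob nS \<theta> \<tau> - obs_prob nS \<theta>' \<tau> \<le> (E - 1) * obs_prob nS \<theta>' \<tau>"
      by (simp add: algebra_simps)
    moreover have "0 \<le> (E - 1) * obs_prob nS \<theta>' \<tau>" using E1 by simp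
    ultimately show "\<bar>obs_prob nS \<theta> \<tau> - obs_prob nS \<theta>' \<tau>\<bar> \<le>
      2 * (E - 1) * obs_prob nS \<theta>' \<tau> - (obs_prob nS \<theta> \<tau> - obs_prob nS \<theta>' \<tau>)"
      unfolding mult.assoc by linarith
  qed simp
  also have "\<dots> = 2 * (E - 1) * (\<Sum>\<tau>\<in>trajectories nA nO H. pol_prob \<pi> [] \<tau> * obs_prob nS \<theta>' \<tau>) -
     ((\<Sum>\<tau>\<in>trajectories nA nO H. pol_prob \<pi> [] \<tau> * obs_prob nS \<theta> \<tau>) -
      (\<Sum>\<tau>\<in>trajectories nA nO H. pol_prob \<pi> [] \<tau> * obs_prob nS \<theta>' \<tau>))"
    by (simp add: sum_subtractf sum_distrib_left right_diff_distrib left_diff_distrib mult_ac)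
  finally show ?thesis using total[OF \<theta>] total[OF \<theta>'] by simp
qed

section \<open>Concentration of the likelihood\<close>

abbreviation datasets :: "nat \<Rightarrow> nat \<Rightarrow> nat \<Rightarrow> dataset set" where
  "datasets nA nO H \<equiv> lists (policies nA nO H \<times> trajectories nA nO H)"

definition affinity :: "nat \<Rightarrow> nat \<Rightarrow> nat \<Rightarrow> param \<Rightarrow> param \<Rightarrow> policy \<Rightarrow> real" where
  "affinity nA nO H \<theta>' \<theta> \<pi> = (\<Sum>\<tau>\<in>trajectories nA nO H.
     sqrt (pmf (trajectory_pmf H \<theta>' \<pi>) \<tau> * pmf (trajectory_pmf H \<theta> \<pi>) \<tau>))"

text \<open>With the value 0 outside the policy class the expectation is at most 1 for every
  function \<open>\<pi>\<close>, so integrals over runs need not track which policies the planner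
  returns.\<close>

definition root_ratio :: "nat \<Rightarrow> nat \<Rightarrow> nat \<Rightarrow> param \<Rightarrow> param \<Rightarrow> policy \<times> history \<Rightarrow> real" where
  "root_ratio nA nO H \<theta>' \<theta> = (\<lambda>(\<pi>, \<tau>). if \<pi> \<in> policies nA nO H
     then sqrt (pmf (trajectory_pmf H \<theta>' \<pi>) \<tau> / pmf (trajectory_pmf H \<theta> \<pi>) \<tau>) *
       exp (1 - affinity nA nO H \<theta>' \<theta> \<pi>)
     else 0)"

lemma root_ratio_nonneg: "0 \<le> root_ratio nA nO H \<theta>' \<theta> p"
  by (auto simp: root_ratio_def split: prod.splits)

text \<open>The exponential factor compensates the Hellinger affinity because \<open>\<rho> * exp (1 - \<rho>) \<le> 1\<close>.\<close>

lemma nn_integral_root_ratio: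
  assumes \<theta>: "\<theta> \<in> params nS nA nO H"
  shows "(\<integral>\<^sup>+ \<tau>. ennreal (root_ratio nA nO H \<theta>' \<theta> (\<pi>, \<tau>)) \<partial>measure_pmf (trajectory_pmf H \<theta> \<pi>)) \<le> 1"
proof (cases "\<pi> \<in> policies nA nO H")
  case False
  then show ?thesis by (simp add: root_ratio_def)
next
  case \<pi>: True
  let ?P = "pmf (trajectory_pmf H \<theta> \<pi>)" and ?Q = "pmf (trajectory_pmf H \<theta>' \<pi>)"
    and ?\<rho> = "affinity nA nO H \<theta>' \<theta> \<pi>"
  have "(\<integral>\<^sup>+ \<tau>. ennreal (root_ratio nA nO H \<theta>' \<theta> (\<pi>, \<tau>)) \<partial>measure_pmf (trajectory_pmf H \<theta> \<pi>)) =
    (\<Sum>\<tau>\<in>trajectories nA nO H. ennreal (root_ratio nA nO H \<theta>' \<theta> (\<pi>, \<tau>)) * ennreal (?P \<tau>))"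
    using set_trajectory_pmf[OF \<theta> \<pi>]
    by (intro nn_integral_measure_pmf_support) auto
  also have "\<dots> = ennreal (\<Sum>\<tau>\<in>trajectories nA nO H. root_ratio nA nO H \<theta>' \<theta> (\<pi>, \<tau>) * ?P \<tau>)"
    by (subst sum_ennreal[symmetric]) (auto simp: ennreal_mult root_ratio_nonneg)
  also have "(\<Sum>\<tau>\<in>trajectories nA nO H. root_ratio nA nO H \<theta>' \<theta> (\<pi>, \<tau>) * ?P \<tau>) =
    (\<Sum>\<tau>\<in>trajectories nA nO H. sqrt (?Q \<tau> * ?P \<tau>)) * exp (1 - ?\<rho>)"
    unfolding sum_distrib_right
  proof (intro sum.cong refl)
    fix \<tau>
    have "sqrt (?Q \<tau> / ?P \<tau>) * ?P \<tau> = sqrt (?Q \<tau> * ?P \<tau>)"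
      by (cases "?P \<tau> = 0") (simp_all add: real_sqrt_divide real_sqrt_mult field_simps)
    then show "root_ratio nA nO H \<theta>' \<theta> (\<pi>, \<tau>) * ?P \<tau> = sqrt (?Q \<tau> * ?P \<tau>) * exp (1 - ?\<rho>)"
      using \<pi> by (simp add: root_ratio_def mult_ac)
  qed
  also have "(\<Sum>\<tau>\<in>trajectories nA nO H. sqrt (?Q \<tau> * ?P \<tau>)) = ?\<rho>" by (simp add: affinity_def)
  finally have eq: "(\<integral>\<^sup>+ \<tau>. ennreal (root_ratio nA nO H \<theta>' \<theta> (\<pi>, \<tau>)) \<partial>measure_pmf (trajectory_pmf H \<theta> \<pi>)) =
    ennreal (?\<rho> * exp (1 - ?\<rho>))" .
  \<comment> \<open>True for every real affinity, so \<open>\<theta>'\<close> may be any member of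
    the cover, in \<open>params\<close> or not.\<close>
  have "?\<rho> * exp (1 - ?\<rho>) \<le> 1"
  proof -
    have "?\<rho> \<le> exp (?\<rho> - 1)" using exp_ge_add_one_self[of "?\<rho> - 1"] by simp
    then have "?\<rho> * exp (1 - ?\<rho>) \<le> exp (?\<rho> - 1) * exp (1 - ?\<rho>)" by (intro mult_right_mono) auto
    then show ?thesis by (simp flip: exp_add)
  qed
  then show ?thesis unfolding eq by (simp only: ennreal_le_1)
qed

section \<open>The run of the algorithm as an adaptive process\<close>

lemma nn_integral_collect_data:
  fixes f :: "policy \<times> history \<Rightarrow> ennreal"
  assumes f: "\<And>\<pi>. (\<integral>\<^sup>+ \<tau>. f (\<pi>, \<tau>) \<partial>measure_pmf (trajectory_pmf H \<theta> \<pi>)) \<le> 1"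
  shows "(\<integral>\<^sup>+ D. prod_list (map f D) \<partial>measure_pmf (collect_data nA H \<theta> \<pi> hs)) \<le> 1"
proof (induction hs)
  case (Cons h hs)
  have "(\<integral>\<^sup>+ D. prod_list (map f D) \<partial>measure_pmf (collect_data nA H \<theta> \<pi> (h # hs))) =
    (\<integral>\<^sup>+ \<tau>. f (then_uniform nA \<pi> h, \<tau>) * (\<integral>\<^sup>+ D. prod_list (map f D) \<partial>measure_pmf (collect_data nA H \<theta> \<pi> hs))
      \<partial>measure_pmf (trajectory_pmf H \<theta> (then_uniform nA \<pi> h)))"
    by (simp add: nn_integral_cmult)
  also have "\<dots> \<le> (\<integral>\<^sup>+ \<tau>. f (then_uniform nA \<pi> h, \<tau>) * 1 \<partial>measure_pmf (trajectory_pmf H \<theta> (then_uniform nA \<pi> h)))"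
    using Cons by (intro nn_integral_mono mult_left_mono) auto
  also have "\<dots> \<le> 1" using f by simp
  finally show ?case .
qed simp

text \<open>A supermartingale argument in integrated form: given the past dataset the next policy is
  fixed, so the new factors have conditional expectation at most 1, however adaptively the policy
  was chosen.\<close>

lemma nn_integral_omle:
  fixes f :: "policy \<times> history \<Rightarrow> ennreal"
  assumes f: "\<And>\<pi>. (\<integral>\<^sup>+ \<tau>. f (\<pi>, \<tau>) \<partial>measure_pmf (trajectory_pmf H \<theta> \<pi>)) \<le> 1"
  shows "(\<integral>\<^sup>+ x. prod_list (map f (snd x)) \<partial>measure_pmf (omle nA H m select \<theta> k)) \<le> 1"
proof (induction k)
  case (Suc k)
  have "(\<integral>\<^sup>+ x. prod_list (map f (snd x)) \<partial>measure_pmf (omle nA H m select \<theta> (Suc k))) =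
    (\<integral>\<^sup>+ x. prod_list (map f (snd x)) *
       (\<integral>\<^sup>+ D'. prod_list (map f D') \<partial>measure_pmf (collect_data nA H \<theta> (snd (select (snd x))) [0..<H - m + 1]))
       \<partial>measure_pmf (omle nA H m select \<theta> k))"
    by (simp add: case_prod_unfold Let_def nn_integral_cmult)
  also have "\<dots> \<le> (\<integral>\<^sup>+ x. prod_list (map f (snd x)) * 1 \<partial>measure_pmf (omle nA H m select \<theta> k))"
    using nn_integral_collect_data[OF f] by (intro nn_integral_mono mult_left_mono) auto
  also have "\<dots> \<le> 1" using Suc by simp
  finally show ?case .
qed simp

lemma collect_data_support:
  "D \<in> set_pmf (collect_data nA H \<theta> \<pi> hs) \<Longrightarrow> length D = length hs \<and>
    (\<forall>i<length hs. \<exists>\<tau>\<in>set_pmf (trajectory_pmf H \<theta> (then_uniform nA \<pi> (hs ! i))).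
       D ! i = (then_uniform nA \<pi> (hs ! i), \<tau>))"
proof (induction hs arbitrary: D)
  case (Cons h hs)
  then obtain \<tau> D' where \<tau>: "\<tau> \<in> set_pmf (trajectory_pmf H \<theta> (then_uniform nA \<pi> h))"
    and D': "D' \<in> set_pmf (collect_data nA H \<theta> \<pi> hs)" and D: "D = (then_uniform nA \<pi> h, \<tau>) # D'"
    by auto
  from Cons.IH[OF D'] \<tau> show ?case unfolding D by (auto simp: nth_Cons split: nat.split)
qed simp

text \<open>All iterations are judged within one run of length \<open>K\<close>. Its prefix of
  \<open>k * L\<close> episodes is distributed as the dataset of a run of length \<open>k\<close>,
  to which the expectation bound applies.\<close>

lemma omle_prefix:
  assumes "k \<le> K" and L: "L = H - m + 1"
  shows "map_pmf (\<lambda>x. take (k * L) (snd x)) (omle nA H m select \<theta> K) =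
    map_pmf snd (omle nA H m select \<theta> k)"
  and "\<And>x. x \<in> set_pmf (omle nA H m select \<theta> K) \<Longrightarrow> length (fst x) = K \<and> length (snd x) = K * L"
proof -
  have len: "x \<in> set_pmf (omle nA H m select \<theta> K) \<Longrightarrow> length (fst x) = K \<and> length (snd x) = K * L" for x K
  proof (induction K arbitrary: x)
    case (Suc K)
    then obtain y D' where y: "y \<in> set_pmf (omle nA H m select \<theta> K)"
      and D': "D' \<in> set_pmf (collect_data nA H \<theta> (snd (select (snd y))) [0..<H - m + 1])"
      and x: "x = (fst y @ [snd (select (snd y))], snd y @ D')"
      by (auto simp: case_prod_unfold Let_def simp del: upt_Suc)
    show ?case using Suc.IH[OF y] collect_data_support[OF D'] by (simp add: x L)
  qed simp
  then show "\<And>x. x \<in> set_pmf (omle nA H m select \<theta> K) \<Longrightarrow> length (fst x) = K \<and> length (snd x) = K * L" .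
  show "map_pmf (\<lambda>x. take (k * L) (snd x)) (omle nA H m select \<theta> K) =
    map_pmf snd (omle nA H m select \<theta> k)"
    using \<open>k \<le> K\<close>
  proof (induction K)
    case (Suc K)
    show ?case
    proof (cases "k = Suc K")
      case True
      show ?thesis unfolding True
      proof (intro map_pmf_cong refl)
        fix x assume "x \<in> set_pmf (omle nA H m select \<theta> (Suc K))"
        then have "length (snd x) = Suc K * L" using len by blast
        then show "take (Suc K * L) (snd x) = snd x" by simp
      qed
    next
      case False
      then have k: "k \<le> K" using Suc.prems by simp
      have "map_pmf (\<lambda>x. take (k * L) (snd x)) (omle nA H m select \<theta> (Suc K)) =
        bind_pmf (omle nA H m select \<theta> K) (\<lambda>x. bind_pmf (collect_data nA H \<theta> (snd (select (snd x))) [0..<H - m + 1])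
          (\<lambda>D'. return_pmf (take (k * L) (snd x @ D'))))"
        by (simp add: case_prod_unfold Let_def map_bind_pmf del: upt_Suc)
      also have "\<dots> = bind_pmf (omle nA H m select \<theta> K) (\<lambda>x. bind_pmf (collect_data nA H \<theta> (snd (select (snd x))) [0..<H - m + 1])
          (\<lambda>D'. return_pmf (take (k * L) (snd x))))"
      proof (intro bind_pmf_cong refl)
        fix x D' assume "x \<in> set_pmf (omle nA H m select \<theta> K)"
        then have "k * L \<le> length (snd x)" using len[of x K] k by simp
        then show "return_pmf (take (k * L) (snd x @ D')) = return_pmf (take (k * L) (snd x))" by simp
      qed
      also have "\<dots> = map_pmf (\<lambda>x. take (k * L) (snd x)) (omle nA H m select \<theta> K)"
        by (simp add: map_pmf_def)
      also have "\<dots> = map_pmf snd (omle nA H m select \<theta> k)" by (rule Suc.IH[OF k])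
      finally show ?thesis .
    qed
  qed simp
qed

text \<open>The planner is a function of the dataset, so every executed policy can be recomputed
  from a prefix of the final dataset. Iterations count from 0 here: iteration \<open>k\<close>
  starts with the first \<open>k * L\<close> episodes.\<close>

lemma omle_support:
  assumes \<theta>: "\<theta> \<in> params nS nA nO H" and nA: "1 \<le> nA" and L: "L = H - m + 1"
    and sel: "\<And>D. D \<in> datasets nA nO H \<Longrightarrow> snd (select D) \<in> policies nA nO H"
  shows "x \<in> set_pmf (omle nA H m select \<theta> K) \<Longrightarrow>
    snd x \<in> datasets nA nO H \<and>
    (\<forall>k<K. fst x ! k = snd (select (take (k * L) (snd x))) \<and>
      (\<forall>h<L. \<exists>\<tau>\<in>set_pmf (trajectory_pmf H \<theta> (then_uniform nA (fst x ! k) h)).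
        snd x ! (k * L + h) = (then_uniform nA (fst x ! k) h, \<tau>)))"
proof (induction K arbitrary: x)
  case (Suc K)
  then obtain y D' where y: "y \<in> set_pmf (omle nA H m select \<theta> K)"
    and D': "D' \<in> set_pmf (collect_data nA H \<theta> (snd (select (snd y))) [0..<H - m + 1])"
    and x: "x = (fst y @ [snd (select (snd y))], snd y @ D')"
    by (auto simp: case_prod_unfold Let_def simp del: upt_Suc)
  define \<pi> where "\<pi> = snd (select (snd y))"
  note IH = Suc.IH[OF y]
  have len: "length (fst y) = K" "length (snd y) = K * L"
    using omle_prefix(2)[OF le_refl L y] by auto
  have \<pi>: "\<pi> \<in> policies nA nO H" unfolding \<pi>_def using IH by (intro sel) auto
  have lenD': "length D' = L" and D'nth: "\<And>i. i < L \<Longrightarrow> \<exists>\<tau>\<in>set_pmf (trajectory_pmf H \<theta> (then_uniform nA \<pi> i)).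
       D' ! i = (then_uniform nA \<pi> i, \<tau>)"
    using collect_data_support[OF D'] by (simp_all add: L \<pi>_def del: upt_Suc)
  have "D' \<in> datasets nA nO H"
  proof -
    have "p \<in> policies nA nO H \<times> trajectories nA nO H" if pD: "p \<in> set D'" for p
    proof -
      obtain i where i: "i < L" and pi: "D' ! i = p"
        using pD unfolding in_set_conv_nth lenD' by blast
      obtain \<tau> where \<tau>: "\<tau> \<in> set_pmf (trajectory_pmf H \<theta> (then_uniform nA \<pi> i))"
        and p: "p = (then_uniform nA \<pi> i, \<tau>)" using D'nth[OF i] unfolding pi by blast
      have "\<tau> \<in> trajectories nA nO H"
        using set_trajectory_pmf[OF \<theta> then_uniform_policies[OF \<pi> nA]] \<tau> by blast
      then show ?thesis unfolding p using then_uniform_policies[OF \<pi> nA] by blast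
    qed
    then show ?thesis by (auto simp: lists_eq_set)
  qed
  then have 1: "snd x \<in> datasets nA nO H"
    using IH by (auto simp: x)
  have 2: "fst x ! k = snd (select (take (k * L) (snd x))) \<and>
      (\<forall>h<L. \<exists>\<tau>\<in>set_pmf (trajectory_pmf H \<theta> (then_uniform nA (fst x ! k) h)).
        snd x ! (k * L + h) = (then_uniform nA (fst x ! k) h, \<tau>))" if k: "k < Suc K" for k
  proof (cases "k = K")
    case True
    have e: "fst x ! k = \<pi>" "take (k * L) (snd x) = snd y" "\<And>h. snd x ! (k * L + h) = D' ! h"
      using True len by (simp_all add: x \<pi>_def nth_append)
    show ?thesis unfolding e using D'nth by (simp add: \<pi>_def)
  next
    case False
    then have k: "k < K" using k by simp
    have le: "k * L + h < K * L" if "h < L" for h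
    proof -
      have "k * L + h < Suc k * L" using that by simp
      also have "\<dots> \<le> K * L" using k by (intro mult_right_mono) auto
      finally show ?thesis .
    qed
    have "k * L \<le> K * L" using k by (intro mult_right_mono) auto
    then have e: "fst x ! k = fst y ! k" "take (k * L) (snd x) = take (k * L) (snd y)"
      "\<And>h. h < L \<Longrightarrow> snd x ! (k * L + h) = snd y ! (k * L + h)"
      using k le by (simp_all add: x nth_append len)
    have a: "fst y ! k = snd (select (take (k * L) (snd y)))" and
      *: "\<forall>h<L. \<exists>\<tau>\<in>set_pmf (trajectory_pmf H \<theta> (then_uniform nA (fst y ! k) h)).
        snd y ! (k * L + h) = (then_uniform nA (fst y ! k) h, \<tau>)"
      using IH k by blast+
    show ?thesis unfolding e(1,2)
    proof (intro conjI allI impI a)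
      fix h assume h: "h < L"
      then show "\<exists>\<tau>\<in>set_pmf (trajectory_pmf H \<theta> (then_uniform nA (fst y ! k) h)).
          snd x ! (k * L + h) = (then_uniform nA (fst y ! k) h, \<tau>)"
        unfolding e(3)[OF h] using * by blast
    qed
  qed
  from 1 2 show ?case by blast
qed simp

text \<open>Markov's inequality at level \<open>card G * K / \<delta>\<close>, followed by a union
  bound over the \<open>K * card G\<close> pairs of iteration and cover element.\<close>

lemma root_ratio_event:
  assumes \<theta>: "\<theta> \<in> params nS nA nO H" and L: "L = H - m + 1"
    and G: "finite G" "G \<noteq> {}" and K: "1 \<le> K" and \<delta>: "0 < \<delta>"
  shows "measure_pmf.prob (omle nA H m select \<theta> K)
     {x. \<exists>k<K. \<exists>\<theta>'\<in>G. real (card G) * real K / \<delta> <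
        prod_list (map (root_ratio nA nO H \<theta>' \<theta>) (take (k * L) (snd x)))} \<le> \<delta>"
proof -
  let ?p = "omle nA H m select \<theta> K"
  define a where "a = real (card G) * real K / \<delta>"
  have cG: "0 < real (card G)" using G by (simp add: card_gt_0_iff)
  have a: "0 < a" using cG K \<delta> by (simp add: a_def)
  define R where "R \<theta>' D = prod_list (map (root_ratio nA nO H \<theta>' \<theta>) D)" for \<theta>' D
  have R0: "0 \<le> R \<theta>' D" for \<theta>' D unfolding R_def by (induction D) (auto simp: root_ratio_nonneg)
  define B where "B k \<theta>' = {x :: policy list \<times> dataset. a < R \<theta>' (take (k * L) (snd x))}" for k \<theta>'
  have eR: "ennreal (R \<theta>' D) = prod_list (map (\<lambda>p. ennreal (root_ratio nA nO H \<theta>' \<theta> p)) D)" for \<theta>' D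
    unfolding R_def
  proof (induction D)
    case (Cons p D)
    have "0 \<le> prod_list (map (root_ratio nA nO H \<theta>' \<theta>) D)" using R0 by (simp add: R_def)
    then show ?case using Cons by (simp add: ennreal_mult root_ratio_nonneg)
  qed simp
  have single: "measure_pmf.prob ?p (B k \<theta>') \<le> 1 / a" if k: "k < K" for k \<theta>'
  proof -
    have "(\<integral>\<^sup>+ x. ennreal (R \<theta>' (take (k * L) (snd x))) \<partial>measure_pmf ?p) =
      (\<integral>\<^sup>+ D. ennreal (R \<theta>' D) \<partial>measure_pmf (map_pmf (\<lambda>x. take (k * L) (snd x)) ?p))"
      by simp
    also have "\<dots> = (\<integral>\<^sup>+ x. ennreal (R \<theta>' (snd x)) \<partial>measure_pmf (omle nA H m select \<theta> k))"
      by (subst omle_prefix(1)[OF less_imp_le[OF k] L]) simp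
    also have "\<dots> \<le> 1"
      unfolding eR by (rule nn_integral_omle) (rule nn_integral_root_ratio[OF \<theta>])
    finally have int: "(\<integral>\<^sup>+ x. ennreal (R \<theta>' (take (k * L) (snd x))) \<partial>measure_pmf ?p) \<le> 1" .
    have "emeasure (measure_pmf ?p) (B k \<theta>') \<le> emeasure (measure_pmf ?p)
       {x \<in> space (measure_pmf ?p). 1 \<le> ennreal (1 / a) * ennreal (R \<theta>' (take (k * L) (snd x)))}"
    proof (intro emeasure_mono)
      show "B k \<theta>' \<subseteq> {x \<in> space (measure_pmf ?p). 1 \<le> ennreal (1 / a) * ennreal (R \<theta>' (take (k * L) (snd x)))}"
      proof
        fix x assume "x \<in> B k \<theta>'"
        then have "1 \<le> 1 / a * R \<theta>' (take (k * L) (snd x))" using a by (simp add: B_def field_simps)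
        then have "1 \<le> ennreal (1 / a * R \<theta>' (take (k * L) (snd x)))" by (simp add: ennreal_ge_1)
        then show "x \<in> {x \<in> space (measure_pmf ?p). 1 \<le> ennreal (1 / a) * ennreal (R \<theta>' (take (k * L) (snd x)))}"
          using a R0 by (subst (asm) ennreal_mult) auto
      qed
    qed simp
    also have "\<dots> \<le> ennreal (1 / a) * (\<integral>\<^sup>+ x. ennreal (R \<theta>' (take (k * L) (snd x))) * indicator (space (measure_pmf ?p)) x \<partial>measure_pmf ?p)"
      by (rule nn_integral_Markov_inequality) auto
    also have "\<dots> \<le> ennreal (1 / a) * 1"
      using int by (intro mult_left_mono) auto
    finally have "emeasure (measure_pmf ?p) (B k \<theta>') \<le> ennreal (1 / a)" by simp
    then show ?thesis using a by (simp add: measure_pmf.emeasure_eq_measure)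
  qed
  have "{x. \<exists>k<K. \<exists>\<theta>'\<in>G. a < R \<theta>' (take (k * L) (snd x))} = (\<Union>i\<in>{..<K} \<times> G. B (fst i) (snd i))"
    by (auto simp: B_def) blast
  then have "measure_pmf.prob ?p {x. \<exists>k<K. \<exists>\<theta>'\<in>G. a < R \<theta>' (take (k * L) (snd x))} \<le>
      (\<Sum>i\<in>{..<K} \<times> G. measure_pmf.prob ?p (B (fst i) (snd i)))"
    using G by (simp only:) (intro measure_pmf.finite_measure_subadditive_finite, auto)
  also have "\<dots> \<le> (\<Sum>i\<in>{..<K} \<times> G. 1 / a)"
    using single by (intro sum_mono) auto
  also have "\<dots> = \<delta>" using G K \<delta> cG by (simp add: a_def card_cartesian_product field_simps)
  finally show ?thesis by (simp add: a_def R_def)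
qed

section \<open>From likelihood ratios to confidence sets\<close>

lemma log_prob_mult: "0 \<le> p \<Longrightarrow> 0 \<le> q \<Longrightarrow> log_prob (p * q) = log_prob p + log_prob q"
  by (auto simp: log_prob_def ln_mult)

lemma log_likelihood_eq:
  "log_likelihood H D \<theta> = log_prob (prod_list (map (\<lambda>(\<pi>, \<tau>). pmf (trajectory_pmf H \<theta> \<pi>) \<tau>) D))"
proof (induction D)
  case (Cons p D)
  have "0 \<le> prod_list (map (\<lambda>(\<pi>, \<tau>). pmf (trajectory_pmf H \<theta> \<pi>) \<tau>) D)"
    by (induction D) auto
  then show ?case using Cons by (auto simp: log_likelihood_def log_prob_mult split: prod.splits)
qed (simp add: log_likelihood_def log_prob_def)

lemma log_prob_le_iff:
  assumes "0 \<le> p" "0 < q"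
  shows "log_prob p \<le> log_prob q + ereal b \<longleftrightarrow> p \<le> exp b * q"
proof (cases "p = 0")
  case True
  then show ?thesis using assms by (simp add: log_prob_def)
next
  case False
  then have "p \<le> exp b * q \<longleftrightarrow> ln p \<le> ln (exp b * q)" using assms by (subst ln_le_cancel_iff) auto
  also have "ln (exp b * q) = b + ln q" using assms by (simp add: ln_mult)
  finally show ?thesis using False assms by (simp add: log_prob_def add.commute)
qed

definition likelihood :: "nat \<Rightarrow> param \<Rightarrow> dataset \<Rightarrow> real" where
  "likelihood H \<theta> D = prod_list (map (\<lambda>(\<pi>, \<tau>). pmf (trajectory_pmf H \<theta> \<pi>) \<tau>) D)"

lemma likelihood_nonneg: "0 \<le> likelihood H \<theta> D"
  unfolding likelihood_def by (induction D) auto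

lemma sum_trajectory_pmf:
  assumes "\<theta> \<in> params nS nA nO H" "\<pi> \<in> policies nA nO H"
  shows "(\<Sum>\<tau>\<in>trajectories nA nO H. pmf (trajectory_pmf H \<theta> \<pi>) \<tau>) = 1"
  using set_trajectory_pmf[OF assms] by (intro sum_pmf_eq_1) auto

lemma affinity_le_1:
  assumes \<theta>': "\<theta>' \<in> params nS nA nO H" and \<theta>: "\<theta> \<in> params nS nA nO H" and \<pi>: "\<pi> \<in> policies nA nO H"
  shows "affinity nA nO H \<theta>' \<theta> \<pi> \<le> 1"
proof -
  have "affinity nA nO H \<theta>' \<theta> \<pi> \<le>
    (\<Sum>\<tau>\<in>trajectories nA nO H. (pmf (trajectory_pmf H \<theta>' \<pi>) \<tau> + pmf (trajectory_pmf H \<theta> \<pi>) \<tau>) / 2)"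
    unfolding affinity_def by (intro sum_mono arith_geo_mean_sqrt) auto
  also have "\<dots> = 1"
    using sum_trajectory_pmf[OF \<theta>' \<pi>] sum_trajectory_pmf[OF \<theta> \<pi>]
    by (simp add: sum_divide_distrib[symmetric] sum.distrib)
  finally show ?thesis .
qed

text \<open>Write a difference of probabilities as difference times sum of their roots and apply
  Cauchy-Schwarz: with \<rho> the affinity, the two sums of squares are
  \<open>2 - 2 * \<rho>\<close> and \<open>2 + 2 * \<rho> \<le> 4\<close>.\<close>

lemma l1_dist_affinity:
  assumes \<theta>': "\<theta>' \<in> params nS nA nO H" and \<theta>: "\<theta> \<in> params nS nA nO H" and \<pi>: "\<pi> \<in> policies nA nO H"
  shows "(l1_dist nS nA nO \<theta>' \<theta> \<pi> H)\<^sup>2 \<le> 8 * (1 - affinity nA nO H \<theta>' \<theta> \<pi>)"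
proof -
  let ?T = "trajectories nA nO H"
  let ?p = "\<lambda>\<tau>. sqrt (pmf (trajectory_pmf H \<theta>' \<pi>) \<tau>)" and ?q = "\<lambda>\<tau>. sqrt (pmf (trajectory_pmf H \<theta> \<pi>) \<tau>)"
  let ?\<rho> = "affinity nA nO H \<theta>' \<theta> \<pi>"
  have sp: "(\<Sum>\<tau>\<in>?T. (?p \<tau>)\<^sup>2) = 1" and sq: "(\<Sum>\<tau>\<in>?T. (?q \<tau>)\<^sup>2) = 1"
    using sum_trajectory_pmf[OF \<theta>' \<pi>] sum_trajectory_pmf[OF \<theta> \<pi>] by simp_all
  have spq: "(\<Sum>\<tau>\<in>?T. ?p \<tau> * ?q \<tau>) = ?\<rho>" by (simp add: affinity_def real_sqrt_mult)
  have "l1_dist nS nA nO \<theta>' \<theta> \<pi> H = (\<Sum>\<tau>\<in>?T. \<bar>?p \<tau> - ?q \<tau>\<bar> * (?p \<tau> + ?q \<tau>))"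
    unfolding l1_dist_def
  proof (intro sum.cong refl)
    fix \<tau> assume \<tau>: "\<tau> \<in> ?T"
    have "pol_prob \<pi> [] \<tau> * \<bar>obs_prob nS \<theta>' \<tau> - obs_prob nS \<theta> \<tau>\<bar> =
      \<bar>pol_prob \<pi> [] \<tau> * obs_prob nS \<theta>' \<tau> - pol_prob \<pi> [] \<tau> * obs_prob nS \<theta> \<tau>\<bar>"
      by (simp add: abs_mult flip: right_diff_distrib)
    also have "\<dots> = \<bar>(?p \<tau>)\<^sup>2 - (?q \<tau>)\<^sup>2\<bar>"
      using pmf_trajectory[OF \<theta>' \<tau>] pmf_trajectory[OF \<theta> \<tau>] by simp
    also have "(?p \<tau>)\<^sup>2 - (?q \<tau>)\<^sup>2 = (?p \<tau> - ?q \<tau>) * (?p \<tau> + ?q \<tau>)"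
      by (simp add: power2_eq_square algebra_simps)
    also have "\<bar>\<dots>\<bar> = \<bar>?p \<tau> - ?q \<tau>\<bar> * (?p \<tau> + ?q \<tau>)"
      by (simp add: abs_mult)
    finally show "pol_prob \<pi> [] \<tau> * \<bar>obs_prob nS \<theta>' \<tau> - obs_prob nS \<theta> \<tau>\<bar> = \<bar>?p \<tau> - ?q \<tau>\<bar> * (?p \<tau> + ?q \<tau>)" .
  qed
  then have "(l1_dist nS nA nO \<theta>' \<theta> \<pi> H)\<^sup>2 \<le> (\<Sum>\<tau>\<in>?T. \<bar>?p \<tau> - ?q \<tau>\<bar>\<^sup>2) * (\<Sum>\<tau>\<in>?T. (?p \<tau> + ?q \<tau>)\<^sup>2)"
    by (simp only: Cauchy_Schwarz_ineq_sum)
  also have "(\<Sum>\<tau>\<in>?T. \<bar>?p \<tau> - ?q \<tau>\<bar>\<^sup>2) = (\<Sum>\<tau>\<in>?T. (?p \<tau>)\<^sup>2) + (\<Sum>\<tau>\<in>?T. (?q \<tau>)\<^sup>2) - 2 * (\<Sum>\<tau>\<in>?T. ?p \<tau> * ?q \<tau>)"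
    unfolding power2_abs power2_diff
    by (simp add: sum.distrib sum_subtractf sum_distrib_left mult.assoc del: real_sqrt_pow2 real_sqrt_power)
  also have "(\<Sum>\<tau>\<in>?T. (?p \<tau> + ?q \<tau>)\<^sup>2) = (\<Sum>\<tau>\<in>?T. (?p \<tau>)\<^sup>2) + (\<Sum>\<tau>\<in>?T. (?q \<tau>)\<^sup>2) + 2 * (\<Sum>\<tau>\<in>?T. ?p \<tau> * ?q \<tau>)"
    unfolding power2_sum
    by (simp add: sum.distrib sum_distrib_left mult.assoc del: real_sqrt_pow2 real_sqrt_power)
  finally have "(l1_dist nS nA nO \<theta>' \<theta> \<pi> H)\<^sup>2 \<le> (2 - 2 * ?\<rho>) * (2 + 2 * ?\<rho>)"
    unfolding sp sq spq by simp
  also have "\<dots> \<le> (2 - 2 * ?\<rho>) * 4"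
    using affinity_le_1[OF \<theta>' \<theta> \<pi>] by (intro mult_left_mono) auto
  finally show ?thesis by simp
qed

lemma prod_root_ratio:
  assumes "D \<in> datasets nA nO H"
  shows "prod_list (map (root_ratio nA nO H \<theta>' \<theta>) D) =
    sqrt (likelihood H \<theta>' D / likelihood H \<theta> D) * exp (\<Sum>p\<leftarrow>D. 1 - affinity nA nO H \<theta>' \<theta> (fst p))"
  using assms
proof (induction D rule: list.induct)
  case (Cons p D)
  obtain \<pi> \<tau> where p: "p = (\<pi>, \<tau>)" by (cases p)
  have "\<pi> \<in> policies nA nO H" using Cons.prems by (simp add: p)
  then show ?case using Cons
    by (simp add: p root_ratio_def likelihood_def real_sqrt_mult real_sqrt_divide exp_add mult_ac)
qed (simp add: likelihood_def)

lemma likelihood_dominated: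
  assumes \<phi>: "\<phi> \<in> params nS nA nO H" and \<phi>': "\<phi>' \<in> params nS nA nO H"
    and E: "\<And>\<tau>. \<tau> \<in> trajectories nA nO H \<Longrightarrow> obs_prob nS \<phi> \<tau> \<le> E * obs_prob nS \<phi>' \<tau>" and E1: "1 \<le> E"
    and D: "D \<in> datasets nA nO H"
  shows "likelihood H \<phi> D \<le> E ^ length D * likelihood H \<phi>' D"
  using D
proof (induction D rule: list.induct)
  case (Cons p D)
  obtain \<pi> \<tau> where p: "p = (\<pi>, \<tau>)" by (cases p)
  have \<tau>: "\<tau> \<in> trajectories nA nO H" using Cons.prems by (simp add: p)
  have "pmf (trajectory_pmf H \<phi> \<pi>) \<tau> \<le> E * pmf (trajectory_pmf H \<phi>' \<pi>) \<tau>"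
    using mult_left_mono[OF E[OF \<tau>], of "pol_prob \<pi> [] \<tau>"]
    unfolding pmf_trajectory[OF \<phi> \<tau>] pmf_trajectory[OF \<phi>' \<tau>] by (simp add: mult_ac)
  then have "pmf (trajectory_pmf H \<phi> \<pi>) \<tau> * likelihood H \<phi> D \<le>
    (E * pmf (trajectory_pmf H \<phi>' \<pi>) \<tau>) * (E ^ length D * likelihood H \<phi>' D)"
    using Cons E1 by (intro mult_mono) (auto simp: likelihood_nonneg)
  then show ?case by (simp add: p likelihood_def mult_ac)
qed (simp add: likelihood_def)

lemma l1_dist_triangle:
  "l1_dist nS nA nO \<theta>1 \<theta>3 \<pi> n \<le> l1_dist nS nA nO \<theta>1 \<theta>2 \<pi> n + l1_dist nS nA nO \<theta>2 \<theta>3 \<pi> n"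
  unfolding l1_dist_def sum.distrib[symmetric] distrib_left[symmetric]
  by (intro sum_mono mult_left_mono) auto

text \<open>One event, two conclusions. Dropping the factor \<open>exp S\<close>, which is at least
  1, bounds the likelihood of every model. If instead the likelihood of \<phi> is not much below
  that of \<theta>, the ratio is bounded from below and the event bounds the sum \<open>S\<close> of
  the affinity deficits. The summand 1 in the lower bound on \<open>\<beta>\<close> pays for
  replacing \<phi> by its dominating cover element.\<close>

lemma likelihood_event:
  assumes \<theta>: "\<theta> \<in> params nS nA nO H"
    and D: "D \<in> datasets nA nO H"
    and pos: "0 < likelihood H \<theta> D"
    and cov: "\<And>\<phi>. \<phi> \<in> params nS nA nO H \<Longrightarrow> \<exists>\<phi>'\<in>G \<inter> params nS nA nO H.
        \<forall>\<tau>\<in>trajectories nA nO H. obs_prob nS \<phi> \<tau> \<le> E * obs_prob nS \<phi>' \<tau>"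
    and E1: "1 \<le> E" and En: "E ^ length D \<le> exp 1"
    and ev: "\<And>\<theta>'. \<theta>' \<in> G \<Longrightarrow> prod_list (map (root_ratio nA nO H \<theta>' \<theta>) D) \<le> a" and a: "1 \<le> a"
    and \<beta>: "1 + 2 * ln a \<le> \<beta>" and \<phi>: "\<phi> \<in> params nS nA nO H"
  shows "log_likelihood H D \<phi> \<le> log_likelihood H D \<theta> + ereal \<beta>"
    and "log_likelihood H D \<theta> - ereal \<beta> \<le> log_likelihood H D \<phi> \<Longrightarrow>
      (\<Sum>p\<leftarrow>D. (l1_dist nS nA nO \<phi> \<theta> (fst p) H)\<^sup>2) \<le> 16 * \<beta> + 8 * real (length D) * (E - 1)\<^sup>2"
proof -
  obtain \<phi>' where \<phi>'G: "\<phi>' \<in> G" and \<phi>': "\<phi>' \<in> params nS nA nO H"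
    and dom: "\<And>\<tau>. \<tau> \<in> trajectories nA nO H \<Longrightarrow> obs_prob nS \<phi> \<tau> \<le> E * obs_prob nS \<phi>' \<tau>"
    using cov[OF \<phi>] by auto
  define S where "S = (\<Sum>p\<leftarrow>D. 1 - affinity nA nO H \<phi>' \<theta> (fst p))"
  have S0: "0 \<le> S" unfolding S_def
    using D by (intro sum_list_nonneg) (auto simp: affinity_le_1[OF \<phi>' \<theta>])
  have bound: "sqrt (likelihood H \<phi>' D / likelihood H \<theta> D) * exp S \<le> a"
    using ev[OF \<phi>'G] unfolding prod_root_ratio[OF D] S_def .
  have lik: "likelihood H \<phi> D \<le> exp 1 * likelihood H \<phi>' D"
    using likelihood_dominated[OF \<phi> \<phi>' dom E1 D] mult_right_mono[OF En likelihood_nonneg[of H \<phi>' D]] by linarith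
  have ll: "log_likelihood H D \<psi> = log_prob (likelihood H \<psi> D)" for \<psi>
    by (simp add: log_likelihood_eq likelihood_def)
  show "log_likelihood H D \<phi> \<le> log_likelihood H D \<theta> + ereal \<beta>"
  proof -
    have "sqrt (likelihood H \<phi>' D / likelihood H \<theta> D) * 1 \<le> sqrt (likelihood H \<phi>' D / likelihood H \<theta> D) * exp S"
      using S0 likelihood_nonneg[of H \<phi>' D] pos by (intro mult_left_mono) auto
    then have "sqrt (likelihood H \<phi>' D / likelihood H \<theta> D) \<le> a" using bound by linarith
    then have "likelihood H \<phi>' D / likelihood H \<theta> D \<le> a\<^sup>2" by (rule sqrt_le_D)
    then have "likelihood H \<phi>' D \<le> a\<^sup>2 * likelihood H \<theta> D" using pos by (simp add: field_simps)
    then have "exp 1 * likelihood H \<phi>' D \<le> exp 1 * (a\<^sup>2 * likelihood H \<theta> D)" by simp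
    then have "likelihood H \<phi> D \<le> exp 1 * (a\<^sup>2 * likelihood H \<theta> D)" using lik by linarith
    also have "a\<^sup>2 = exp (2 * ln a)" using a by (simp add: exp_double)
    also have "exp 1 * (exp (2 * ln a) * likelihood H \<theta> D) = exp (1 + 2 * ln a) * likelihood H \<theta> D"
      by (simp add: exp_add)
    also have "\<dots> \<le> exp \<beta> * likelihood H \<theta> D" using \<beta> pos by simp
    finally show ?thesis
      unfolding ll using log_prob_le_iff[OF likelihood_nonneg pos] by blast
  qed
  define b where "b = 1 + \<beta>"
  assume ge: "log_likelihood H D \<theta> - ereal \<beta> \<le> log_likelihood H D \<phi>"
  have \<phi>pos: "0 < likelihood H \<phi> D"
  proof (rule ccontr)
    assume "\<not> ?thesis"
    then have "likelihood H \<phi> D = 0" using likelihood_nonneg[of H \<phi> D] by simp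
    then show False using ge pos by (simp add: ll log_prob_def)
  qed
  then have "log_prob (likelihood H \<theta> D) \<le> log_prob (likelihood H \<phi> D) + ereal \<beta>"
    using ge pos by (simp add: ll log_prob_def)
  then have "likelihood H \<theta> D \<le> exp \<beta> * likelihood H \<phi> D"
    using log_prob_le_iff[OF likelihood_nonneg \<phi>pos] by blast
  also have "\<dots> \<le> exp \<beta> * (exp 1 * likelihood H \<phi>' D)" using lik by simp
  also have "exp \<beta> * (exp 1 * likelihood H \<phi>' D) = exp b * likelihood H \<phi>' D"
    by (simp add: b_def exp_add)
  finally have "exp (- b) \<le> likelihood H \<phi>' D / likelihood H \<theta> D"
    using pos by (simp add: exp_minus field_simps)
  then have "sqrt (exp (- b)) * exp S \<le> a"
    using bound by (smt (verit) exp_gt_zero mult_right_mono real_sqrt_le_mono)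
  moreover have "sqrt (exp (- b)) = exp (- b / 2)"
    by (rule real_sqrt_unique) (simp_all add: power2_eq_square flip: exp_add)
  ultimately have m: "exp (- b / 2) * exp S \<le> a" by simp
  have "exp (- b / 2 + S) = exp (- b / 2) * exp S" by (rule exp_add)
  also have "\<dots> \<le> exp (ln a)" using m a by simp
  finally have "- b / 2 + S \<le> ln a" by (simp only: exp_le_cancel_iff)
  \<comment> \<open>As \<open>b = 1 + \<beta>\<close> and \<open>1 + 2 * ln a \<le> \<beta>\<close>,
    the right-hand side is at most \<open>2 * \<beta>\<close>.\<close>
  then have "2 * S \<le> 2 * ln a + b" by simp
  then have S\<beta>: "S \<le> \<beta>" using \<beta> unfolding b_def by simp
  \<comment> \<open>Triangle inequality through the cover element and
    \<open>(u + v)\<^sup>2 \<le> 2 * u\<^sup>2 + 2 * v\<^sup>2\<close>: 16 is twice the 8 of the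
    affinity bound, and 8 is twice the 4 from squaring \<open>2 * (E - 1)\<close>.\<close>
  have each: "(l1_dist nS nA nO \<phi> \<theta> (fst p) H)\<^sup>2 \<le> 16 * (1 - affinity nA nO H \<phi>' \<theta> (fst p)) + 8 * (E - 1)\<^sup>2"
    if "p \<in> set D" for p
  proof -
    have \<pi>: "fst p \<in> policies nA nO H" using that D by auto
    let ?u = "l1_dist nS nA nO \<phi> \<phi>' (fst p) H" and ?v = "l1_dist nS nA nO \<phi>' \<theta> (fst p) H"
    have u: "?u \<le> 2 * (E - 1)" by (rule dominates_l1_dist[OF \<phi> \<phi>' \<pi> dom E1])
    have "?u\<^sup>2 \<le> (2 * (E - 1))\<^sup>2" by (rule power_mono[OF u l1_dist_nonneg])
    moreover have "?v\<^sup>2 \<le> 8 * (1 - affinity nA nO H \<phi>' \<theta> (fst p))" by (rule l1_dist_affinity[OF \<phi>' \<theta> \<pi>])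
    moreover have "(l1_dist nS nA nO \<phi> \<theta> (fst p) H)\<^sup>2 \<le> (?u + ?v)\<^sup>2"
      by (rule power_mono[OF l1_dist_triangle l1_dist_nonneg])
    moreover have "(?u + ?v)\<^sup>2 \<le> 2 * ?u\<^sup>2 + 2 * ?v\<^sup>2"
      using sum_squares_bound[of ?u ?v] by (simp add: power2_sum)
    moreover have "(2 * (E - 1))\<^sup>2 = 4 * (E - 1)\<^sup>2" by (simp only: power_mult_distrib) simp
    ultimately show ?thesis by linarith
  qed
  have "(\<Sum>p\<leftarrow>D. (l1_dist nS nA nO \<phi> \<theta> (fst p) H)\<^sup>2) \<le>
    (\<Sum>p\<leftarrow>D. 16 * (1 - affinity nA nO H \<phi>' \<theta> (fst p)) + 8 * (E - 1)\<^sup>2)"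
    using each by (intro sum_list_mono) auto
  also have "\<dots> = 16 * S + real (length D) * (8 * (E - 1)\<^sup>2)"
    unfolding S_def sum_list_addf by (simp only: sum_list_const_mult sum_list_triv)
  finally show "(\<Sum>p\<leftarrow>D. (l1_dist nS nA nO \<phi> \<theta> (fst p) H)\<^sup>2) \<le> 16 * \<beta> + 8 * real (length D) * (E - 1)\<^sup>2"
    using S\<beta> by (simp add: mult_ac)
qed

section \<open>The eluder argument\<close>

lemma dot_self_le_l1: "sqrt (dot d g g) \<le> l1 d g"
proof -
  have "dot d g g \<le> (l1 d g)\<^sup>2"
  proof -
    have "\<bar>g s\<bar> * \<bar>g s\<bar> \<le> \<bar>g s\<bar> * l1 d g" if "s < d" for s
      using that by (intro mult_left_mono member_le_sum[where f = "\<lambda>s. \<bar>g s\<bar>"]) auto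
    then have "(\<Sum>s<d. \<bar>g s\<bar> * \<bar>g s\<bar>) \<le> (\<Sum>s<d. \<bar>g s\<bar> * l1 d g)"
      by (intro sum_mono) auto
    then show ?thesis by (simp add: dot_def power2_eq_square sum_distrib_right)
  qed
  then have "sqrt (dot d g g) \<le> \<bar>\<Sum>s<d. \<bar>g s\<bar>\<bar>" by (metis real_sqrt_abs real_sqrt_le_mono)
  also have "\<dots> = l1 d g" by (simp add: sum_nonneg)
  finally show ?thesis .
qed

lemma sum_blocks:
  fixes f :: "nat \<Rightarrow> real"
  shows "(\<Sum>m<t * n. f m) = (\<Sum>j<t. \<Sum>i<n. f (j * n + i))"
proof -
  have "(\<Sum>m<t * n. f m) = (\<Sum>j<t. sum f {j * n..<j * n + n})" by (rule sum.nat_group[symmetric])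
  also have "\<dots> = (\<Sum>j<t. \<Sum>i<n. f (j * n + i))"
  proof (rule sum.cong[OF refl])
    fix j show "sum f {j * n..<j * n + n} = (\<Sum>i<n. f (j * n + i))"
      using sum.shift_bounds_nat_ivl[of f 0 "j * n" n] by (simp add: lessThan_atLeast0 add.commute)
  qed
  finally show ?thesis .
qed

abbreviation potential :: "nat \<Rightarrow> nat \<Rightarrow> real" where
  "potential d k \<equiv> 2 * (real d ^ 2 + 2 * real d * ln (1 + real k))"

text \<open>All vectors of all iterations are flattened into one sequence, vector \<open>i\<close>
  of iteration \<open>t\<close> at position \<open>t * n + i\<close>. When it is treated, earlier
  vectors of its own block count as past too; they contribute at most
  \<open>\<Psi> t t \<le> R\<close>, and with the Euclidean norms this makes \<open>2 * R\<close>.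
  Cauchy-Schwarz turns the bound on past squares into \<open>sqrt (k * C)\<close>. The mass per
  block is at most 1, so the potential depends on \<open>k\<close> but not on
  \<open>n\<close>.\<close>

lemma l1_eluder_indexed:
  fixes x :: "nat \<Rightarrow> nat \<Rightarrow> nat \<Rightarrow> real" and g :: "nat \<Rightarrow> 'l \<Rightarrow> nat \<Rightarrow> real" and L :: "'l set" and n d k :: nat
  defines "\<Psi> \<equiv> \<lambda>t j. \<Sum>l\<in>L. \<Sum>i<n. \<bar>dot d (g t l) (x j i)\<bar>"
  assumes x: "\<And>t. t < k \<Longrightarrow> (\<Sum>i<n. sqrt (dot d (x t i) (x t i))) \<le> 1"
    and g: "\<And>t. t < k \<Longrightarrow> (\<Sum>l\<in>L. sqrt (dot d (g t l) (g t l))) \<le> R"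
    and C: "\<And>t. t < k \<Longrightarrow> (\<Sum>j<t. (\<Psi> t j)\<^sup>2) \<le> C"
    and R0: "0 \<le> R" and C0: "0 \<le> C"
  shows "(\<Sum>t<k. \<Psi> t t) \<le> (2 * R + sqrt (real k * C)) * potential d k"
proof -
  \<comment> \<open>Zero beyond the range, because \<open>l1_elliptic\<close> asks for the norm
    bound at every index.\<close>
  define X where "X m = (if m < k * n then x (m div n) (m mod n) else (\<lambda>_. 0))" for m
  have X_eq: "X (t * n + i) = x t i" if "t < k" "i < n" for t i
  proof -
    have "t * n + i < Suc t * n" using that by simp
    also have "\<dots> \<le> k * n" using that by (intro mult_right_mono) auto
    finally show ?thesis using that by (simp add: X_def)
  qed
  have X1: "dot d (X m) (X m) \<le> 1" for m
  proof (cases "m < k * n")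
    case True
    then have n: "0 < n" by (cases n) auto
    have "m div n < k" using True by (simp add: less_mult_imp_div_less)
    then have "sqrt (dot d (x (m div n) (m mod n)) (x (m div n) (m mod n))) \<le> 1"
      using x[of "m div n"] n by (intro order_trans[OF member_le_sum[where f = "\<lambda>i. sqrt (dot d (x (m div n) i) (x (m div n) i))"] x])
        (auto simp: dot_nonneg)
    then show ?thesis using True by (simp add: X_def)
  qed (simp add: X_def dot_def)
  obtain q where q0: "\<And>m. m < k * n \<Longrightarrow> 0 \<le> q m"
    and q: "\<And>m g. m < k * n \<Longrightarrow> \<bar>dot d g (X m)\<bar> \<le> (sqrt (dot d g g) + (\<Sum>j<m. \<bar>dot d g (X j)\<bar>)) * q m"
    and qs: "(\<Sum>m<k * n. q m) \<le> 2 * (real d ^ 2 + 2 * real d * ln (1 + (\<Sum>m<k * n. sqrt (dot d (X m) (X m)))))"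
    using l1_elliptic[of d X "k * n", OF X1] by blast
  have "(\<Sum>m<k * n. sqrt (dot d (X m) (X m))) = (\<Sum>t<k. \<Sum>i<n. sqrt (dot d (x t i) (x t i)))"
    unfolding sum_blocks by (intro sum.cong refl) (auto simp: X_eq)
  also have "\<dots> \<le> (\<Sum>t<k. 1)" using x by (intro sum_mono) auto
  finally have mass: "(\<Sum>m<k * n. sqrt (dot d (X m) (X m))) \<le> real k" by simp
  have "0 \<le> (\<Sum>m<k * n. sqrt (dot d (X m) (X m)))" by (auto simp: dot_nonneg intro!: sum_nonneg)
  then have "ln (1 + (\<Sum>m<k * n. sqrt (dot d (X m) (X m)))) \<le> ln (1 + real k)" using mass by simp
  then have Q: "(\<Sum>m<k * n. q m) \<le> 2 * (real d ^ 2 + 2 * real d * ln (1 + real k))"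
    using qs by (smt (verit) mult_left_mono of_nat_0_le_iff mult_nonneg_nonneg)
  have \<Psi>0: "0 \<le> \<Psi> t j" for t j unfolding \<Psi>_def by (intro sum_nonneg) auto
  have \<Psi>R: "\<Psi> t t \<le> R" if t: "t < k" for t
  proof -
    have "\<Psi> t t \<le> (\<Sum>l\<in>L. \<Sum>i<n. sqrt (dot d (g t l) (g t l)) * sqrt (dot d (x t i) (x t i)))"
      unfolding \<Psi>_def by (intro sum_mono dot_Cauchy_Schwarz)
    also have "\<dots> = (\<Sum>l\<in>L. sqrt (dot d (g t l) (g t l))) * (\<Sum>i<n. sqrt (dot d (x t i) (x t i)))"
      by (simp add: sum_product)
    also have "\<dots> \<le> R * 1"
      using g[OF t] x[OF t] R0 by (intro mult_mono) (auto simp: dot_nonneg intro!: sum_nonneg)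
    finally show ?thesis by simp
  qed
  have past: "(\<Sum>j<t. \<Psi> t j) \<le> sqrt (real k * C)" if t: "t < k" for t
  proof -
    have "(\<Sum>j<t. 1 * \<Psi> t j)\<^sup>2 \<le> (\<Sum>j<t. 1\<^sup>2) * (\<Sum>j<t. (\<Psi> t j)\<^sup>2)"
      by (rule Cauchy_Schwarz_ineq_sum)
    also have "\<dots> \<le> real k * C"
      using C[OF t] t C0 by (intro mult_mono) (auto intro: sum_nonneg)
    finally show ?thesis by (intro real_le_rsqrt) simp
  qed
  have step: "\<Psi> t t \<le> (2 * R + sqrt (real k * C)) * (\<Sum>i<n. q (t * n + i))" if t: "t < k" for t
  proof -
    have idx: "t * n + i < k * n" if "i < n" for i
    proof -
      have "t * n + i < Suc t * n" using that by simp
      also have "\<dots> \<le> k * n" using t by (intro mult_right_mono) auto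
      finally show ?thesis .
    qed
    have "\<Psi> t t = (\<Sum>i<n. \<Sum>l\<in>L. \<bar>dot d (g t l) (X (t * n + i))\<bar>)"
      unfolding \<Psi>_def by (subst sum.swap) (simp add: X_eq t)
    also have "\<dots> \<le> (\<Sum>i<n. (2 * R + sqrt (real k * C)) * q (t * n + i))"
    proof (intro sum_mono)
      fix i assume i: "i \<in> {..<n}"
      then have i': "i < n" by simp
      have "(\<Sum>l\<in>L. \<bar>dot d (g t l) (X (t * n + i))\<bar>) \<le>
        (\<Sum>l\<in>L. (sqrt (dot d (g t l) (g t l)) + (\<Sum>j<Suc t * n. \<bar>dot d (g t l) (X j)\<bar>)) * q (t * n + i))"
      proof (intro sum_mono order_trans[OF q[OF idx[OF i']]] mult_right_mono add_left_mono)
        fix l show "(\<Sum>j<t * n + i. \<bar>dot d (g t l) (X j)\<bar>) \<le> (\<Sum>j<Suc t * n. \<bar>dot d (g t l) (X j)\<bar>)"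
          using i by (intro sum_mono2) auto
      qed (use q0[OF idx[OF i']] in auto)
      also have "\<dots> = ((\<Sum>l\<in>L. sqrt (dot d (g t l) (g t l))) + (\<Sum>j<Suc t. \<Psi> t j)) * q (t * n + i)"
      proof -
        have "(\<Sum>l\<in>L. \<Sum>j<Suc t * n. \<bar>dot d (g t l) (X j)\<bar>) = (\<Sum>j<Suc t. \<Psi> t j)"
          unfolding sum_blocks \<Psi>_def using t
          by (subst sum.swap, intro sum.cong refl) (auto simp: X_eq)
        then show ?thesis by (simp only: sum_distrib_right[symmetric] sum.distrib)
      qed
      also have "\<dots> \<le> (R + (sqrt (real k * C) + R)) * q (t * n + i)"
        using g[OF t] past[OF t] \<Psi>R[OF t] q0[OF idx[OF i']]
        by (intro mult_right_mono add_mono) auto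
      finally show "(\<Sum>l\<in>L. \<bar>dot d (g t l) (X (t * n + i))\<bar>) \<le> (2 * R + sqrt (real k * C)) * q (t * n + i)"
        by (simp add: algebra_simps)
    qed
    finally show ?thesis by (simp add: sum_distrib_left)
  qed
  have "(\<Sum>t<k. \<Psi> t t) \<le> (\<Sum>t<k. (2 * R + sqrt (real k * C)) * (\<Sum>i<n. q (t * n + i)))"
    using step by (intro sum_mono) auto
  also have "\<dots> = (2 * R + sqrt (real k * C)) * (\<Sum>m<k * n. q m)"
    unfolding sum_blocks by (simp add: sum_distrib_left)
  also have "\<dots> \<le> (2 * R + sqrt (real k * C)) * potential d k"
    using Q R0 C0 by (intro mult_left_mono) auto
  finally show ?thesis .
qed

text \<open>Stated as existence of a coefficient vector, so that closure rules can replace explicit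
  coefficients for the nested sums in the defects.\<close>

definition linear_functional :: "nat \<Rightarrow> ((nat \<Rightarrow> real) \<Rightarrow> real) \<Rightarrow> bool" where
  "linear_functional d F \<longleftrightarrow> (\<exists>g. \<forall>v. F v = dot d g v)"

lemma linear_functional_coord: "s < d \<Longrightarrow> linear_functional d (\<lambda>v. v s)"
  unfolding linear_functional_def dot_def
  by (intro exI[of _ "\<lambda>i. if i = s then 1 else 0"]) (simp add: if_distrib if_distribR cong: if_cong)

lemma linear_functional_cmult: "linear_functional d F \<Longrightarrow> linear_functional d (\<lambda>v. c * F v)"
proof -
  assume "linear_functional d F"
  then obtain g where "\<forall>v. F v = dot d g v" by (auto simp: linear_functional_def)
  then have "\<forall>v. c * F v = dot d (\<lambda>i. c * g i) v" by (simp add: dot_def sum_distrib_left mult_ac)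
  then show ?thesis unfolding linear_functional_def by blast
qed

lemma linear_functional_multc: "linear_functional d F \<Longrightarrow> linear_functional d (\<lambda>v. F v * c)"
  using linear_functional_cmult[of d F c] by (simp add: mult.commute)

lemma linear_functional_diff:
  "linear_functional d F \<Longrightarrow> linear_functional d G \<Longrightarrow> linear_functional d (\<lambda>v. F v - G v)"
proof -
  assume "linear_functional d F" "linear_functional d G"
  then obtain f g where "\<forall>v. F v = dot d f v" "\<forall>v. G v = dot d g v" by (auto simp: linear_functional_def)
  then have "\<forall>v. F v - G v = dot d (\<lambda>i. f i - g i) v"
    by (simp add: dot_def sum_subtractf left_diff_distrib)
  then show ?thesis unfolding linear_functional_def by blast
qed

lemma linear_functional_sum:
  assumes "\<And>i. i \<in> I \<Longrightarrow> linear_functional d (F i)"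
  shows "linear_functional d (\<lambda>v. \<Sum>i\<in>I. F i v)"
proof -
  obtain g where g: "\<And>i v. i \<in> I \<Longrightarrow> F i v = dot d (g i) v"
    using assms unfolding linear_functional_def by metis
  have "(\<Sum>i\<in>I. F i v) = dot d (\<lambda>s. \<Sum>i\<in>I. g i s) v" for v
  proof -
    have "(\<Sum>i\<in>I. F i v) = (\<Sum>i\<in>I. \<Sum>s<d. g i s * v s)" using g by (simp add: dot_def)
    also have "\<dots> = dot d (\<lambda>s. \<Sum>i\<in>I. g i s) v"
      unfolding dot_def sum_distrib_right by (rule sum.swap)
    finally show ?thesis .
  qed
  then show ?thesis unfolding linear_functional_def by blast
qed

text \<open>The form needed for models: the vectors \<open>b i\<close> are fixed, only their weights
  and the functionals change with the iteration. Testing the bound \<open>R\<close> on unit vectors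
  shows that the coefficient vectors have Euclidean norms summing to at most
  \<open>d * R\<close>.\<close>

lemma l1_eluder:
  fixes b :: "'i \<Rightarrow> nat \<Rightarrow> real" and F :: "nat \<Rightarrow> 'l \<Rightarrow> (nat \<Rightarrow> real) \<Rightarrow> real"
    and w :: "nat \<Rightarrow> 'i \<Rightarrow> real" and I :: "'i set" and L :: "'l set" and d k :: nat
  defines "Z \<equiv> \<lambda>t j. \<Sum>i\<in>I. w j i * (\<Sum>l\<in>L. \<bar>F t l (b i)\<bar>)"
  assumes I: "finite I"
    and lin: "\<And>t l. t < k \<Longrightarrow> l \<in> L \<Longrightarrow> linear_functional d (F t l)"
    and R: "\<And>t v. t < k \<Longrightarrow> (\<Sum>l\<in>L. \<bar>F t l v\<bar>) \<le> R * l1 d v"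
    and w: "\<And>t i. t < k \<Longrightarrow> i \<in> I \<Longrightarrow> 0 \<le> w t i"
    and mass: "\<And>t. t < k \<Longrightarrow> (\<Sum>i\<in>I. w t i * l1 d (b i)) \<le> 1"
    and C: "\<And>t. t < k \<Longrightarrow> (\<Sum>j<t. (Z t j)\<^sup>2) \<le> C"
    and R0: "0 \<le> R" and C0: "0 \<le> C"
  shows "(\<Sum>t<k. Z t t) \<le> (2 * (real d * R) + sqrt (real k * C)) * potential d k"
proof -
  obtain e where e: "bij_betw e {0..<card I} I" using ex_bij_betw_nat_finite[OF I] by blast
  then have e': "bij_betw e {..<card I} I" by (simp add: lessThan_atLeast0)
  have eI: "e i \<in> I" if "i < card I" for i using e' that by (auto simp: bij_betw_def)
  have "\<exists>g. \<forall>t<k. \<forall>l\<in>L. \<forall>v. F t l v = dot d (g t l) v"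
    using lin unfolding linear_functional_def by metis
  then obtain g where g: "\<And>t l v. t < k \<Longrightarrow> l \<in> L \<Longrightarrow> F t l v = dot d (g t l) v" by blast
  define x where "x t i s = w t (e i) * b (e i) s" for t i s
  have dotx: "dot d h (x t i) = w t (e i) * dot d h (b (e i))" for h t i
    by (simp add: dot_def x_def sum_distrib_left mult_ac)
  have \<Psi>: "(\<Sum>l\<in>L. \<Sum>i<card I. \<bar>dot d (g t l) (x j i)\<bar>) = Z t j" if t: "t < k" and j: "j < k" for t j
  proof -
    have "(\<Sum>l\<in>L. \<Sum>i<card I. \<bar>dot d (g t l) (x j i)\<bar>) = (\<Sum>i<card I. w j (e i) * (\<Sum>l\<in>L. \<bar>F t l (b (e i))\<bar>))"
      unfolding sum_distrib_left using t j eI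
      by (subst sum.swap) (auto simp: dotx abs_mult w g intro!: sum.cong)
    also have "\<dots> = Z t j" unfolding Z_def
      by (rule sum.reindex_bij_betw[OF e', of "\<lambda>i. w j i * (\<Sum>l\<in>L. \<bar>F t l (b i)\<bar>)"])
    finally show ?thesis .
  qed
  have "(\<Sum>t<k. \<Sum>l\<in>L. \<Sum>i<card I. \<bar>dot d (g t l) (x t i)\<bar>) \<le>
    (2 * (real d * R) + sqrt (real k * C)) * potential d k"
  proof (rule l1_eluder_indexed)
    fix t assume t: "t < k"
    have "(\<Sum>i<card I. sqrt (dot d (x t i) (x t i))) \<le> (\<Sum>i<card I. w t (e i) * l1 d (b (e i)))"
    proof (intro sum_mono order_trans[OF dot_self_le_l1])
      fix i assume "i \<in> {..<card I}"
      then show "l1 d (x t i) \<le> w t (e i) * l1 d (b (e i))"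
        using w[OF t eI] by (simp add: x_def abs_mult sum_distrib_left)
    qed
    also have "\<dots> = (\<Sum>i\<in>I. w t i * l1 d (b i))"
      by (rule sum.reindex_bij_betw[OF e', of "\<lambda>i. w t i * l1 d (b i)"])
    finally show "(\<Sum>i<card I. sqrt (dot d (x t i) (x t i))) \<le> 1" using mass[OF t] by linarith
    have "(\<Sum>l\<in>L. sqrt (dot d (g t l) (g t l))) \<le> (\<Sum>l\<in>L. \<Sum>s<d. \<bar>g t l s\<bar>)"
      by (intro sum_mono dot_self_le_l1)
    also have "\<dots> = (\<Sum>s<d. \<Sum>l\<in>L. \<bar>F t l (\<lambda>i. if i = s then 1 else 0)\<bar>)"
    proof (subst sum.swap, intro sum.cong refl)
      fix s l assume "s \<in> {..<d}" "l \<in> L"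
      then show "\<bar>g t l s\<bar> = \<bar>F t l (\<lambda>i. if i = s then 1 else 0)\<bar>"
        using t by (simp add: g dot_def if_distrib if_distribR cong: if_cong)
    qed
    also have "\<dots> \<le> (\<Sum>s<d. R * (\<Sum>s'<d. \<bar>if s' = s then 1 else 0\<bar>))"
      by (rule sum_mono, rule R[OF t])
    also have "\<dots> = (\<Sum>s<d. R)"
      by (intro sum.cong refl) (simp add: if_distrib if_distribR cong: if_cong)
    finally show "(\<Sum>l\<in>L. sqrt (dot d (g t l) (g t l))) \<le> real d * R" by simp
    have "(\<Sum>j<t. (\<Sum>l\<in>L. \<Sum>i<card I. \<bar>dot d (g t l) (x j i)\<bar>)\<^sup>2) = (\<Sum>j<t. (Z t j)\<^sup>2)"
      using t by (intro sum.cong refl) (simp add: \<Psi>)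
    then show "(\<Sum>j<t. (\<Sum>l\<in>L. \<Sum>i<card I. \<bar>dot d (g t l) (x j i)\<bar>)\<^sup>2) \<le> C"
      using C[OF t] by simp
  qed (use R0 C0 in auto)
  then show ?thesis by (simp add: \<Psi>)
qed

section \<open>Comparing two models\<close>

text \<open>
  The model \<open>\<phi>\<close> is compared with the true model \<open>\<theta>\<close>. The rows of the \<open>m\<close>-step likelihood matrices
  are indexed by whole histories of length \<open>m\<close>: compared with the emission-action matrices every
  row is repeated \<open>nA\<close> times, which only increases the singular values.
\<close>

locale model_pair =
  fixes nS nA nO H m :: nat and \<theta> \<phi> :: param and N :: "nat \<Rightarrow> nat \<Rightarrow> history \<Rightarrow> real" and \<kappa> :: real
  assumes \<theta>: "\<theta> \<in> params nS nA nO H" and \<phi>: "\<phi> \<in> params nS nA nO H"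
    and dims: "1 \<le> nS" "1 \<le> nA" "1 \<le> nO" and m: "1 \<le> m" "m \<le> H"
    and left_inverse: "\<And>h s s'. 1 \<le> h \<Longrightarrow> h \<le> H - m + 1 \<Longrightarrow> s < nS \<Longrightarrow> s' < nS \<Longrightarrow>
      (\<Sum>\<tau>\<in>trajectories nA nO m. N h s \<tau> * obs_lik nS \<phi> h s' \<tau>) = (if s = s' then 1 else 0)"
    and N_bound: "\<And>h x. 1 \<le> h \<Longrightarrow> h \<le> H - m + 1 \<Longrightarrow>
      (\<Sum>s<nS. \<bar>\<Sum>\<tau>\<in>trajectories nA nO m. N h s \<tau> * x \<tau>\<bar>) \<le> \<kappa> * (\<Sum>\<tau>\<in>trajectories nA nO m. \<bar>x \<tau>\<bar>)"
    and \<kappa>: "0 \<le> \<kappa>"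
begin

abbreviation T :: "nat \<Rightarrow> history set" where "T n \<equiv> trajectories nA nO n"

definition state :: "param \<Rightarrow> history \<Rightarrow> nat \<Rightarrow> real" where
  "state \<psi> \<tau> = belief nS \<psi> 1 (pmf (init \<psi>)) \<tau>"

text \<open>Translates state vectors of \<open>\<theta>\<close> into state vectors of \<open>\<phi>\<close> with about the same predictions.\<close>

definition transfer :: "nat \<Rightarrow> (nat \<Rightarrow> real) \<Rightarrow> nat \<Rightarrow> real" where
  "transfer h v s = (\<Sum>\<tau>\<in>T m. N h s \<tau> * (\<Sum>s'<nS. v s' * obs_lik nS \<theta> h s' \<tau>))"

definition gap :: "history \<Rightarrow> history \<Rightarrow> real" where
  "gap \<tau> \<tau>2 = obs_prob nS \<phi> (\<tau> @ \<tau>2) - obs_prob nS \<theta> (\<tau> @ \<tau>2)"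

abbreviation gap_l1 :: "nat \<Rightarrow> history \<Rightarrow> real" where
  "gap_l1 n \<tau> \<equiv> (\<Sum>\<tau>2\<in>T n. \<bar>gap \<tau> \<tau>2\<bar>)"

definition offset :: "history \<Rightarrow> nat \<Rightarrow> real" where
  "offset \<tau> s = state \<phi> \<tau> s - transfer (Suc (length \<tau>)) (state \<theta> \<tau>) s"

text \<open>The \<open>Inl\<close> components measure how far the transfer is from commuting with one step of the
  dynamics, the \<open>Inr\<close> components how far it is from preserving the predictions for the last \<open>m\<close>
  steps.\<close>

definition defect :: "nat \<Rightarrow> (nat \<times> nat \<times> nat) + history \<Rightarrow> (nat \<Rightarrow> real) \<Rightarrow> real" where
  "defect h l v = (case l of
     Inl (x, a, s) \<Rightarrow> belief_step nS \<phi> (Suc h) x a (transfer (Suc h) v) s -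
       transfer (Suc (Suc h)) (belief_step nS \<theta> (Suc h) x a v) s
   | Inr \<tau>2 \<Rightarrow> (\<Sum>s<nS. transfer (Suc h) v s * obs_lik nS \<phi> (Suc h) s \<tau>2) -
       (\<Sum>s<nS. v s * obs_lik nS \<theta> (Suc h) s \<tau>2))"

text \<open>A step component compares transfers at steps \<open>h + 1\<close> and
  \<open>h + 2\<close>, and a left inverse is available only up to step \<open>H - m + 1\<close>. At
  \<open>h = H - m\<close> exactly \<open>m\<close> steps remain, and their predictions are compared
  as a whole.\<close>

definition components :: "nat \<Rightarrow> ((nat \<times> nat \<times> nat) + history) set" where
  "components h = (if h < H - m then Inl ` ({..<nO} \<times> {..<nA} \<times> {..<nS}) else Inr ` T m)"

abbreviation defect_l1 :: "nat \<Rightarrow> (nat \<Rightarrow> real) \<Rightarrow> real" where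
  "defect_l1 h v \<equiv> (\<Sum>l\<in>components h. \<bar>defect h l v\<bar>)"

lemma sum_components:
  "defect_l1 h v =
    (if h < H - m then \<Sum>x<nO. \<Sum>a<nA. \<Sum>s<nS. \<bar>defect h (Inl (x, a, s)) v\<bar>
     else \<Sum>\<tau>2\<in>T m. \<bar>defect h (Inr \<tau>2) v\<bar>)"
  by (simp add: components_def sum.reindex sum.cartesian_product case_prod_unfold)

lemma linear_functional_transfer: "linear_functional nS (\<lambda>v. transfer h v s)"
  unfolding transfer_def
  by (intro linear_functional_sum linear_functional_cmult linear_functional_multc linear_functional_coord) simp

lemma linear_functional_defect:
  assumes "l \<in> components h"
  shows "linear_functional nS (defect h l)"
proof (cases l)
  case (Inl p)
  obtain x a s where p: "p = (x, a, s)" by (cases p)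
  have "linear_functional nS (\<lambda>v. belief_step nS \<phi> (Suc h) x a (transfer (Suc h) v) s)"
    unfolding belief_step_def
    by (intro linear_functional_sum linear_functional_multc linear_functional_transfer)
  moreover have "linear_functional nS (\<lambda>v. transfer (Suc (Suc h)) (belief_step nS \<theta> (Suc h) x a v) s)"
    unfolding transfer_def belief_step_def
    by (intro linear_functional_sum linear_functional_cmult linear_functional_multc linear_functional_coord) simp
  ultimately show ?thesis unfolding Inl p defect_def
    by (simp add: linear_functional_diff)
next
  case (Inr \<tau>2)
  have "linear_functional nS (\<lambda>v. \<Sum>s<nS. transfer (Suc h) v s * obs_lik nS \<phi> (Suc h) s \<tau>2)"
    by (intro linear_functional_sum linear_functional_multc linear_functional_transfer)
  moreover have "linear_functional nS (\<lambda>v. \<Sum>s<nS. v s * obs_lik nS \<theta> (Suc h) s \<tau>2)"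
    by (intro linear_functional_sum linear_functional_multc linear_functional_coord) simp
  ultimately show ?thesis unfolding Inr defect_def
    by (simp add: linear_functional_diff)
qed

lemma sum_obs_lik_l1:
  assumes \<psi>: "\<psi> \<in> params nS nA nO H" and \<pi>: "\<pi> \<in> policies nA nO H" and h: "1 \<le> h" "h \<le> H - m + 1"
  shows "(\<Sum>\<tau>\<in>T m. \<bar>\<Sum>s<nS. v s * obs_lik nS \<psi> h s \<tau>\<bar>) \<le> real nA ^ m * l1 nS v"
proof -
  have "(\<Sum>\<tau>\<in>T m. \<bar>\<Sum>s<nS. v s * obs_lik nS \<psi> h s \<tau>\<bar>) \<le> (\<Sum>\<tau>\<in>T m. \<Sum>s<nS. \<bar>v s\<bar> * obs_lik nS \<psi> h s \<tau>)"
    by (intro sum_mono order_trans[OF sum_abs]) (simp add: abs_mult)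
  also have "\<dots> = (\<Sum>s<nS. \<bar>v s\<bar> * (\<Sum>\<tau>\<in>T m. obs_lik nS \<psi> h s \<tau>))"
    by (subst sum.swap) (simp add: sum_distrib_left)
  also have "\<dots> = (\<Sum>s<nS. \<bar>v s\<bar> * real nA ^ m)"
    using obs_lik_total[OF \<psi> \<pi> dims(2,3), of _ h m] h m by (intro sum.cong refl) auto
  finally show ?thesis by (simp add: sum_distrib_left mult.commute)
qed

lemma transfer_l1:
  assumes \<pi>: "\<pi> \<in> policies nA nO H" and h: "1 \<le> h" "h \<le> H - m + 1"
  shows "l1 nS (transfer h v) \<le> \<kappa> * real nA ^ m * l1 nS v"
proof -
  have "l1 nS (transfer h v) \<le> \<kappa> * (\<Sum>\<tau>\<in>T m. \<bar>\<Sum>s<nS. v s * obs_lik nS \<theta> h s \<tau>\<bar>)"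
    unfolding transfer_def by (rule N_bound[OF h])
  also have "\<dots> \<le> \<kappa> * (real nA ^ m * l1 nS v)"
    by (rule mult_left_mono[OF sum_obs_lik_l1[OF \<theta> \<pi> h] \<kappa>])
  finally show ?thesis by (simp add: mult.assoc)
qed

lemma state_snoc: "state \<psi> (\<tau> @ [(x, a)]) = belief_step nS \<psi> (Suc (length \<tau>)) x a (state \<psi> \<tau>)"
  by (simp add: state_def belief_append)

lemma obs_prob_state:
  "\<tau>2 \<noteq> [] \<Longrightarrow> obs_prob nS \<psi> (\<tau> @ \<tau>2) = (\<Sum>s<nS. state \<psi> \<tau> s * obs_lik nS \<psi> (Suc (length \<tau>)) s \<tau>2)"
  unfolding obs_prob_def state_def by (subst obs_lik_belief) simp_all

text \<open>The left inverse recovers the state vector of \<phi> from its predictions, and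
  \<open>transfer\<close> applies the same inverse to the predictions of \<theta>. Their difference
  is thus the inverse applied to observable errors.\<close>

lemma offset_eq:
  assumes \<tau>: "length \<tau> + m \<le> H" and s: "s < nS"
  shows "offset \<tau> s = (\<Sum>\<tau>2\<in>T m. N (Suc (length \<tau>)) s \<tau>2 * gap \<tau> \<tau>2)"
proof -
  let ?h = "Suc (length \<tau>)"
  have h: "1 \<le> ?h" "?h \<le> H - m + 1" using \<tau> m by auto
  have "(\<Sum>\<tau>2\<in>T m. N ?h s \<tau>2 * (\<Sum>s'<nS. state \<phi> \<tau> s' * obs_lik nS \<phi> ?h s' \<tau>2)) =
    (\<Sum>s'<nS. state \<phi> \<tau> s' * (\<Sum>\<tau>2\<in>T m. N ?h s \<tau>2 * obs_lik nS \<phi> ?h s' \<tau>2))"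
    unfolding sum_distrib_left by (subst sum.swap) (simp add: mult_ac)
  also have "\<dots> = (\<Sum>s'<nS. state \<phi> \<tau> s' * (if s = s' then 1 else 0))"
    using left_inverse[OF h s] by (intro sum.cong refl) simp
  also have "\<dots> = state \<phi> \<tau> s" using s by (simp add: if_distrib if_distribR cong: if_cong)
  finally have 1: "(\<Sum>\<tau>2\<in>T m. N ?h s \<tau>2 * (\<Sum>s'<nS. state \<phi> \<tau> s' * obs_lik nS \<phi> ?h s' \<tau>2)) = state \<phi> \<tau> s" .
  have ne: "\<tau>2 \<noteq> []" if "\<tau>2 \<in> T m" for \<tau>2 using that m by auto
  have "(\<Sum>\<tau>2\<in>T m. N ?h s \<tau>2 * gap \<tau> \<tau>2) =
    (\<Sum>\<tau>2\<in>T m. N ?h s \<tau>2 * (\<Sum>s'<nS. state \<phi> \<tau> s' * obs_lik nS \<phi> ?h s' \<tau>2) -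
      N ?h s \<tau>2 * (\<Sum>s'<nS. state \<theta> \<tau> s' * obs_lik nS \<theta> ?h s' \<tau>2))"
    using ne by (intro sum.cong refl) (simp add: gap_def obs_prob_state right_diff_distrib)
  then show ?thesis unfolding offset_def sum_subtractf 1 transfer_def by simp
qed

lemma offset_l1:
  assumes \<tau>: "length \<tau> + m \<le> H"
  shows "l1 nS (offset \<tau>) \<le> \<kappa> * gap_l1 m \<tau>"
proof -
  have "l1 nS (offset \<tau>) = (\<Sum>s<nS. \<bar>\<Sum>\<tau>2\<in>T m. N (Suc (length \<tau>)) s \<tau>2 * gap \<tau> \<tau>2\<bar>)"
    using offset_eq[OF \<tau>] by (intro sum.cong refl) simp
  also have "\<dots> \<le> \<kappa> * gap_l1 m \<tau>"
    using \<tau> m by (intro N_bound) auto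
  finally show ?thesis .
qed

text \<open>Insert the \<phi>-step of the transferred \<theta>-vector: the old offset is propagated
  by \<phi> alone, and what remains is the defect at the true state vector.\<close>

lemma offset_snoc:
  "offset (\<tau> @ [(x, a)]) s = belief_step nS \<phi> (Suc (length \<tau>)) x a (offset \<tau>) s +
     defect (length \<tau>) (Inl (x, a, s)) (state \<theta> \<tau>)"
proof -
  have "belief_step nS \<phi> (Suc (length \<tau>)) x a (offset \<tau>) s =
    belief_step nS \<phi> (Suc (length \<tau>)) x a (state \<phi> \<tau>) s -
    belief_step nS \<phi> (Suc (length \<tau>)) x a (transfer (Suc (length \<tau>)) (state \<theta> \<tau>)) s"
    by (simp add: belief_step_def offset_def left_diff_distrib sum_subtractf)
  then show ?thesis by (simp add: offset_def state_snoc defect_def)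
qed

lemma gap_eq:
  assumes "\<tau>2 \<noteq> []"
  shows "gap \<tau> \<tau>2 = (\<Sum>s<nS. offset \<tau> s * obs_lik nS \<phi> (Suc (length \<tau>)) s \<tau>2) +
    defect (length \<tau>) (Inr \<tau>2) (state \<theta> \<tau>)"
  using assms
  by (simp add: gap_def obs_prob_state offset_def defect_def left_diff_distrib sum_subtractf)

text \<open>A common bound for both kinds of components; the square also covers
  \<open>nA ^ Suc m\<close>, since \<open>1 \<le> m\<close>.\<close>

definition defect_const :: real where "defect_const = 2 * (1 + \<kappa>) * (real nA ^ m)\<^sup>2"

lemma defect_const_ge:
  "2 * \<kappa> * (real nA * real nA ^ m) \<le> defect_const" "real nA ^ m * (1 + \<kappa> * real nA ^ m) \<le> defect_const"
proof -
  have A: "1 \<le> real nA ^ m" using dims by (intro one_le_power) simp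
  have A1: "real nA \<le> real nA ^ m" using dims m by (intro self_le_power) auto
  have "2 * \<kappa> * (real nA * real nA ^ m) \<le> (2 * (1 + \<kappa>)) * (real nA ^ m * real nA ^ m)"
    using A1 \<kappa> by (intro mult_mono) auto
  then show "2 * \<kappa> * (real nA * real nA ^ m) \<le> defect_const" by (simp add: defect_const_def power2_eq_square)
  have "real nA ^ m * (1 + \<kappa> * real nA ^ m) \<le> real nA ^ m * (real nA ^ m + \<kappa> * real nA ^ m)"
    using A by (intro mult_left_mono) auto
  also have "\<dots> = (1 + \<kappa>) * (real nA ^ m)\<^sup>2" by (simp add: power2_eq_square algebra_simps)
  also have "\<dots> \<le> defect_const" using \<kappa> unfolding defect_const_def mult.assoc by simp
  finally show "real nA ^ m * (1 + \<kappa> * real nA ^ m) \<le> defect_const" .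
qed

text \<open>An a priori bound for arbitrary vectors. It serves as the \<open>R\<close> of
  \<open>l1_eluder\<close>, in contrast to \<open>exp_defect_le\<close>, where the defect is small
  because of data.\<close>

lemma defect_bound:
  assumes \<pi>: "\<pi> \<in> policies nA nO H" and h: "h \<le> H - m"
  shows "defect_l1 h v \<le> defect_const * l1 nS v"
proof -
  have v0: "0 \<le> l1 nS v" by (intro sum_nonneg) auto
  have h1: "1 \<le> Suc h" "Suc h \<le> H - m + 1" using h by auto
  have t: "l1 nS (transfer (Suc h) v) \<le> \<kappa> * real nA ^ m * l1 nS v"
    by (rule transfer_l1[OF \<pi> h1])
  show ?thesis
  proof (cases "h < H - m")
    case True
    have h2: "1 \<le> Suc (Suc h)" "Suc (Suc h) \<le> H - m + 1" using True by auto
    have hH: "Suc h < H" using True m by auto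
    have "(\<Sum>x<nO. \<Sum>a<nA. \<Sum>s<nS. \<bar>defect h (Inl (x, a, s)) v\<bar>) \<le>
      (\<Sum>x<nO. \<Sum>a<nA. l1 nS (belief_step nS \<phi> (Suc h) x a (transfer (Suc h) v)) +
        l1 nS (transfer (Suc (Suc h)) (belief_step nS \<theta> (Suc h) x a v)))"
      unfolding sum.distrib[symmetric] defect_def by (intro sum_mono) (simp add: abs_triangle_ineq4)
    also have "\<dots> \<le> (\<Sum>x<nO. \<Sum>a<nA. l1 nS (belief_step nS \<phi> (Suc h) x a (transfer (Suc h) v)) +
        \<kappa> * real nA ^ m * l1 nS (belief_step nS \<theta> (Suc h) x a v))"
      by (rule sum_mono, rule sum_mono, rule add_left_mono, rule transfer_l1[OF \<pi> h2])
    also have "\<dots> = (\<Sum>x<nO. \<Sum>a<nA. \<Sum>s<nS. \<bar>belief_step nS \<phi> (Suc h) x a (transfer (Suc h) v) s\<bar>) +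
        \<kappa> * real nA ^ m * (\<Sum>x<nO. \<Sum>a<nA. \<Sum>s<nS. \<bar>belief_step nS \<theta> (Suc h) x a v s\<bar>)"
      by (simp add: sum.distrib sum_distrib_left)
    also have "\<dots> \<le> real nA * l1 nS (transfer (Suc h) v) +
        \<kappa> * real nA ^ m * (real nA * l1 nS v)"
      using \<kappa> belief_step_all_l1[OF \<phi> h1(1) hH] belief_step_all_l1[OF \<theta> h1(1) hH]
      by (intro add_mono mult_left_mono) auto
    also have "\<dots> \<le> real nA * (\<kappa> * real nA ^ m * l1 nS v) +
        \<kappa> * real nA ^ m * (real nA * l1 nS v)"
      using t by (intro add_right_mono mult_left_mono) auto
    also have "\<dots> = 2 * \<kappa> * (real nA * real nA ^ m) * l1 nS v" by (simp add: algebra_simps)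
    also have "\<dots> \<le> defect_const * l1 nS v" by (rule mult_right_mono[OF defect_const_ge(1) v0])
    finally show ?thesis using True by (simp add: sum_components)
  next
    case False
    have "(\<Sum>\<tau>2\<in>T m. \<bar>defect h (Inr \<tau>2) v\<bar>) \<le>
      (\<Sum>\<tau>2\<in>T m. \<bar>\<Sum>s<nS. transfer (Suc h) v s * obs_lik nS \<phi> (Suc h) s \<tau>2\<bar>) +
      (\<Sum>\<tau>2\<in>T m. \<bar>\<Sum>s<nS. v s * obs_lik nS \<theta> (Suc h) s \<tau>2\<bar>)"
      unfolding sum.distrib[symmetric] defect_def by (intro sum_mono) (simp add: abs_triangle_ineq4)
    also have "\<dots> \<le> real nA ^ m * l1 nS (transfer (Suc h) v) + real nA ^ m * l1 nS v"
      by (intro add_mono sum_obs_lik_l1[OF \<phi> \<pi> h1] sum_obs_lik_l1[OF \<theta> \<pi> h1])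
    also have "\<dots> \<le> real nA ^ m * (\<kappa> * real nA ^ m * l1 nS v) + real nA ^ m * l1 nS v"
      using t by (intro add_right_mono mult_left_mono) auto
    also have "\<dots> = real nA ^ m * (1 + \<kappa> * real nA ^ m) * l1 nS v" by (simp add: algebra_simps)
    also have "\<dots> \<le> defect_const * l1 nS v" by (rule mult_right_mono[OF defect_const_ge(2) v0])
    finally show ?thesis using False by (simp add: sum_components)
  qed
qed

definition data_dist :: "policy \<Rightarrow> nat \<Rightarrow> real" where
  "data_dist \<pi> h = l1_dist nS nA nO \<phi> \<theta> (then_uniform nA \<pi> h) H"

definition exp_defect :: "policy \<Rightarrow> nat \<Rightarrow> real" where
  "exp_defect \<pi> h = (\<Sum>\<tau>\<in>T h. pol_prob \<pi> [] \<tau> * defect_l1 h (state \<theta> \<tau>))"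

text \<open>Importance weighting: after step \<open>h\<close> each sequence of \<open>n\<close>
  actions has probability \<open>(1 / nA) ^ n\<close> under the data policy, so the unweighted sum
  is \<open>nA ^ n\<close> times a distance between marginals of its trajectories.\<close>

lemma gap_data:
  assumes \<pi>: "\<pi> \<in> policies nA nO H" and n: "1 \<le> n" "h + n \<le> H"
  shows "(\<Sum>\<tau>\<in>T h. pol_prob \<pi> [] \<tau> * gap_l1 n \<tau>) \<le> real nA ^ n * data_dist \<pi> h"
proof -
  have "(\<Sum>\<tau>\<in>T h. pol_prob \<pi> [] \<tau> * gap_l1 n \<tau>) =
    (\<Sum>\<tau>\<in>T h. \<Sum>\<tau>2\<in>T n. real nA ^ n * (pol_prob (then_uniform nA \<pi> h) [] (\<tau> @ \<tau>2) *
      \<bar>obs_prob nS \<phi> (\<tau> @ \<tau>2) - obs_prob nS \<theta> (\<tau> @ \<tau>2)\<bar>))"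
    unfolding sum_distrib_left
  proof (intro sum.cong refl)
    fix \<tau> \<tau>2 assume \<tau>: "\<tau> \<in> T h" and \<tau>2: "\<tau>2 \<in> T n"
    have "pol_prob (then_uniform nA \<pi> h) [] (\<tau> @ \<tau>2) = pol_prob \<pi> [] \<tau> * (1 / real nA) ^ n"
      using \<tau> pol_prob_then_uniform_before[of "[]" \<tau> h nA \<pi>]
        pol_prob_then_uniform_after[OF dims(2) _ \<tau>2, of h \<tau> \<pi>]
      by (simp add: pol_prob_append length_trajectories)
    then show "pol_prob \<pi> [] \<tau> * \<bar>gap \<tau> \<tau>2\<bar> = real nA ^ n * (pol_prob (then_uniform nA \<pi> h) [] (\<tau> @ \<tau>2) *
      \<bar>obs_prob nS \<phi> (\<tau> @ \<tau>2) - obs_prob nS \<theta> (\<tau> @ \<tau>2)\<bar>)"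
      using dims by (simp add: gap_def power_divide)
  qed
  also have "\<dots> = real nA ^ n * l1_dist nS nA nO \<phi> \<theta> (then_uniform nA \<pi> h) (h + n)"
    by (simp add: l1_dist_def sum_trajectories_add sum_distrib_left)
  also have "\<dots> \<le> real nA ^ n * data_dist \<pi> h"
    unfolding data_dist_def using n l1_dist_mono[OF \<phi> \<theta> then_uniform_policies[OF \<pi> dims(2)]]
    by (intro mult_left_mono) auto
  finally show ?thesis .
qed

text \<open>Read \<open>offset_snoc\<close> and \<open>gap_eq\<close> backwards: at a true state
  vector the defect is a difference of offsets and gaps, all of them visible in the \<open>m\<close>
  or \<open>m + 1\<close> steps after step \<open>h\<close>. Those steps are uniform in the data
  collected with this policy.\<close>

lemma exp_defect_le:
  assumes \<pi>: "\<pi> \<in> policies nA nO H" and h: "h \<le> H - m"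
  shows "exp_defect \<pi> h \<le> defect_const * data_dist \<pi> h"
proof -
  have D0: "0 \<le> data_dist \<pi> h" by (simp add: data_dist_def l1_dist_nonneg)
  have hm: "h + m \<le> H" using h m by simp
  have g1: "(\<Sum>\<tau>\<in>T h. pol_prob \<pi> [] \<tau> * gap_l1 m \<tau>) \<le> real nA ^ m * data_dist \<pi> h"
    by (rule gap_data[OF \<pi> m(1) hm])
  show ?thesis
  proof (cases "h < H - m")
    case True
    have hm1: "h + Suc m \<le> H" and hH: "Suc h < H" using True m by auto
    have g2: "(\<Sum>\<tau>\<in>T h. pol_prob \<pi> [] \<tau> * gap_l1 (Suc m) \<tau>) \<le> real nA ^ Suc m * data_dist \<pi> h"
      by (rule gap_data[OF \<pi> _ hm1]) simp
    have pt: "defect_l1 h (state \<theta> \<tau>) \<le>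
      \<kappa> * gap_l1 (Suc m) \<tau> + real nA * (\<kappa> * gap_l1 m \<tau>)" if \<tau>: "\<tau> \<in> T h" for \<tau>
    proof -
      have len: "length \<tau> = h" using \<tau> by (rule length_trajectories)
      have "defect_l1 h (state \<theta> \<tau>) = (\<Sum>x<nO. \<Sum>a<nA. \<Sum>s<nS. \<bar>defect h (Inl (x, a, s)) (state \<theta> \<tau>)\<bar>)"
        using True by (simp add: sum_components)
      also have "\<dots> \<le> (\<Sum>x<nO. \<Sum>a<nA. \<Sum>s<nS. \<bar>offset (\<tau> @ [(x, a)]) s\<bar> + \<bar>belief_step nS \<phi> (Suc h) x a (offset \<tau>) s\<bar>)"
        using offset_snoc[of \<tau>] len by (intro sum_mono) simp
      also have "\<dots> = (\<Sum>x<nO. \<Sum>a<nA. \<Sum>s<nS. \<bar>offset (\<tau> @ [(x, a)]) s\<bar>) +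
        (\<Sum>x<nO. \<Sum>a<nA. \<Sum>s<nS. \<bar>belief_step nS \<phi> (Suc h) x a (offset \<tau>) s\<bar>)"
        by (simp add: sum.distrib)
      also have "\<dots> \<le> (\<Sum>x<nO. \<Sum>a<nA. \<kappa> * gap_l1 m (\<tau> @ [(x, a)])) + real nA * l1 nS (offset \<tau>)"
      proof (rule add_mono)
        show "(\<Sum>x<nO. \<Sum>a<nA. \<Sum>s<nS. \<bar>offset (\<tau> @ [(x, a)]) s\<bar>) \<le>
          (\<Sum>x<nO. \<Sum>a<nA. \<kappa> * gap_l1 m (\<tau> @ [(x, a)]))"
          by (rule sum_mono, rule sum_mono, rule offset_l1) (use len hm1 in simp)
        show "(\<Sum>x<nO. \<Sum>a<nA. \<Sum>s<nS. \<bar>belief_step nS \<phi> (Suc h) x a (offset \<tau>) s\<bar>) \<le> real nA * l1 nS (offset \<tau>)"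
          by (rule belief_step_all_l1[OF \<phi> _ hH]) simp
      qed
      also have "(\<Sum>x<nO. \<Sum>a<nA. \<kappa> * gap_l1 m (\<tau> @ [(x, a)])) = \<kappa> * gap_l1 (Suc m) \<tau>"
        by (simp add: sum_trajectories_Suc sum_distrib_left gap_def)
      also have "real nA * l1 nS (offset \<tau>) \<le> real nA * (\<kappa> * gap_l1 m \<tau>)"
        using len hm by (intro mult_left_mono offset_l1) auto
      finally show ?thesis by simp
    qed
    have "exp_defect \<pi> h \<le> (\<Sum>\<tau>\<in>T h. pol_prob \<pi> [] \<tau> *
      (\<kappa> * gap_l1 (Suc m) \<tau> + real nA * (\<kappa> * gap_l1 m \<tau>)))"
      unfolding exp_defect_def using pt by (intro sum_mono mult_left_mono) auto
    also have "\<dots> = \<kappa> * (\<Sum>\<tau>\<in>T h. pol_prob \<pi> [] \<tau> * gap_l1 (Suc m) \<tau>) +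
      real nA * (\<kappa> * (\<Sum>\<tau>\<in>T h. pol_prob \<pi> [] \<tau> * gap_l1 m \<tau>))"
      unfolding distrib_left sum.distrib by (simp add: sum_distrib_left mult_ac)
    also have "\<dots> \<le> \<kappa> * (real nA ^ Suc m * data_dist \<pi> h) + real nA * (\<kappa> * (real nA ^ m * data_dist \<pi> h))"
      using g1 g2 \<kappa> by (intro add_mono mult_left_mono) auto
    also have "\<dots> = 2 * \<kappa> * (real nA * real nA ^ m) * data_dist \<pi> h" by (simp add: algebra_simps)
    also have "\<dots> \<le> defect_const * data_dist \<pi> h" by (rule mult_right_mono[OF defect_const_ge(1) D0])
    finally show ?thesis .
  next
    case False
    have pt: "defect_l1 h (state \<theta> \<tau>) \<le> (1 + \<kappa> * real nA ^ m) * gap_l1 m \<tau>"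
      if \<tau>: "\<tau> \<in> T h" for \<tau>
    proof -
      have len: "length \<tau> = h" using \<tau> by (rule length_trajectories)
      have h1: "1 \<le> Suc h" "Suc h \<le> H - m + 1" using h by auto
      have ne: "\<tau>2 \<noteq> []" if "\<tau>2 \<in> T m" for \<tau>2 using that m by auto
      have "defect_l1 h (state \<theta> \<tau>) = (\<Sum>\<tau>2\<in>T m. \<bar>defect h (Inr \<tau>2) (state \<theta> \<tau>)\<bar>)"
        using False by (simp add: sum_components)
      also have "\<dots> \<le> (\<Sum>\<tau>2\<in>T m. \<bar>gap \<tau> \<tau>2\<bar> + \<bar>\<Sum>s<nS. offset \<tau> s * obs_lik nS \<phi> (Suc h) s \<tau>2\<bar>)"
        using gap_eq[OF ne, of _ \<tau>] len by (intro sum_mono) auto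
      also have "\<dots> \<le> gap_l1 m \<tau> + real nA ^ m * l1 nS (offset \<tau>)"
        unfolding sum.distrib by (intro add_left_mono sum_obs_lik_l1[OF \<phi> \<pi> h1])
      also have "\<dots> \<le> gap_l1 m \<tau> + real nA ^ m * (\<kappa> * gap_l1 m \<tau>)"
        using len hm by (intro add_left_mono mult_left_mono offset_l1) auto
      finally show ?thesis by (simp add: algebra_simps)
    qed
    have "exp_defect \<pi> h \<le> (\<Sum>\<tau>\<in>T h. pol_prob \<pi> [] \<tau> * ((1 + \<kappa> * real nA ^ m) * gap_l1 m \<tau>))"
      unfolding exp_defect_def using pt by (intro sum_mono mult_left_mono) auto
    also have "\<dots> = (1 + \<kappa> * real nA ^ m) * (\<Sum>\<tau>\<in>T h. pol_prob \<pi> [] \<tau> * gap_l1 m \<tau>)"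
      unfolding sum_distrib_left by (simp add: mult_ac)
    also have "\<dots> \<le> (1 + \<kappa> * real nA ^ m) * (real nA ^ m * data_dist \<pi> h)"
      using g1 \<kappa> by (intro mult_left_mono) auto
    also have "\<dots> = real nA ^ m * (1 + \<kappa> * real nA ^ m) * data_dist \<pi> h" by (simp add: mult_ac)
    also have "\<dots> \<le> defect_const * data_dist \<pi> h" by (rule mult_right_mono[OF defect_const_ge(2) D0])
    finally show ?thesis .
  qed
qed

definition exp_offset :: "policy \<Rightarrow> nat \<Rightarrow> real" where
  "exp_offset \<pi> h = (\<Sum>\<tau>\<in>T h. pol_prob \<pi> [] \<tau> * l1 nS (offset \<tau>))"

text \<open>Averaged over \<open>\<pi>\<close>, a step of \<phi> does not expand the l1-norm, so
  errors add up over the steps and do not multiply. The defect is summed over all actions, its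
  probability factor being bounded by 1.\<close>

lemma exp_offset_Suc:
  assumes \<pi>: "\<pi> \<in> policies nA nO H" and h: "h < H - m"
  shows "exp_offset \<pi> (Suc h) \<le> exp_offset \<pi> h + exp_defect \<pi> h"
proof -
  have hH: "Suc h < H" using h m by auto
  have one: "(\<Sum>p\<in>T (Suc 0). f p) = (\<Sum>x<nO. \<Sum>a<nA. f [(x, a)])" for f :: "history \<Rightarrow> real"
    by (simp add: sum_trajectories_Suc)
  have add: "(\<Sum>\<tau>\<in>T (Suc h). f \<tau>) = (\<Sum>\<tau>\<in>T h. \<Sum>\<tau>2\<in>T (Suc 0). f (\<tau> @ \<tau>2))" for f :: "history \<Rightarrow> real"
    using sum_trajectories_add[of f nA nO h "Suc 0"] by simp
  have "exp_offset \<pi> (Suc h) = (\<Sum>\<tau>\<in>T h. \<Sum>x<nO. \<Sum>a<nA. pol_prob \<pi> [] (\<tau> @ [(x, a)]) * l1 nS (offset (\<tau> @ [(x, a)])))"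
    unfolding exp_offset_def add one by simp
  also have "\<dots> \<le> (\<Sum>\<tau>\<in>T h. pol_prob \<pi> [] \<tau> * (l1 nS (offset \<tau>) + defect_l1 h (state \<theta> \<tau>)))"
  proof (intro sum_mono)
    fix \<tau> assume \<tau>: "\<tau> \<in> T h"
    then have len: "length \<tau> = h" by (rule length_trajectories)
    have "(\<Sum>x<nO. \<Sum>a<nA. pol_prob \<pi> [] (\<tau> @ [(x, a)]) * l1 nS (offset (\<tau> @ [(x, a)]))) =
      pol_prob \<pi> [] \<tau> * (\<Sum>x<nO. \<Sum>a<nA. pmf (\<pi> \<tau> x) a * l1 nS (offset (\<tau> @ [(x, a)])))"
      by (simp add: pol_prob_append sum_distrib_left mult.assoc)
    also have "\<dots> \<le> pol_prob \<pi> [] \<tau> * (l1 nS (offset \<tau>) + defect_l1 h (state \<theta> \<tau>))"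
    proof (rule mult_left_mono)
      have "(\<Sum>x<nO. \<Sum>a<nA. pmf (\<pi> \<tau> x) a * l1 nS (offset (\<tau> @ [(x, a)]))) \<le>
        (\<Sum>x<nO. \<Sum>a<nA. pmf (\<pi> \<tau> x) a * l1 nS (belief_step nS \<phi> (Suc h) x a (offset \<tau>)) +
          (\<Sum>s<nS. \<bar>defect h (Inl (x, a, s)) (state \<theta> \<tau>)\<bar>))"
      proof (rule sum_mono, rule sum_mono)
        fix x a
        let ?B = "\<Sum>s<nS. \<bar>belief_step nS \<phi> (Suc h) x a (offset \<tau>) s\<bar>" and ?F = "\<Sum>s<nS. \<bar>defect h (Inl (x, a, s)) (state \<theta> \<tau>)\<bar>"
        have "l1 nS (offset (\<tau> @ [(x, a)])) \<le> ?B + ?F"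
          unfolding sum.distrib[symmetric] offset_snoc len by (intro sum_mono abs_triangle_ineq)
        then have "pmf (\<pi> \<tau> x) a * l1 nS (offset (\<tau> @ [(x, a)])) \<le> pmf (\<pi> \<tau> x) a * (?B + ?F)"
          by (rule mult_left_mono) simp
        also have "\<dots> \<le> pmf (\<pi> \<tau> x) a * ?B + ?F"
          unfolding distrib_left
          by (intro add_left_mono mult_left_le_one_le) (auto simp: pmf_le_1 intro!: sum_nonneg)
        finally show "pmf (\<pi> \<tau> x) a * l1 nS (offset (\<tau> @ [(x, a)])) \<le> pmf (\<pi> \<tau> x) a * ?B + ?F" .
      qed
      also have "\<dots> = (\<Sum>x<nO. \<Sum>a<nA. pmf (\<pi> \<tau> x) a * l1 nS (belief_step nS \<phi> (Suc h) x a (offset \<tau>))) +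
          defect_l1 h (state \<theta> \<tau>)"
        using h by (simp add: sum.distrib sum_components)
      also have "\<dots> \<le> l1 nS (offset \<tau>) + defect_l1 h (state \<theta> \<tau>)"
        by (intro add_right_mono belief_step_policy_l1[OF \<phi> \<pi> \<tau> hH])
      finally show "(\<Sum>x<nO. \<Sum>a<nA. pmf (\<pi> \<tau> x) a * l1 nS (offset (\<tau> @ [(x, a)]))) \<le>
        l1 nS (offset \<tau>) + defect_l1 h (state \<theta> \<tau>)" .
    qed simp
    finally show "(\<Sum>x<nO. \<Sum>a<nA. pol_prob \<pi> [] (\<tau> @ [(x, a)]) * l1 nS (offset (\<tau> @ [(x, a)]))) \<le>
      pol_prob \<pi> [] \<tau> * (l1 nS (offset \<tau>) + defect_l1 h (state \<theta> \<tau>))" .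
  qed
  also have "\<dots> = exp_offset \<pi> h + exp_defect \<pi> h" by (simp add: exp_offset_def exp_defect_def distrib_left sum.distrib)
  finally show ?thesis .
qed

lemma exp_offset_le: "\<pi> \<in> policies nA nO H \<Longrightarrow> h \<le> H - m \<Longrightarrow> exp_offset \<pi> h \<le> exp_offset \<pi> 0 + (\<Sum>i<h. exp_defect \<pi> i)"
proof (induction h)
  case (Suc h)
  then show ?case using exp_offset_Suc[of \<pi> h] by simp
qed simp

lemma exp_offset_0: "exp_offset \<pi> 0 \<le> \<kappa> * gap_l1 m []"
  using offset_l1[of "[]"] m by (simp add: exp_offset_def)

text \<open>Telescoping: the offset at \<open>H - m\<close> is the initial offset plus the defects
  of the earlier steps, and the remaining \<open>m\<close> steps add the last defect. Weighted by
  \<open>\<pi>\<close>, the likelihoods of \<phi> from any state sum to 1, so this last stage does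
  not enlarge the offset.\<close>

lemma l1_dist_le:
  assumes \<pi>: "\<pi> \<in> policies nA nO H"
  shows "l1_dist nS nA nO \<phi> \<theta> \<pi> H \<le> \<kappa> * gap_l1 m [] + (\<Sum>h<Suc (H - m). exp_defect \<pi> h)"
proof -
  define h where "h = H - m"
  have H: "H = h + m" using m by (simp add: h_def)
  have "l1_dist nS nA nO \<phi> \<theta> \<pi> H = (\<Sum>\<tau>\<in>T h. pol_prob \<pi> [] \<tau> * (\<Sum>\<tau>2\<in>T m. pol_prob \<pi> \<tau> \<tau>2 * \<bar>gap \<tau> \<tau>2\<bar>))"
    unfolding H by (simp add: l1_dist_def sum_trajectories_add pol_prob_append gap_def sum_distrib_left mult.assoc)
  also have "\<dots> \<le> (\<Sum>\<tau>\<in>T h. pol_prob \<pi> [] \<tau> * (l1 nS (offset \<tau>) + defect_l1 h (state \<theta> \<tau>)))"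
  proof (intro sum_mono mult_left_mono)
    fix \<tau> assume \<tau>: "\<tau> \<in> T h"
    then have len: "length \<tau> = h" by (rule length_trajectories)
    have ne: "\<tau>2 \<noteq> []" if "\<tau>2 \<in> T m" for \<tau>2 using that m by auto
    have "(\<Sum>\<tau>2\<in>T m. pol_prob \<pi> \<tau> \<tau>2 * \<bar>gap \<tau> \<tau>2\<bar>) \<le>
      (\<Sum>\<tau>2\<in>T m. (\<Sum>s<nS. \<bar>offset \<tau> s\<bar> * (pol_prob \<pi> \<tau> \<tau>2 * obs_lik nS \<phi> (Suc h) s \<tau>2)) + \<bar>defect h (Inr \<tau>2) (state \<theta> \<tau>)\<bar>)"
    proof (intro sum_mono)
      fix \<tau>2 assume \<tau>2: "\<tau>2 \<in> T m"
      have "\<bar>gap \<tau> \<tau>2\<bar> \<le> (\<Sum>s<nS. \<bar>offset \<tau> s\<bar> * obs_lik nS \<phi> (Suc h) s \<tau>2) + \<bar>defect h (Inr \<tau>2) (state \<theta> \<tau>)\<bar>"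
        unfolding gap_eq[OF ne[OF \<tau>2]] len
        by (intro order_trans[OF abs_triangle_ineq] add_right_mono order_trans[OF sum_abs]) (simp add: abs_mult)
      then have "pol_prob \<pi> \<tau> \<tau>2 * \<bar>gap \<tau> \<tau>2\<bar> \<le> pol_prob \<pi> \<tau> \<tau>2 *
        ((\<Sum>s<nS. \<bar>offset \<tau> s\<bar> * obs_lik nS \<phi> (Suc h) s \<tau>2) + \<bar>defect h (Inr \<tau>2) (state \<theta> \<tau>)\<bar>)"
        by (rule mult_left_mono) simp
      also have "\<dots> \<le> pol_prob \<pi> \<tau> \<tau>2 * (\<Sum>s<nS. \<bar>offset \<tau> s\<bar> * obs_lik nS \<phi> (Suc h) s \<tau>2) + \<bar>defect h (Inr \<tau>2) (state \<theta> \<tau>)\<bar>"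
        unfolding distrib_left by (intro add_left_mono mult_left_le_one_le) (auto simp: pol_prob_le_1)
      finally show "pol_prob \<pi> \<tau> \<tau>2 * \<bar>gap \<tau> \<tau>2\<bar> \<le>
        (\<Sum>s<nS. \<bar>offset \<tau> s\<bar> * (pol_prob \<pi> \<tau> \<tau>2 * obs_lik nS \<phi> (Suc h) s \<tau>2)) + \<bar>defect h (Inr \<tau>2) (state \<theta> \<tau>)\<bar>"
        by (simp add: sum_distrib_left mult_ac)
    qed
    also have "\<dots> = (\<Sum>s<nS. \<bar>offset \<tau> s\<bar> * (\<Sum>\<tau>2\<in>T m. pol_prob \<pi> \<tau> \<tau>2 * obs_lik nS \<phi> (Suc h) s \<tau>2)) +
        (\<Sum>\<tau>2\<in>T m. \<bar>defect h (Inr \<tau>2) (state \<theta> \<tau>)\<bar>)"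
      unfolding sum.distrib sum_distrib_left by (subst sum.swap) simp
    also have "(\<Sum>s<nS. \<bar>offset \<tau> s\<bar> * (\<Sum>\<tau>2\<in>T m. pol_prob \<pi> \<tau> \<tau>2 * obs_lik nS \<phi> (Suc h) s \<tau>2)) = l1 nS (offset \<tau>)"
      using pol_prob_obs_lik_total[OF \<phi> \<pi> _ \<tau>, of _ m] H by (intro sum.cong refl) simp
    also have "(\<Sum>\<tau>2\<in>T m. \<bar>defect h (Inr \<tau>2) (state \<theta> \<tau>)\<bar>) = defect_l1 h (state \<theta> \<tau>)"
      by (simp add: sum_components h_def)
    finally show "(\<Sum>\<tau>2\<in>T m. pol_prob \<pi> \<tau> \<tau>2 * \<bar>gap \<tau> \<tau>2\<bar>) \<le>
      l1 nS (offset \<tau>) + defect_l1 h (state \<theta> \<tau>)" .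
  qed simp
  also have "\<dots> = exp_offset \<pi> h + exp_defect \<pi> h" by (simp add: exp_offset_def exp_defect_def distrib_left sum.distrib)
  also have "\<dots> \<le> \<kappa> * gap_l1 m [] + (\<Sum>h<Suc (H - m). exp_defect \<pi> h)"
    using exp_offset_le[OF \<pi>, of h] exp_offset_0[of \<pi>] by (simp add: h_def)
  finally show ?thesis .
qed

text \<open>The initial gap depends on no policy, and the fully uniform episode \<open>h = 0\<close>
  of every iteration measures it.\<close>

lemma gap_Nil_le: assumes \<pi>: "\<pi> \<in> policies nA nO H"
  shows "gap_l1 m [] \<le> real nA ^ m * data_dist \<pi> 0"
  using gap_data[OF \<pi> m(1), of 0] m by simp

lemma gap_Nil_bound: assumes \<pi>: "\<pi> \<in> policies nA nO H"
  shows "gap_l1 m [] \<le> 2 * real nA ^ m"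
proof -
  have one: "l1 nS (pmf (init \<psi>)) = 1" if "\<psi> \<in> params nS nA nO H" for \<psi>
    using init_supp[OF that] sum_pmf_eq_1[of "{..<nS}" "init \<psi>"] by simp
  have h: "1 \<le> (1 :: nat)" "1 \<le> H - m + 1" by auto
  have "gap_l1 m [] \<le> (\<Sum>\<tau>2\<in>T m. \<bar>\<Sum>s<nS. pmf (init \<phi>) s * obs_lik nS \<phi> 1 s \<tau>2\<bar>) +
      (\<Sum>\<tau>2\<in>T m. \<bar>\<Sum>s<nS. pmf (init \<theta>) s * obs_lik nS \<theta> 1 s \<tau>2\<bar>)"
    unfolding sum.distrib[symmetric] gap_def obs_prob_def append_Nil by (intro sum_mono abs_triangle_ineq4)
  also have "\<dots> \<le> real nA ^ m * 1 + real nA ^ m * 1"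
    using sum_obs_lik_l1[OF \<phi> \<pi> h, of "pmf (init \<phi>)"] sum_obs_lik_l1[OF \<theta> \<pi> h, of "pmf (init \<theta>)"]
    unfolding one[OF \<phi>] one[OF \<theta>] by (rule add_mono)
  finally show ?thesis by simp
qed

text \<open>Supplies the mass hypothesis of \<open>l1_eluder\<close>, uniformly in the exponentially
  many histories.\<close>

lemma state_mass:
  assumes \<pi>: "\<pi> \<in> policies nA nO H" and h: "h \<le> H - m"
  shows "(\<Sum>\<tau>\<in>T h. pol_prob \<pi> [] \<tau> * l1 nS (state \<theta> \<tau>)) \<le> 1"
proof -
  have "l1 nS (pmf (init \<theta>)) = 1"
    using init_supp[OF \<theta>] sum_pmf_eq_1[of "{..<nS}" "init \<theta>"] by simp
  then show ?thesis
    using belief_l1[OF \<theta> \<pi>, of "[]" 0 h "pmf (init \<theta>)"] h m by (simp add: state_def)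
qed

end

lemma model_pair_exists:
  assumes \<theta>: "\<theta> \<in> params nS nA nO H" and \<phi>: "\<phi> \<in> params nS nA nO H"
    and dims: "1 \<le> nS" "1 \<le> nA" "1 \<le> nO" and m: "1 \<le> m" "m \<le> H"
    and \<alpha>: "0 < \<alpha>" "\<alpha> \<le> min_singular_value nS nA nO H m \<phi>"
  shows "\<exists>N. model_pair nS nA nO H m \<theta> \<phi> N (real nS / \<alpha>)"
proof -
  have "\<exists>N. (\<forall>s<nS. \<forall>s'<nS. (\<Sum>\<tau>\<in>trajectories nA nO m. N s \<tau> * obs_lik nS \<phi> h s' \<tau>) = (if s = s' then 1 else 0)) \<and>
     (\<forall>x. (\<Sum>s<nS. \<bar>\<Sum>\<tau>\<in>trajectories nA nO m. N s \<tau> * x \<tau>\<bar>) \<le> real nS / \<alpha> * (\<Sum>\<tau>\<in>trajectories nA nO m. \<bar>x \<tau>\<bar>))"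
    if h: "1 \<le> h" "h \<le> H - m + 1" for h
    by (rule bounded_left_inverse[OF finite_trajectories \<alpha>(1) obs_lik_lower_bound[OF \<phi> dims(1,2) m \<alpha> h]])
  then have "\<forall>h. \<exists>N. 1 \<le> h \<and> h \<le> H - m + 1 \<longrightarrow>
     (\<forall>s<nS. \<forall>s'<nS. (\<Sum>\<tau>\<in>trajectories nA nO m. N s \<tau> * obs_lik nS \<phi> h s' \<tau>) = (if s = s' then 1 else 0)) \<and>
     (\<forall>x. (\<Sum>s<nS. \<bar>\<Sum>\<tau>\<in>trajectories nA nO m. N s \<tau> * x \<tau>\<bar>) \<le> real nS / \<alpha> * (\<Sum>\<tau>\<in>trajectories nA nO m. \<bar>x \<tau>\<bar>))"
    by blast
  from choice[OF this] obtain N where N: "\<forall>h. 1 \<le> h \<and> h \<le> H - m + 1 \<longrightarrow>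
     (\<forall>s<nS. \<forall>s'<nS. (\<Sum>\<tau>\<in>trajectories nA nO m. N h s \<tau> * obs_lik nS \<phi> h s' \<tau>) = (if s = s' then 1 else 0)) \<and>
     (\<forall>x. (\<Sum>s<nS. \<bar>\<Sum>\<tau>\<in>trajectories nA nO m. N h s \<tau> * x \<tau>\<bar>) \<le> real nS / \<alpha> * (\<Sum>\<tau>\<in>trajectories nA nO m. \<bar>x \<tau>\<bar>))" ..
  have "model_pair nS nA nO H m \<theta> \<phi> N (real nS / \<alpha>)"
  proof
    fix h s s' :: nat assume h: "1 \<le> h" "h \<le> H - m + 1" and s: "s < nS" "s' < nS"
    show "(\<Sum>\<tau>\<in>trajectories nA nO m. N h s \<tau> * obs_lik nS \<phi> h s' \<tau>) = (if s = s' then 1 else 0)"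
      using N h s by blast
  next
    fix h :: nat and x assume h: "1 \<le> h" "h \<le> H - m + 1"
    show "(\<Sum>s<nS. \<bar>\<Sum>\<tau>\<in>trajectories nA nO m. N h s \<tau> * x \<tau>\<bar>) \<le> real nS / \<alpha> * (\<Sum>\<tau>\<in>trajectories nA nO m. \<bar>x \<tau>\<bar>)"
      using N h by blast
  qed (use assms in auto)
  then show ?thesis by blast
qed

text \<open>For each \<open>h\<close> the eluder lemma is applied to the state vectors of \<theta>,
  weighted by the policy of the iteration, and to the defects of the model of the iteration; this
  gives the second summand. The first comes from the initial gaps, by an instance of dimension
  1.\<close>

lemma sum_l1_dist_le:
  assumes \<theta>: "\<theta> \<in> params nS nA nO H" and dims: "1 \<le> nS" "1 \<le> nA" "1 \<le> nO" and m: "1 \<le> m" "m \<le> H"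
    and \<alpha>: "0 < \<alpha>"
    and \<phi>: "\<And>t. t < k \<Longrightarrow> \<phi> t \<in> params nS nA nO H"
      "\<And>t. t < k \<Longrightarrow> \<alpha> \<le> min_singular_value nS nA nO H m (\<phi> t)"
    and \<pi>: "\<And>t. t < k \<Longrightarrow> \<pi> t \<in> policies nA nO H"
    and data: "\<And>t. t < k \<Longrightarrow> (\<Sum>j<t. \<Sum>h<Suc (H - m). (l1_dist nS nA nO (\<phi> t) \<theta> (then_uniform nA (\<pi> j) h) H)\<^sup>2) \<le> C"
    and C0: "0 \<le> C"
  defines "\<kappa> \<equiv> real nS / \<alpha>"
  defines "R \<equiv> 2 * (1 + \<kappa>) * (real nA ^ m)\<^sup>2"
  shows "(\<Sum>t<k. l1_dist nS nA nO (\<phi> t) \<theta> (\<pi> t) H) \<le>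
    \<kappa> * (real nA ^ m * ((4 + sqrt (real k * C)) * (2 * (1 + 2 * ln (1 + real k))))) +
    real (Suc (H - m)) * (R * ((2 * real nS + sqrt (real k * C)) * potential nS k))"
proof -
  have \<kappa>0: "0 \<le> \<kappa>" using \<alpha> by (simp add: \<kappa>_def)
  have R0: "0 \<le> R" using \<kappa>0 by (simp add: R_def)
  have "\<exists>N. \<forall>t<k. model_pair nS nA nO H m \<theta> (\<phi> t) (N t) \<kappa>"
    unfolding \<kappa>_def using model_pair_exists[OF \<theta> \<phi>(1) dims m \<alpha> \<phi>(2)] by metis
  then obtain N where mp: "\<And>t. t < k \<Longrightarrow> model_pair nS nA nO H m \<theta> (\<phi> t) (N t) \<kappa>" by blast
  define st where "st = model_pair.state nS"
  define cmp where "cmp = model_pair.components nS nA nO H m"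
  define F where "F h t l v = model_pair.defect nS nA nO m \<theta> (\<phi> t) (N t) h l v" for h t l v
  define ZZ where "ZZ h t j = (\<Sum>\<tau>\<in>trajectories nA nO h. pol_prob (\<pi> j) [] \<tau> * (\<Sum>l\<in>cmp h. \<bar>F h t l (st \<theta> \<tau>)\<bar>))" for h t j
  define D where "D h t j = l1_dist nS nA nO (\<phi> t) \<theta> (then_uniform nA (\<pi> j) h) H" for h t j
  define X where "X t = (\<Sum>\<tau>2\<in>trajectories nA nO m. \<bar>model_pair.gap nS \<theta> (\<phi> t) [] \<tau>2\<bar>)" for t
  have D0: "0 \<le> D h t j" for h t j by (simp add: D_def l1_dist_nonneg)
  have D2: "(\<Sum>j<t. (D h t j)\<^sup>2) \<le> C" if t: "t < k" and h: "h \<le> H - m" for t h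
  proof -
    have "(\<Sum>j<t. (D h t j)\<^sup>2) \<le> (\<Sum>j<t. \<Sum>h<Suc (H - m). (D h t j)\<^sup>2)"
      using h by (intro sum_mono member_le_sum[where f = "\<lambda>h. (D h t _)\<^sup>2"]) auto
    then show ?thesis using data[OF t] by (simp add: D_def)
  qed
  have scale: "(\<Sum>j<t. (u j)\<^sup>2) \<le> c\<^sup>2 * C"
    if t: "t < k" and h: "h \<le> H - m" and u: "\<And>j. j < t \<Longrightarrow> 0 \<le> u j \<and> u j \<le> c * D h t j" for t h u c
  proof -
    have "(\<Sum>j<t. (u j)\<^sup>2) \<le> (\<Sum>j<t. (c * D h t j)\<^sup>2)" using u by (intro sum_mono power_mono) auto
    also have "\<dots> = c\<^sup>2 * (\<Sum>j<t. (D h t j)\<^sup>2)" by (simp add: power_mult_distrib sum_distrib_left)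
    also have "\<dots> \<le> c\<^sup>2 * C" using D2[OF t h] by (intro mult_left_mono) auto
    finally show ?thesis .
  qed
  have Rdef: "model_pair.defect_const nA m \<kappa> = R" if "t < k" for t
    by (simp add: model_pair.defect_const_def[OF mp[OF that]] R_def)
  have Zsum: "(\<Sum>t<k. ZZ h t t) \<le> R * ((2 * real nS + sqrt (real k * C)) * potential nS k)"
    if h: "h \<le> H - m" for h
  proof -
    have "(\<Sum>t<k. ZZ h t t) \<le> (2 * (real nS * R) + sqrt (real k * (R\<^sup>2 * C))) * potential nS k"
      unfolding ZZ_def
    proof (rule l1_eluder)
      show "finite (trajectories nA nO h)" by simp
      fix t assume t: "t < k"
      interpret model_pair nS nA nO H m \<theta> "\<phi> t" "N t" \<kappa> by (rule mp[OF t])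
      show "linear_functional nS (F h t l)" if "l \<in> cmp h" for l
        using linear_functional_defect[of l h] that unfolding F_def[abs_def] cmp_def by simp
      show "(\<Sum>l\<in>cmp h. \<bar>F h t l v\<bar>) \<le> R * l1 nS v" for v
        using defect_bound[OF \<pi>[OF t] h, of v] unfolding F_def cmp_def Rdef[OF t] .
      show "(\<Sum>\<tau>\<in>trajectories nA nO h. pol_prob (\<pi> t) [] \<tau> * l1 nS (st \<theta> \<tau>)) \<le> 1"
        using state_mass[OF \<pi>[OF t] h] unfolding st_def .
      show "(\<Sum>j<t. (\<Sum>\<tau>\<in>trajectories nA nO h. pol_prob (\<pi> j) [] \<tau> * (\<Sum>l\<in>cmp h. \<bar>F h t l (st \<theta> \<tau>)\<bar>))\<^sup>2) \<le> R\<^sup>2 * C"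
      proof (rule scale[OF t h])
        fix j assume "j < t"
        then have j: "j < k" using t by simp
        show "0 \<le> (\<Sum>\<tau>\<in>trajectories nA nO h. pol_prob (\<pi> j) [] \<tau> * (\<Sum>l\<in>cmp h. \<bar>F h t l (st \<theta> \<tau>)\<bar>)) \<and>
          (\<Sum>\<tau>\<in>trajectories nA nO h. pol_prob (\<pi> j) [] \<tau> * (\<Sum>l\<in>cmp h. \<bar>F h t l (st \<theta> \<tau>)\<bar>)) \<le> R * D h t j"
          using exp_defect_le[OF \<pi>[OF j] h]
          unfolding exp_defect_def data_dist_def Rdef[OF t] F_def cmp_def st_def D_def by (auto intro!: sum_nonneg mult_nonneg_nonneg)
      qed
    qed (use R0 C0 in auto)
    also have "sqrt (real k * (R\<^sup>2 * C)) = R * sqrt (real k * C)" using R0 by (simp add: real_sqrt_mult)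
    finally show ?thesis by (simp add: algebra_simps)
  qed
  have Xsum: "(\<Sum>t<k. X t) \<le> real nA ^ m * ((4 + sqrt (real k * C)) * (2 * (1 + 2 * ln (1 + real k))))"
  proof -
    \<comment> \<open>The initial gap as the coefficient of a functional on a one-dimensional space,
      evaluated at the constant vector 1 in every iteration.\<close>
    define G where "G t l v = X t * (v (0 :: nat) :: real)" for t v and l :: unit
    have X0: "0 \<le> X t" for t unfolding X_def by (intro sum_nonneg) auto
    have "(\<Sum>t<k. \<Sum>i\<in>{()}. 1 * (\<Sum>l\<in>{()}. \<bar>G t l (\<lambda>_. 1)\<bar>)) \<le>
      (2 * (real 1 * (2 * real nA ^ m)) + sqrt (real k * ((real nA ^ m)\<^sup>2 * C))) * potential 1 k"
    proof (rule l1_eluder)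
      fix t assume t: "t < k"
      interpret model_pair nS nA nO H m \<theta> "\<phi> t" "N t" \<kappa> by (rule mp[OF t])
      show "linear_functional 1 (G t l)" for l
        unfolding G_def[abs_def] by (intro linear_functional_cmult linear_functional_coord) simp
      show "(\<Sum>l\<in>{()}. \<bar>G t l v\<bar>) \<le> 2 * real nA ^ m * (\<Sum>s<1. \<bar>v s\<bar>)" for v
        using mult_right_mono[OF gap_Nil_bound[OF \<pi>[OF t]], of "\<bar>v 0\<bar>"] X0[of t]
        by (simp add: G_def abs_mult X_def)
      show "(\<Sum>j<t. (\<Sum>i\<in>{()}. 1 * (\<Sum>l\<in>{()}. \<bar>G t l (\<lambda>_. 1)\<bar>))\<^sup>2) \<le> (real nA ^ m)\<^sup>2 * C"
      proof (rule scale[OF t])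
        fix j assume "j < t"
        then have j: "j < k" using t by simp
        show "0 \<le> (\<Sum>i\<in>{()}. 1 * (\<Sum>l\<in>{()}. \<bar>G t l (\<lambda>_. 1)\<bar>)) \<and>
          (\<Sum>i\<in>{()}. 1 * (\<Sum>l\<in>{()}. \<bar>G t l (\<lambda>_. 1)\<bar>)) \<le> real nA ^ m * D 0 t j"
          using gap_Nil_le[OF \<pi>[OF j]] X0[of t] by (simp add: G_def X_def D_def data_dist_def)
      qed simp
    qed (use C0 in auto)
    also have "sqrt (real k * ((real nA ^ m)\<^sup>2 * C)) = real nA ^ m * sqrt (real k * C)" by (simp add: real_sqrt_mult)
    finally show ?thesis using X0 by (simp add: G_def algebra_simps)
  qed
  have each: "l1_dist nS nA nO (\<phi> t) \<theta> (\<pi> t) H \<le> \<kappa> * X t + (\<Sum>h<Suc (H - m). ZZ h t t)" if t: "t < k" for t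
  proof -
    interpret model_pair nS nA nO H m \<theta> "\<phi> t" "N t" \<kappa> by (rule mp[OF t])
    show ?thesis using l1_dist_le[OF \<pi>[OF t]]
      unfolding X_def ZZ_def exp_defect_def F_def cmp_def st_def .
  qed
  have "(\<Sum>t<k. l1_dist nS nA nO (\<phi> t) \<theta> (\<pi> t) H) \<le> (\<Sum>t<k. \<kappa> * X t + (\<Sum>h<Suc (H - m). ZZ h t t))"
    using each by (intro sum_mono) auto
  also have "\<dots> = \<kappa> * (\<Sum>t<k. X t) + (\<Sum>h<Suc (H - m). \<Sum>t<k. ZZ h t t)"
    unfolding sum.distrib sum_distrib_left by (subst (2) sum.swap) simp
  also have "\<dots> \<le> \<kappa> * (real nA ^ m * ((4 + sqrt (real k * C)) * (2 * (1 + 2 * ln (1 + real k))))) +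
    (\<Sum>h<Suc (H - m). R * ((2 * real nS + sqrt (real k * C)) * potential nS k))"
    using Xsum Zsum \<kappa>0 by (intro add_mono mult_left_mono sum_mono) auto
  finally show ?thesis by simp
qed

section \<open>Constants\<close>

lemma policy_value_one_observation:
  assumes \<theta>: "\<theta> \<in> params nS nA 1 H" and \<pi>: "\<pi> \<in> policies nA 1 H"
  shows "policy_value H r \<theta> \<pi> = (\<Sum>h=1..H. r h 0)"
proof -
  have "(\<Sum>h=1..H. r h (fst (\<tau> ! (h - 1)))) = (\<Sum>h=1..H. r h 0)" if \<tau>: "\<tau> \<in> trajectories nA 1 H" for \<tau>
  proof (intro sum.cong refl)
    fix h assume h: "h \<in> {1..H}"
    have "\<tau> ! (h - 1) \<in> set \<tau>" using \<tau> h by (intro nth_mem) (auto simp: trajectories_def)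
    then have "\<tau> ! (h - 1) \<in> {..<1} \<times> {..<nA}" using \<tau> by (auto simp: trajectories_def lists_eq_set)
    then show "r h (fst (\<tau> ! (h - 1))) = r h 0" by auto
  qed
  then have "policy_value H r \<theta> \<pi> = (\<Sum>\<tau>\<in>trajectories nA 1 H. pol_prob \<pi> [] \<tau> * obs_prob nS \<theta> \<tau> * (\<Sum>h=1..H. r h 0))"
    unfolding policy_value_eq[OF \<theta> \<pi>] by (intro sum.cong refl) simp
  also have "\<dots> = (\<Sum>\<tau>\<in>trajectories nA 1 H. pmf (trajectory_pmf H \<theta> \<pi>) \<tau>) * (\<Sum>h=1..H. r h 0)"
    unfolding sum_distrib_right using pmf_trajectory[OF \<theta>] by (intro sum.cong refl) simp
  finally show ?thesis using sum_trajectory_pmf[OF \<theta> \<pi>] by simp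
qed

lemma policies_nonempty: "1 \<le> nA \<Longrightarrow> policies nA nO H \<noteq> {}"
proof -
  assume "1 \<le> nA"
  then have "(\<lambda>_ _. return_pmf 0) \<in> policies nA nO H" by (auto simp: policies_def)
  then show ?thesis by blast
qed

text \<open>The resolution makes \<open>c = 1 + 1 / (3 * H\<^sup>2 * K)\<close>. With exponent
  \<open>3 * H\<close> per episode and at most \<open>K * H\<close> episodes, the accumulated factor
  is at most \<open>exp 1\<close>.\<close>

lemma rounding_constants:
  fixes H K d n :: nat
  assumes pos: "1 \<le> H" "1 \<le> K" "1 \<le> d" and n: "n \<le> K * H"
  defines "c \<equiv> 1 + real d / real (3 * H * H * K * d)"
  defines "E \<equiv> c ^ (3 * H)"
  shows "1 \<le> c" "1 \<le> E" "E ^ n \<le> exp 1" "8 * real n * (E - 1)\<^sup>2 \<le> 32"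
proof -
  define M where "M = 3 * H * H * K"
  have M: "1 \<le> M" using pos by (simp add: M_def)
  have c: "c = 1 + 1 / real M" using pos by (simp add: c_def M_def)
  show c1: "1 \<le> c" by (simp add: c)
  show E1: "1 \<le> E" unfolding E_def using c1 by (rule one_le_power)
  have ce: "c \<le> exp (1 / real M)" unfolding c by (rule exp_ge_add_one_self)
  have cp: "c ^ j \<le> exp (real j / real M)" for j
  proof -
    have "c ^ j \<le> exp (1 / real M) ^ j" using c1 by (intro power_mono ce) simp
    then show ?thesis by (simp flip: exp_of_nat_mult)
  qed
  have "3 * H * n \<le> M"
  proof -
    have "3 * H * n \<le> 3 * H * (K * H)" using n by (intro mult_left_mono) auto
    then show ?thesis by (simp add: M_def mult_ac)
  qed
  then have "real (3 * H * n) / real M \<le> 1" using M by (simp add: divide_le_eq_1 flip: of_nat_mult)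
  then have "exp (real (3 * H * n) / real M) \<le> exp 1" by simp
  then show "E ^ n \<le> exp 1" unfolding E_def power_mult[symmetric] using cp[of "3 * H * n"] by linarith
  \<comment> \<open>Since \<open>E \<le> exp y \<le> 1 + 2 * y\<close>, the squared error is at most
    \<open>4 * y\<^sup>2\<close>, and the number of episodes cancels one factor
    \<open>y\<close>.\<close>
  define y where "y = 1 / (real H * real K)"
  have HK: "1 \<le> real H * real K" using pos by (metis mult_mono of_nat_0_le_iff of_nat_1 of_nat_le_iff mult_1 zero_le_one)
  have y: "0 \<le> y" "y \<le> 1" using HK by (simp_all add: y_def)
  have "E \<le> exp y"
    using cp[of "3 * H"] pos by (simp add: E_def M_def y_def)
  also have "\<dots> \<le> 1 + y + y\<^sup>2" using y by (rule exp_bound)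
  also have "\<dots> \<le> 1 + 2 * y" using y by (simp add: power2_eq_square mult_left_le)
  finally have "E - 1 \<le> 2 * y" by simp
  then have "(E - 1)\<^sup>2 \<le> (2 * y)\<^sup>2" using E1 by (intro power_mono) auto
  then have "real n * (E - 1)\<^sup>2 \<le> (real H * real K) * (2 * y)\<^sup>2"
  proof (intro mult_mono)
    show "real n \<le> real H * real K" using n by (metis mult.commute of_nat_le_iff of_nat_mult)
  qed auto
  also have "\<dots> = 4 * y" using HK by (simp add: y_def power2_eq_square)
  also have "\<dots> \<le> 4" using y by simp
  finally show "8 * real n * (E - 1)\<^sup>2 \<le> 32" by simp
qed

abbreviation omle_\<beta> :: "nat \<Rightarrow> nat \<Rightarrow> nat \<Rightarrow> nat \<Rightarrow> nat \<Rightarrow> real \<Rightarrow> real" where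
  "omle_\<beta> nS nA nO H K \<delta> \<equiv> 26 * (real H * (real nS ^ 2 * real nA + real nS * real nO)
     * ln (real nS * real nA * real nO * real H * real K) + ln (real K * real H / \<delta>))"

text \<open>The origin of 26. With \<open>X\<close> the product of the five sizes and
  \<open>W\<close> the factor before the logarithm, the resolution satisfies
  \<open>N + 1 \<le> X ^ 6\<close> and there are at most \<open>2 * W\<close> table entries, so
  \<open>2 * ln (card G)\<close> is at most \<open>24 * W * ln X\<close>. The summand 1 is at most
  \<open>2 * W * ln X\<close>, which is where \<open>2 \<le> X\<close> is essential.\<close>

lemma cover_log_size:
  fixes nS nA nO H K :: nat and \<delta> \<beta> :: real
  assumes pos: "1 \<le> nS" "1 \<le> nA" "1 \<le> nO" "1 \<le> K" "1 \<le> H" and \<delta>: "0 < \<delta>" "\<delta> \<le> 1"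
    and X2: "2 \<le> nS * nA * nO * H * K"
  defines "G \<equiv> cover nS nA nO H (3 * H * H * K * (nS + nO))"
  assumes \<beta>: "\<beta> = omle_\<beta> nS nA nO H K \<delta>"
  shows "1 + 2 * ln (real (card G) * real K / \<delta>) \<le> \<beta>" "1 \<le> real (card G) * real K / \<delta>"
proof -
  define N where "N = 3 * H * H * K * (nS + nO)"
  define X where "X = nS * nA * nO * H * K"
  define W where "W = H * (nS ^ 2 * nA + nS * nO)"
  have cardG: "1 \<le> card G" unfolding G_def using cover_nonempty finite_cover by (simp add: Suc_le_eq card_gt_0_iff)
  have X8: "8 \<le> X ^ 3" using power_mono[OF X2, of 3] by (simp add: X_def)
  have le: "a \<le> a * b" if "1 \<le> b" for a b :: nat using that by simp
  have "N + 1 \<le> X ^ 6"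
  proof -
    have S: "nS \<le> X" and O: "nO \<le> X" and HHK: "H * H * K \<le> X * X"
    proof -
      have p: "1 \<le> nA * nO * H * K" "1 \<le> nS * nA * H * K" "1 \<le> nS * nA * nO" "1 \<le> nS * nA * nO * K"
        using pos by simp_all
      show "nS \<le> X" using le[OF p(1), of nS] by (simp add: X_def mult_ac)
      show "nO \<le> X" using le[OF p(2), of nO] by (simp add: X_def mult_ac)
      have "H * K \<le> X" using le[OF p(3), of "H * K"] by (simp add: X_def mult_ac)
      moreover have "H \<le> X" using le[OF p(4), of H] by (simp add: X_def mult_ac)
      ultimately show "H * H * K \<le> X * X" using mult_mono[of H X "H * K" X] by (simp add: mult_ac)
    qed
    have "N = 3 * (H * H * K) * (nS + nO)" by (simp add: N_def mult_ac)
    also have "\<dots> \<le> 3 * (X * X) * (X + X)"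
      by (rule mult_le_mono) (use S O HHK in auto)
    also have "\<dots> = 6 * X ^ 3" by (simp add: power3_eq_cube)
    finally have "N + 1 \<le> 6 * X ^ 3 + X ^ 3" using X8 by linarith
    also have "\<dots> \<le> 8 * X ^ 3" by simp
    also have "\<dots> \<le> X ^ 3 * X ^ 3" using X8 by (intro mult_right_mono) auto
    finally show ?thesis by (simp flip: power_add)
  qed
  then have "real (N + 1) \<le> real X ^ 6" by (metis of_nat_le_iff of_nat_power)
  then have "ln (real (N + 1)) \<le> ln (real X ^ 6)" by (intro ln_mono) auto
  then have lnN: "ln (real (N + 1)) \<le> 6 * ln (real X)" using X2 by (simp add: ln_realpow X_def)
  have idx: "card (code_index nS nA nO H) \<le> 2 * W"
  proof -
    have "nS \<le> H * nS * nO" using pos le[of "H * nO" nS] by (simp add: mult_ac)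
    then have "nS + H * nA * nS * nS + H * nS * nO \<le> H * nA * nS * nS + 2 * (H * nS * nO)" by linarith
    also have "\<dots> \<le> 2 * W" by (simp add: W_def power2_eq_square algebra_simps)
    finally show ?thesis using card_code_index[of nS nA nO H] by linarith
  qed
  have lnX: "1 / 2 \<le> ln (real X)"
  proof -
    have "1 / 2 \<le> ln (2 :: real)" using ln_le_minus_one[of "1 / 2 :: real"] by (simp add: ln_div)
    also have "\<dots> \<le> ln (real X)" using X2 by (intro ln_mono) (auto simp: X_def simp del: of_nat_mult)
    finally show ?thesis .
  qed
  have "1 \<le> nS * nO" using pos by simp
  then have "1 * 1 \<le> H * (nS ^ 2 * nA + nS * nO)" using pos by (intro mult_le_mono) linarith+
  then have W1: "1 \<le> W" by (simp add: W_def)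
  have "ln (real (card G)) \<le> ln (real ((N + 1) ^ card (code_index nS nA nO H)))"
    using cardG card_cover[of nS nA nO H N] unfolding G_def N_def by (intro ln_mono of_nat_mono) auto
  also have "\<dots> = real (card (code_index nS nA nO H)) * ln (real (N + 1))"
    by (simp only: of_nat_power) (subst ln_realpow, auto)
  also have "\<dots> \<le> real (2 * W) * (6 * ln (real X))"
    using idx lnN by (intro mult_mono) (auto simp del: of_nat_mult)
  finally have lnG: "ln (real (card G)) \<le> 12 * (real W * ln (real X))" by simp
  have K\<delta>: "real K \<le> real K / \<delta>" using \<delta> pos by (simp add: field_simps mult_left_le)
  have K1: "1 \<le> real K" using pos by simp
  have a: "real (card G) * real K / \<delta> = real (card G) * (real K / \<delta>)" by simp
  have "1 * 1 \<le> real (card G) * (real K / \<delta>)" using cardG K\<delta> K1 by (intro mult_mono) auto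
  then show "1 \<le> real (card G) * real K / \<delta>" by simp
  have lna: "ln (real (card G) * real K / \<delta>) = ln (real (card G)) + ln (real K / \<delta>)"
    unfolding a using cardG K\<delta> K1 by (intro ln_mult_pos) auto
  have "real K / \<delta> \<le> real K * real H / \<delta>" using \<delta> pos by (intro divide_right_mono) auto
  then have lnK: "ln (real K / \<delta>) \<le> ln (real K * real H / \<delta>)" using K\<delta> K1 by (intro ln_mono) auto
  have lnK0: "0 \<le> ln (real K / \<delta>)" using K\<delta> K1 by simp
  have "1 / 2 * 1 \<le> ln (real X) * real W" using lnX W1 by (intro mult_mono) auto
  then have one: "1 \<le> 2 * (real W * ln (real X))" by (simp add: mult.commute)
  have "\<beta> = 26 * (real W * ln (real X) + ln (real K * real H / \<delta>))"
    unfolding \<beta> W_def X_def by simp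
  then show "1 + 2 * ln (real (card G) * real K / \<delta>) \<le> \<beta>"
    unfolding lna using lnG lnK lnK0 one by argo
qed

text \<open>The arguments stand for \<open>nS\<close>, \<open>nA ^ m\<close>, \<open>nO\<close>,
  \<open>H\<close>, \<open>1 / \<alpha>\<close> and \<open>ln (K / \<delta>)\<close>.
  \<open>C\<close> is a polynomial bound for \<open>16 * \<beta> + 32\<close>: logarithms of sizes
  are replaced by the sizes, and \<open>ln K\<close> by \<open>l\<close>. The root of
  \<open>C\<close> is avoided by \<open>sqrt C \<le> 1 + C\<close>.\<close>

definition regret_poly :: "real \<Rightarrow> real \<Rightarrow> real \<Rightarrow> real \<Rightarrow> real \<Rightarrow> real \<Rightarrow> real" where
  "regret_poly S a b H i l =
     (let \<kappa> = S * i; C = 16 * (26 * (H * (S\<^sup>2 * a + S * b) * (S + a + b + H + l) + (l + H))) + 32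
      in H * (\<kappa> * (a * ((5 + C) * (2 * (3 + 2 * l)))) +
         H * (2 * (1 + \<kappa>) * a\<^sup>2 * ((2 * S + 1 + C) * (2 * (S\<^sup>2 + 2 * S * (1 + l)))))))"

lemma regret_poly_nonneg:
  assumes "0 \<le> S" "0 \<le> a" "0 \<le> b" "0 \<le> H" "0 \<le> i" "0 \<le> l"
  shows "0 \<le> regret_poly S a b H i l"
  using assms unfolding regret_poly_def Let_def by (intro mult_nonneg_nonneg add_nonneg_nonneg) auto

lemma regret_poly_polynomial:
  "real_polynomial_function (\<lambda>(S, a, b, H, i, l). regret_poly S a b H i l)"
proof -
  have lin: "real_polynomial_function (\<lambda>x :: real \<times> real \<times> real \<times> real \<times> real \<times> real. fst x)"
    "real_polynomial_function (\<lambda>x :: real \<times> real \<times> real \<times> real \<times> real \<times> real. fst (snd x))"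
    "real_polynomial_function (\<lambda>x :: real \<times> real \<times> real \<times> real \<times> real \<times> real. fst (snd (snd x)))"
    "real_polynomial_function (\<lambda>x :: real \<times> real \<times> real \<times> real \<times> real \<times> real. fst (snd (snd (snd x))))"
    "real_polynomial_function (\<lambda>x :: real \<times> real \<times> real \<times> real \<times> real \<times> real. fst (snd (snd (snd (snd x)))))"
    "real_polynomial_function (\<lambda>x :: real \<times> real \<times> real \<times> real \<times> real \<times> real. snd (snd (snd (snd (snd x)))))"
    by (intro real_polynomial_function.intros(1) bounded_linear_fst_comp bounded_linear_snd_comp bounded_linear_ident)+
  show ?thesis
    unfolding case_prod_unfold regret_poly_def Let_def
    by (intro real_polynomial_function.intros(2-4) real_polynomial_function_power lin)
qed

lemma regret_poly_bound:
  fixes nS nA nO H K k m :: nat and \<delta> \<alpha> \<beta> C :: real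
  assumes pos: "1 \<le> nS" "1 \<le> nA" "1 \<le> nO" "1 \<le> K" "1 \<le> H" and \<delta>: "0 < \<delta>" "\<delta> \<le> 1"
    and m: "1 \<le> m" "m \<le> H" and \<alpha>: "0 < \<alpha>" and k: "1 \<le> k" "k \<le> K"
    and \<beta>: "\<beta> = omle_\<beta> nS nA nO H K \<delta>"
    and C: "C = 16 * \<beta> + 32"
  defines "\<kappa> \<equiv> real nS / \<alpha>"
  shows "0 \<le> C"
    "real H * (\<kappa> * (real nA ^ m * ((4 + sqrt (real k * C)) * (2 * (1 + 2 * ln (1 + real k))))) +
      real (Suc (H - m)) * (2 * (1 + \<kappa>) * (real nA ^ m)\<^sup>2 *
        ((2 * real nS + sqrt (real k * C)) * potential nS k)))
     \<le> regret_poly (real nS) (real nA ^ m) (real nO) (real H) (1 / \<alpha>) (ln (real K / \<delta>)) * sqrt (real k)"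
proof -
  define l where "l = ln (real K / \<delta>)"
  define a where "a = real nA ^ m"
  define S where "S = real nS"
  define b where "b = real nO"
  define h where "h = real H"
  define q where "q = sqrt (real k)"
  have Aa: "real nA \<le> a" unfolding a_def using pos m by (intro self_le_power) auto
  have p1: "1 \<le> S" "1 \<le> a" "1 \<le> b" "1 \<le> h" "1 \<le> real nA" using pos Aa by (auto simp: S_def b_def h_def)
  have K1: "1 \<le> real K" using pos by simp
  have K\<delta>: "real K \<le> real K / \<delta>" using \<delta> pos by (simp add: field_simps mult_left_le)
  have lnK: "ln (real K) \<le> l" unfolding l_def using K1 K\<delta> by (intro ln_mono) auto
  have l0: "0 \<le> l" using lnK K1 ln_ge_zero[of "real K"] by linarith
  have q1: "1 \<le> q" using k by (simp add: q_def)
  have \<kappa>: "\<kappa> = S * (1 / \<alpha>)" "0 \<le> \<kappa>" using \<alpha> by (simp_all add: \<kappa>_def S_def)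
  have lnk: "ln (1 + real k) \<le> 1 + l"
  proof -
    have "ln (1 + real k) \<le> ln (2 * real K)" using k by (intro ln_mono) auto
    also have "\<dots> = ln 2 + ln (real K)" using K1 by (simp add: ln_mult)
    also have "\<dots> \<le> 1 + l" using lnK ln_2_less_1 by simp
    finally show ?thesis .
  qed
  have lnk0: "0 \<le> ln (1 + real k)" by simp
  have lnle: "ln x \<le> x" if "1 \<le> x" for x :: real using ln_le_minus_one[of x] that by linarith
  have lnX: "ln (S * real nA * b * h * real K) \<le> S + a + b + h + l"
  proof -
    have "ln (S * real nA * b * h * real K) = ln S + ln (real nA) + ln b + ln h + ln (real K)"
      using p1 K1 by (simp add: ln_mult)
    also have "\<dots> \<le> S + a + b + h + l"
      using lnle[of S] lnle[of "real nA"] lnle[of b] lnle[of h] p1 lnK Aa by linarith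
    finally show ?thesis .
  qed
  have lnX0: "0 \<le> ln (S * real nA * b * h * real K)"
  proof -
    have "1 \<le> nS * nA * nO * H * K" using pos by simp
    then have "real 1 \<le> real (nS * nA * nO * H * K)" by (rule of_nat_mono)
    then show ?thesis by (simp add: S_def b_def h_def)
  qed
  have lnKH: "ln (real K * h / \<delta>) \<le> l + h" "0 \<le> ln (real K * h / \<delta>)"
  proof -
    have "ln (real K * h / \<delta>) = ln (real K / \<delta> * h)" by simp
    also have "\<dots> = l + ln h" unfolding l_def using p1 K1 \<delta> by (intro ln_mult_pos) auto
    finally have e: "ln (real K * h / \<delta>) = l + ln h" .
    show "ln (real K * h / \<delta>) \<le> l + h" "0 \<le> ln (real K * h / \<delta>)"
      unfolding e using lnle[of h] p1 l0 by simp_all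
  qed
  have \<beta>0: "0 \<le> \<beta>" unfolding \<beta> using lnX0 lnKH(2) by (simp add: S_def b_def h_def)
  then show C0: "0 \<le> C" by (simp add: C)
  define C' where "C' = 16 * (26 * (h * (S\<^sup>2 * a + S * b) * (S + a + b + h + l) + (l + h))) + 32"
  have CC: "C \<le> C'"
  proof -
    have "h * (S\<^sup>2 * real nA + S * b) * ln (S * real nA * b * h * real K) \<le> h * (S\<^sup>2 * a + S * b) * (S + a + b + h + l)"
      using Aa p1 l0 lnX lnX0 by (intro mult_mono add_mono order_refl) auto
    then show ?thesis using lnKH(1) unfolding C \<beta> C'_def by (simp add: S_def b_def h_def)
  qed
  have sq: "sqrt (real k * C) \<le> q * (1 + C')"
  proof -
    have "sqrt C \<le> 1 + C"
    proof (rule real_le_lsqrt)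
      show "C \<le> (1 + C)\<^sup>2" using C0 by (simp add: power2_eq_square algebra_simps)
    qed (use C0 in auto)
    then have "q * sqrt C \<le> q * (1 + C')" using CC q1 by (intro mult_left_mono) auto
    then show ?thesis by (simp add: q_def real_sqrt_mult)
  qed
  have sq0: "0 \<le> sqrt (real k * C)" using C0 by simp
  have C'0: "0 \<le> C'" using C0 CC by linarith
  have A: "(4 + sqrt (real k * C)) * (2 * (1 + 2 * ln (1 + real k))) \<le> ((5 + C') * (2 * (3 + 2 * l))) * q"
  proof -
    have "4 + sqrt (real k * C) \<le> (5 + C') * q" using sq q1 by (simp add: algebra_simps)
    moreover have "2 * (1 + 2 * ln (1 + real k)) \<le> 2 * (3 + 2 * l)" using lnk by simp
    ultimately have "(4 + sqrt (real k * C)) * (2 * (1 + 2 * ln (1 + real k))) \<le> ((5 + C') * q) * (2 * (3 + 2 * l))"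
      using sq0 lnk0 q1 C'0 by (intro mult_mono) auto
    then show ?thesis by (simp add: mult_ac)
  qed
  have B: "(2 * S + sqrt (real k * C)) * (2 * (S\<^sup>2 + 2 * S * ln (1 + real k))) \<le>
     ((2 * S + 1 + C') * (2 * (S\<^sup>2 + 2 * S * (1 + l)))) * q"
  proof -
    have "2 * S * 1 \<le> 2 * S * q" using p1 q1 by (intro mult_left_mono) auto
    then have "2 * S + sqrt (real k * C) \<le> (2 * S + 1 + C') * q" using sq by (simp add: algebra_simps)
    moreover have "2 * (S\<^sup>2 + 2 * S * ln (1 + real k)) \<le> 2 * (S\<^sup>2 + 2 * S * (1 + l))"
      using lnk p1 by (intro mult_left_mono add_left_mono) auto
    ultimately have "(2 * S + sqrt (real k * C)) * (2 * (S\<^sup>2 + 2 * S * ln (1 + real k))) \<le>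
      ((2 * S + 1 + C') * q) * (2 * (S\<^sup>2 + 2 * S * (1 + l)))"
      using sq0 lnk0 q1 C'0 p1 by (intro mult_mono) (auto intro!: add_nonneg_nonneg mult_nonneg_nonneg)
    then show ?thesis by (simp add: mult_ac)
  qed
  have Hm: "real (Suc (H - m)) \<le> h" using m by (simp add: h_def)
  have R0: "0 \<le> 2 * (1 + \<kappa>) * a\<^sup>2" using \<kappa> by simp
  have B0: "0 \<le> (2 * S + 1 + C') * (2 * (S\<^sup>2 + 2 * S * (1 + l))) * q"
    using p1 C'0 l0 q1 by (intro mult_nonneg_nonneg add_nonneg_nonneg) auto
  have 1: "\<kappa> * (a * ((4 + sqrt (real k * C)) * (2 * (1 + 2 * ln (1 + real k))))) \<le> \<kappa> * (a * (((5 + C') * (2 * (3 + 2 * l))) * q))"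
    using A \<kappa> p1 by (intro mult_left_mono) auto
  have 2: "real (Suc (H - m)) * (2 * (1 + \<kappa>) * a\<^sup>2 * ((2 * S + sqrt (real k * C)) * (2 * (S\<^sup>2 + 2 * S * ln (1 + real k))))) \<le>
     h * (2 * (1 + \<kappa>) * a\<^sup>2 * (((2 * S + 1 + C') * (2 * (S\<^sup>2 + 2 * S * (1 + l)))) * q))"
  proof -
    have "2 * (1 + \<kappa>) * a\<^sup>2 * ((2 * S + sqrt (real k * C)) * (2 * (S\<^sup>2 + 2 * S * ln (1 + real k)))) \<le>
      2 * (1 + \<kappa>) * a\<^sup>2 * (((2 * S + 1 + C') * (2 * (S\<^sup>2 + 2 * S * (1 + l)))) * q)" (is "?u \<le> ?v")
      by (rule mult_left_mono[OF B R0])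
    then have "real (Suc (H - m)) * ?u \<le> real (Suc (H - m)) * ?v" by (rule mult_left_mono) simp
    also have "\<dots> \<le> h * ?v" by (rule mult_right_mono[OF Hm mult_nonneg_nonneg[OF R0 B0]])
    finally show ?thesis .
  qed
  have "h * (\<kappa> * (a * ((4 + sqrt (real k * C)) * (2 * (1 + 2 * ln (1 + real k))))) +
      real (Suc (H - m)) * (2 * (1 + \<kappa>) * a\<^sup>2 * ((2 * S + sqrt (real k * C)) * (2 * (S\<^sup>2 + 2 * S * ln (1 + real k))))))
    \<le> h * (\<kappa> * (a * (((5 + C') * (2 * (3 + 2 * l))) * q)) +
      h * (2 * (1 + \<kappa>) * a\<^sup>2 * (((2 * S + 1 + C') * (2 * (S\<^sup>2 + 2 * S * (1 + l)))) * q)))"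
    by (rule mult_left_mono[OF add_mono[OF 1 2]]) (use p1 in simp)
  also have "\<dots> = regret_poly S a b h (1 / \<alpha>) l * q"
    unfolding regret_poly_def Let_def C'_def[symmetric] \<kappa>(1)[symmetric]
    by (simp only: distrib_left distrib_right mult_ac)
  finally show "real H * (\<kappa> * (real nA ^ m * ((4 + sqrt (real k * C)) * (2 * (1 + 2 * ln (1 + real k))))) +
      real (Suc (H - m)) * (2 * (1 + \<kappa>) * (real nA ^ m)\<^sup>2 *
        ((2 * real nS + sqrt (real k * C)) * potential nS k)))
     \<le> regret_poly (real nS) (real nA ^ m) (real nO) (real H) (1 / \<alpha>) (ln (real K / \<delta>)) * sqrt (real k)"
    unfolding S_def a_def b_def h_def l_def q_def .
qed

section \<open>The regret bound\<close>

lemma prob_ge_of_bad_event: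
  assumes bad: "measure_pmf.prob p B \<le> \<delta>" and good: "\<And>x. x \<in> set_pmf p \<Longrightarrow> x \<notin> B \<Longrightarrow> x \<in> A"
  shows "1 - \<delta> \<le> measure_pmf.prob p A"
proof -
  have "1 - measure_pmf.prob p B = measure_pmf.prob p (space (measure_pmf p) - B)"
    by (rule measure_pmf.prob_compl[symmetric]) simp
  also have "\<dots> = measure_pmf.prob p (space (measure_pmf p) - B \<inter> UNIV)" by simp
  also have "\<dots> \<le> measure_pmf.prob p A"
    by (rule measure_pmf.finite_measure_mono_AE) (use good in \<open>auto simp: AE_measure_pmf_iff\<close>)
  finally show ?thesis using bad by linarith
qed

lemma sum_list_take_blocks:
  fixes f :: "'a \<Rightarrow> real"
  assumes "t * L \<le> length D"
  shows "(\<Sum>p\<leftarrow>take (t * L) D. f p) = (\<Sum>j<t. \<Sum>h<L. f (D ! (j * L + h)))"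
proof -
  have "(\<Sum>p\<leftarrow>take (t * L) D. f p) = (\<Sum>i<t * L. f (D ! i))"
    using assms by (simp add: sum_list_sum_nth lessThan_atLeast0 min_absorb2)
  then show ?thesis unfolding sum_blocks .
qed

text \<open>The likelihood bound puts \<theta> into the confidence set, so \<theta> with any policy
  competes in the planner's maximization. The guard \<open>D \<noteq> []\<close> mirrors the first
  iteration, whose confidence set has no likelihood constraint.\<close>

lemma optimistic_step:
  assumes plan: "optimistic_planner nS nA nO H r m \<alpha> \<beta> select"
    and D: "D \<in> datasets nA nO H"
    and \<theta>: "\<theta> \<in> params nS nA nO H" "\<alpha> \<le> min_singular_value nS nA nO H m \<theta>" and nA: "1 \<le> nA"
    and le: "\<And>\<phi>. \<phi> \<in> params nS nA nO H \<Longrightarrow> log_likelihood H D \<phi> \<le> log_likelihood H D \<theta> + ereal \<beta>"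
  shows "fst (select D) \<in> params nS nA nO H" "snd (select D) \<in> policies nA nO H"
    "\<alpha> \<le> min_singular_value nS nA nO H m (fst (select D))"
    "D \<noteq> [] \<Longrightarrow> log_likelihood H D \<theta> - ereal \<beta> \<le> log_likelihood H D (fst (select D))"
    "optimal_value nA nO H r \<theta> \<le> policy_value H r (fst (select D)) (snd (select D))"
proof -
  let ?B = "confidence_set nS nA nO H m \<alpha> \<beta> D"
  have "(SUP \<theta>'\<in>params nS nA nO H. log_likelihood H D \<theta>') \<le> log_likelihood H D \<theta> + ereal \<beta>"
    by (rule SUP_least) (rule le)
  then have "(SUP \<theta>'\<in>params nS nA nO H. log_likelihood H D \<theta>') - ereal \<beta> \<le> log_likelihood H D \<theta>"
    by (subst ereal_minus_le) auto
  then have \<theta>B: "\<theta> \<in> ?B" using \<theta> by (simp add: confidence_set_def)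
  have max: "is_arg_max (\<lambda>(\<theta>, \<pi>). policy_value H r \<theta> \<pi>) (\<lambda>x. x \<in> ?B \<times> policies nA nO H) (select D)"
    using plan D \<theta>B unfolding optimistic_planner_def by blast
  then have in_set: "fst (select D) \<in> ?B" "snd (select D) \<in> policies nA nO H"
    unfolding is_arg_max_def by (auto simp: mem_Times_iff)
  then show "fst (select D) \<in> params nS nA nO H" "snd (select D) \<in> policies nA nO H"
    "\<alpha> \<le> min_singular_value nS nA nO H m (fst (select D))"
    by (simp_all add: confidence_set_def)
  show "log_likelihood H D \<theta> - ereal \<beta> \<le> log_likelihood H D (fst (select D))" if "D \<noteq> []"
  proof -
    have "log_likelihood H D \<theta> - ereal \<beta> \<le> (SUP \<theta>'\<in>params nS nA nO H. log_likelihood H D \<theta>') - ereal \<beta>"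
      using \<theta> by (intro ereal_minus_mono SUP_upper) auto
    also have "\<dots> \<le> log_likelihood H D (fst (select D))"
      using in_set(1) that by (simp add: confidence_set_def)
    finally show ?thesis .
  qed
  show "optimal_value nA nO H r \<theta> \<le> policy_value H r (fst (select D)) (snd (select D))"
    unfolding optimal_value_def
  proof (rule cSUP_least[OF policies_nonempty[OF nA]])
    fix \<pi> assume "\<pi> \<in> policies nA nO H"
    then have "(\<theta>, \<pi>) \<in> ?B \<times> policies nA nO H" using \<theta>B by simp
    then have "\<not> policy_value H r (fst (select D)) (snd (select D)) < policy_value H r \<theta> \<pi>"
      using max unfolding is_arg_max_def case_prod_unfold by fastforce
    then show "policy_value H r \<theta> \<pi> \<le> policy_value H r (fst (select D)) (snd (select D))" by simp
  qed
qed

text \<open>The deterministic half: a single run in the support that avoids the bad event. The proof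
  counts iterations from 0, so \<open>Dt t\<close> is the dataset that iteration \<open>t\<close>
  starts with.\<close>

lemma omle_regret:
  fixes \<delta> \<alpha> \<beta> :: real and nS nA nO K H m :: nat
  assumes \<delta>: "0 < \<delta>" "\<delta> \<le> 1" and pos: "1 \<le> nS" "1 \<le> nA" "1 \<le> nO" "1 \<le> K" "1 \<le> H"
    and m: "1 \<le> m" "m \<le> H" and \<alpha>: "0 < \<alpha>"
    and \<beta>: "\<beta> = omle_\<beta> nS nA nO H K \<delta>"
    and r: "\<forall>h\<in>{1..H}. \<forall>x<nO. 0 \<le> r h x \<and> r h x \<le> 1"
    and plan: "optimistic_planner nS nA nO H r m \<alpha> \<beta> select"
    and \<theta>: "\<theta> \<in> params nS nA nO H" and sv: "\<alpha> \<le> min_singular_value nS nA nO H m \<theta>"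
    and X2: "2 \<le> nS * nA * nO * H * K"
    and x: "x \<in> set_pmf (omle nA H m select \<theta> K)"
  defines "G \<equiv> cover nS nA nO H (3 * H * H * K * (nS + nO))"
  defines "L \<equiv> H - m + 1"
  assumes good: "\<And>k \<theta>'. k < K \<Longrightarrow> \<theta>' \<in> G \<Longrightarrow>
      prod_list (map (root_ratio nA nO H \<theta>' \<theta>) (take (k * L) (snd x))) \<le> real (card G) * real K / \<delta>"
    and k: "k \<in> {1..K}"
  shows "(\<Sum>t=1..k. optimal_value nA nO H r \<theta> - policy_value H r \<theta> (fst x ! (t - 1)))
    \<le> regret_poly (real nS) (real nA ^ m) (real nO) (real H) (1 / \<alpha>) (ln (real K / \<delta>)) * sqrt (real k)"
proof -
  define Dt where "Dt t = take (t * L) (snd x)" for t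
  define \<phi> where "\<phi> t = fst (select (Dt t))" for t
  define \<pi> where "\<pi> t = fst x ! t" for t
  define c where "c = 1 + real (nS + nO) / real (3 * H * H * K * (nS + nO))"
  define E where "E = c ^ (3 * H)"
  define C where "C = 16 * \<beta> + 32"
  have L1: "L = H - m + 1" "L = Suc (H - m)" by (simp_all add: L_def)
  have sel: "snd (select D) \<in> policies nA nO H" if "D \<in> datasets nA nO H" for D
    using plan that unfolding optimistic_planner_def by (auto simp: mem_Times_iff)
  note supp = omle_support[OF \<theta> pos(2) L1(1) sel x]
  have Dlists: "snd x \<in> datasets nA nO H" using supp by blast
  have lenD: "length (snd x) = K * L" using omle_prefix(2)[OF le_refl L1(1) x] by simp
  have \<pi>_eq: "\<pi> t = snd (select (Dt t))" if "t < K" for t using supp that by (simp add: \<pi>_def Dt_def)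
  have item: "\<exists>\<tau>\<in>set_pmf (trajectory_pmf H \<theta> (then_uniform nA (\<pi> j) h)).
      snd x ! (j * L + h) = (then_uniform nA (\<pi> j) h, \<tau>)" if "j < K" "h < L" for j h
    using supp that unfolding \<pi>_def by blast
  have Dtl: "Dt t \<in> datasets nA nO H" for t
    using Dlists set_take_subset[of "t * L" "snd x"] by (auto simp: Dt_def lists_eq_set)
  have Lpos: "0 < L" by (simp add: L_def)
  \<comment> \<open>Every recorded episode was drawn from \<theta> under the policy recorded with
    it, so likelihood ratios against \<theta> never divide by 0.\<close>
  have positive: "0 < likelihood H \<theta> (Dt t)" for t
  proof -
    have "0 < pmf (trajectory_pmf H \<theta> (fst p)) (snd p)" if p: "p \<in> set (snd x)" for p
    proof -
      obtain i where i: "i < K * L" "p = snd x ! i" using p lenD by (metis in_set_conv_nth)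
      have "i div L < K" "i mod L < L" using i Lpos by (simp_all add: less_mult_imp_div_less)
      from item[OF this] i(2) show ?thesis by (auto simp: pmf_positive)
    qed
    then have "\<forall>p\<in>set (Dt t). 0 < pmf (trajectory_pmf H \<theta> (fst p)) (snd p)"
      using set_take_subset[of "t * L" "snd x"] by (auto simp: Dt_def)
    moreover have "0 < likelihood H \<theta> D" if "\<forall>p\<in>set D. 0 < pmf (trajectory_pmf H \<theta> (fst p)) (snd p)" for D
      using that by (induction D) (auto simp: likelihood_def case_prod_unfold)
    ultimately show ?thesis by blast
  qed
  have cov: "\<exists>\<phi>'\<in>G \<inter> params nS nA nO H. \<forall>\<tau>\<in>trajectories nA nO H. obs_prob nS \<psi> \<tau> \<le> E * obs_prob nS \<phi>' \<tau>"
    if \<psi>: "\<psi> \<in> params nS nA nO H" for \<psi>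
  proof -
    have N: "1 \<le> 3 * H * H * K * (nS + nO)" using pos by simp
    obtain \<psi>' where "\<psi>' \<in> G" "\<psi>' \<in> params nS nA nO H" and dom: "dominates nS nA H c \<psi>' \<psi>"
      using cover_dominates[OF \<psi> N] unfolding G_def c_def by blast
    moreover have "obs_prob nS \<psi> \<tau> \<le> E * obs_prob nS \<psi>' \<tau>" if "\<tau> \<in> trajectories nA nO H" for \<tau>
      unfolding E_def
      by (rule dominates_obs_prob[OF dom _ that pos(5)]) (simp add: c_def)
    ultimately show ?thesis by blast
  qed
  have L_le: "L \<le> H" using m by (simp add: L_def)
  have lenDt: "length (Dt t) \<le> K * H" for t
  proof -
    have "length (Dt t) \<le> K * L" by (simp add: Dt_def lenD)
    also have "\<dots> \<le> K * H" using L_le by simp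
    finally show ?thesis .
  qed
  have sum1: "1 \<le> nS + nO" using pos by simp
  note rc = rounding_constants[OF pos(5,4) sum1 lenDt, folded c_def, folded E_def]
  have ln\<beta>: "1 + 2 * ln (real (card G) * real K / \<delta>) \<le> \<beta>" and a1: "1 \<le> real (card G) * real K / \<delta>"
    using cover_log_size[OF pos \<delta> X2 \<beta>] unfolding G_def by auto
  have ev: "prod_list (map (root_ratio nA nO H \<theta>' \<theta>) (Dt t)) \<le> real (card G) * real K / \<delta>"
    if "t < K" "\<theta>' \<in> G" for t \<theta>'
    using good[OF that] by (simp add: Dt_def)
  have lle: "log_likelihood H (Dt t) \<psi> \<le> log_likelihood H (Dt t) \<theta> + ereal \<beta>"
    if t: "t < K" and \<psi>: "\<psi> \<in> params nS nA nO H" for t \<psi>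
    by (rule likelihood_event(1)[OF \<theta> Dtl positive cov rc(2,3) ev[OF t] a1 ln\<beta> \<psi>])
  have l1_data: "(\<Sum>p\<leftarrow>Dt t. (l1_dist nS nA nO \<psi> \<theta> (fst p) H)\<^sup>2) \<le> 16 * \<beta> + 8 * real (length (Dt t)) * (E - 1)\<^sup>2"
    if t: "t < K" and \<psi>: "\<psi> \<in> params nS nA nO H"
      and ge: "log_likelihood H (Dt t) \<theta> - ereal \<beta> \<le> log_likelihood H (Dt t) \<psi>" for t \<psi>
    by (rule likelihood_event(2)[OF \<theta> Dtl positive cov rc(2,3) ev[OF t] a1 ln\<beta> \<psi> ge])
  note step = optimistic_step[OF plan Dtl \<theta> sv pos(2) lle, folded \<phi>_def]
  have \<pi>pol: "\<pi> t \<in> policies nA nO H" if "t < K" for t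
    unfolding \<pi>_eq[OF that] by (rule sel[OF Dtl])
  have data: "(\<Sum>j<t. \<Sum>h<Suc (H - m). (l1_dist nS nA nO (\<phi> t) \<theta> (then_uniform nA (\<pi> j) h) H)\<^sup>2) \<le> C"
    if t: "t < K" for t
  proof -
    have tL: "t * L \<le> length (snd x)" using t by (simp add: lenD)
    have "(\<Sum>j<t. \<Sum>h<L. (l1_dist nS nA nO (\<phi> t) \<theta> (then_uniform nA (\<pi> j) h) H)\<^sup>2) =
      (\<Sum>j<t. \<Sum>h<L. (l1_dist nS nA nO (\<phi> t) \<theta> (fst (snd x ! (j * L + h))) H)\<^sup>2)"
    proof (rule sum.cong[OF refl], rule sum.cong[OF refl])
      fix j h assume "j \<in> {..<t}" "h \<in> {..<L}"
      then have "fst (snd x ! (j * L + h)) = then_uniform nA (\<pi> j) h" using item[of j h] t by auto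
      then show "(l1_dist nS nA nO (\<phi> t) \<theta> (then_uniform nA (\<pi> j) h) H)\<^sup>2 =
        (l1_dist nS nA nO (\<phi> t) \<theta> (fst (snd x ! (j * L + h))) H)\<^sup>2" by simp
    qed
    also have "\<dots> = (\<Sum>p\<leftarrow>Dt t. (l1_dist nS nA nO (\<phi> t) \<theta> (fst p) H)\<^sup>2)"
      unfolding Dt_def by (rule sum_list_take_blocks[OF tL, symmetric])
    also have "\<dots> \<le> C"
    proof (cases "Dt t = []")
      case True
      have "0 \<le> C" using regret_poly_bound(1)[OF pos \<delta> m \<alpha> _ _ \<beta> C_def, of k] k by simp
      then show ?thesis by (simp add: True)
    next
      case False
      have "log_likelihood H (Dt t) \<theta> - ereal \<beta> \<le> log_likelihood H (Dt t) (\<phi> t)"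
        using step(4)[OF t _ False] by simp
      from l1_data[OF t step(1)[OF t] this] rc(4)[of t]
      show ?thesis unfolding C_def by simp
    qed
    finally show ?thesis unfolding L1(2) .
  qed
  have kK: "k \<le> K" "1 \<le> k" using k by auto
  have C0: "0 \<le> C" using regret_poly_bound(1)[OF pos \<delta> m \<alpha> kK(2,1) \<beta> C_def] .
  have reg: "optimal_value nA nO H r \<theta> - policy_value H r \<theta> (\<pi> t) \<le> real H * l1_dist nS nA nO (\<phi> t) \<theta> (\<pi> t) H"
    if t: "t < K" for t
  proof -
    have "optimal_value nA nO H r \<theta> \<le> policy_value H r (\<phi> t) (\<pi> t)"
      using step(5)[OF t] unfolding \<pi>_eq[OF t] .
    moreover have "\<bar>policy_value H r (\<phi> t) (\<pi> t) - policy_value H r \<theta> (\<pi> t)\<bar> \<le> real H * l1_dist nS nA nO (\<phi> t) \<theta> (\<pi> t) H"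
      by (rule policy_value_diff[OF step(1)[OF t] \<theta> \<pi>pol[OF t] r])
    ultimately show ?thesis by linarith
  qed
  have "(\<Sum>t=1..k. optimal_value nA nO H r \<theta> - policy_value H r \<theta> (fst x ! (t - 1))) =
    (\<Sum>t<k. optimal_value nA nO H r \<theta> - policy_value H r \<theta> (\<pi> t))"
    unfolding \<pi>_def using sum.shift_bounds_Suc_ivl[of "\<lambda>t. optimal_value nA nO H r \<theta> - policy_value H r \<theta> (fst x ! (t - 1))" 0 k]
    by (simp add: lessThan_atLeast0 atLeastLessThanSuc_atLeastAtMost)
  also have "\<dots> \<le> (\<Sum>t<k. real H * l1_dist nS nA nO (\<phi> t) \<theta> (\<pi> t) H)"
    using reg kK by (intro sum_mono) auto
  also have "\<dots> = real H * (\<Sum>t<k. l1_dist nS nA nO (\<phi> t) \<theta> (\<pi> t) H)" by (simp add: sum_distrib_left)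
  also have "\<dots> \<le> real H * (real nS / \<alpha> * (real nA ^ m * ((4 + sqrt (real k * C)) * (2 * (1 + 2 * ln (1 + real k))))) +
      real (Suc (H - m)) * (2 * (1 + real nS / \<alpha>) * (real nA ^ m)\<^sup>2 *
        ((2 * real nS + sqrt (real k * C)) * potential nS k)))"
  proof (rule mult_left_mono)
    show "(\<Sum>t<k. l1_dist nS nA nO (\<phi> t) \<theta> (\<pi> t) H) \<le>
      real nS / \<alpha> * (real nA ^ m * ((4 + sqrt (real k * C)) * (2 * (1 + 2 * ln (1 + real k))))) +
      real (Suc (H - m)) * (2 * (1 + real nS / \<alpha>) * (real nA ^ m)\<^sup>2 *
        ((2 * real nS + sqrt (real k * C)) * potential nS k))"
    proof (rule sum_l1_dist_le[OF \<theta> pos(1-3) m \<alpha> _ _ _ _ C0])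
      fix t assume "t < k"
      then have t: "t < K" using kK by simp
      show "\<phi> t \<in> params nS nA nO H" by (rule step(1)[OF t])
      show "\<alpha> \<le> min_singular_value nS nA nO H m (\<phi> t)" by (rule step(3)[OF t])
      show "\<pi> t \<in> policies nA nO H" by (rule \<pi>pol[OF t])
      show "(\<Sum>j<t. \<Sum>h<Suc (H - m). (l1_dist nS nA nO (\<phi> t) \<theta> (then_uniform nA (\<pi> j) h) H)\<^sup>2) \<le> C"
        by (rule data[OF t])
    qed
  qed simp
  also have "\<dots> \<le> regret_poly (real nS) (real nA ^ m) (real nO) (real H) (1 / \<alpha>) (ln (real K / \<delta>)) * sqrt (real k)"
    by (rule regret_poly_bound(2)[OF pos \<delta> m \<alpha> kK(2,1) \<beta> C_def])
  finally show ?thesis .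
qed

theorem theorem7:
  shows "\<exists>c>0::real. \<exists>p :: real \<times> real \<times> real \<times> real \<times> real \<times> real \<Rightarrow> real.
    real_polynomial_function p \<and>
    (\<forall>(\<delta>::real) (nS::nat) (nA::nat) (nO::nat) (K::nat) (H::nat) (m::nat) (\<alpha>::real) (\<beta>::real)
       (r :: nat \<Rightarrow> nat \<Rightarrow> real) (select :: dataset \<Rightarrow> param \<times> policy) (\<theta>::param).
       0 < \<delta> \<and> \<delta> \<le> 1 \<and>
       1 \<le> nS \<and> 1 \<le> nA \<and> 1 \<le> nO \<and> 1 \<le> K \<and> 1 \<le> H \<and>
       1 \<le> m \<and> m \<le> H \<and>
       0 < \<alpha> \<and>
       \<beta> = c * (real H * (real nS ^ 2 * real nA + real nS * real nO)
                    * ln (real nS * real nA * real nO * real H * real K)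
                  + ln (real K * real H / \<delta>)) \<and>
       (\<forall>h\<in>{1..H}. \<forall>x<nO. 0 \<le> r h x \<and> r h x \<le> 1) \<and>
       optimistic_planner nS nA nO H r m \<alpha> \<beta> select \<and>
       \<theta> \<in> params nS nA nO H \<and>
       min_singular_value nS nA nO H m \<theta> \<ge> \<alpha>
       \<longrightarrow>
       measure_pmf.prob (omle nA H m select \<theta> K)
         {(\<pi>s, D). \<forall>k\<in>{1..K}.
            (\<Sum>t=1..k. optimal_value nA nO H r \<theta> - policy_value H r \<theta> (\<pi>s ! (t - 1)))
            \<le> p (real nS, real nA ^ m, real nO, real H, 1 / \<alpha>, ln (real K / \<delta>)) * sqrt (real k)}
       \<ge> 1 - \<delta>)"
proof (intro exI conjI allI impI)
  show "(0 :: real) < 26" by simp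
  show "real_polynomial_function (\<lambda>(S, a, b, H, i, l). regret_poly S a b H i l)"
    by (rule regret_poly_polynomial)
  fix \<delta> :: real and nS nA nO K H m :: nat and \<alpha> \<beta> :: real and r :: "nat \<Rightarrow> nat \<Rightarrow> real"
    and select :: "dataset \<Rightarrow> param \<times> policy" and \<theta> :: param
  assume *: "0 < \<delta> \<and> \<delta> \<le> 1 \<and>
       1 \<le> nS \<and> 1 \<le> nA \<and> 1 \<le> nO \<and> 1 \<le> K \<and> 1 \<le> H \<and>
       1 \<le> m \<and> m \<le> H \<and>
       0 < \<alpha> \<and>
       \<beta> = 26 * (real H * (real nS ^ 2 * real nA + real nS * real nO)
                    * ln (real nS * real nA * real nO * real H * real K)
                  + ln (real K * real H / \<delta>)) \<and>
       (\<forall>h\<in>{1..H}. \<forall>x<nO. 0 \<le> r h x \<and> r h x \<le> 1) \<and>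
       optimistic_planner nS nA nO H r m \<alpha> \<beta> select \<and>
       \<theta> \<in> params nS nA nO H \<and>
       min_singular_value nS nA nO H m \<theta> \<ge> \<alpha>"
  then have \<delta>: "0 < \<delta>" "\<delta> \<le> 1" and pos: "1 \<le> nS" "1 \<le> nA" "1 \<le> nO" "1 \<le> K" "1 \<le> H"
    and m: "1 \<le> m" "m \<le> H" and \<alpha>: "0 < \<alpha>"
    and \<beta>: "\<beta> = omle_\<beta> nS nA nO H K \<delta>"
    and r: "\<forall>h\<in>{1..H}. \<forall>x<nO. 0 \<le> r h x \<and> r h x \<le> 1"
    and plan: "optimistic_planner nS nA nO H r m \<alpha> \<beta> select"
    and \<theta>: "\<theta> \<in> params nS nA nO H" and sv: "\<alpha> \<le> min_singular_value nS nA nO H m \<theta>" by auto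
  let ?p = "omle nA H m select \<theta> K"
  let ?A = "{(\<pi>s, D). \<forall>k\<in>{1..K}.
      (\<Sum>t=1..k. optimal_value nA nO H r \<theta> - policy_value H r \<theta> (\<pi>s ! (t - 1)))
      \<le> (case (real nS, real nA ^ m, real nO, real H, 1 / \<alpha>, ln (real K / \<delta>)) of
          (S, a, b, H, i, l) \<Rightarrow> regret_poly S a b H i l) * sqrt (real k)} :: (policy list \<times> dataset) set"
  define L where "L = H - m + 1"
  show "1 - \<delta> \<le> measure_pmf.prob ?p ?A"
  \<comment> \<open>If all sizes are 1, the logarithm in \<open>\<beta>\<close> vanishes and
    \<open>\<beta>\<close> is 0 for \<open>\<delta> = 1\<close>, too small for the likelihood
    argument. But with a single observation all policies have the same value, so the regret is
    0.\<close>
  proof (cases "nS * nA * nO * H * K = 1")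
    case True
    then have nO: "nO = 1" by simp
    have sel: "snd (select D) \<in> policies nA nO H" if "D \<in> datasets nA nO H" for D
      using plan that unfolding optimistic_planner_def by (auto simp: mem_Times_iff)
    have val: "policy_value H r \<theta> \<pi> = (\<Sum>h=1..H. r h 0)" if "\<pi> \<in> policies nA nO H" for \<pi>
      using policy_value_one_observation[of \<theta> nS nA H \<pi> r] \<theta> that by (simp add: nO)
    have opt: "optimal_value nA nO H r \<theta> = (\<Sum>h=1..H. r h 0)"
      unfolding optimal_value_def using policies_nonempty[OF pos(2), of nO H] by (simp add: val cong: SUP_cong_simp)
    have l0: "0 \<le> ln (real K / \<delta>)" using \<delta> pos by (simp add: field_simps)
    have "x \<in> ?A" if x: "x \<in> set_pmf ?p" for x
    proof -
      have "(\<Sum>t=1..k. optimal_value nA nO H r \<theta> - policy_value H r \<theta> (fst x ! (t - 1))) = 0" if k: "k \<in> {1..K}" for k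
      proof (intro sum.neutral ballI)
        fix t assume t: "t \<in> {1..k}"
        have D: "snd x \<in> datasets nA nO H"
          and f: "fst x ! (t - 1) = snd (select (take ((t - 1) * L) (snd x)))"
          using omle_support[OF \<theta> pos(2) L_def sel x] t k by auto
        have "take ((t - 1) * L) (snd x) \<in> datasets nA nO H"
          using D set_take_subset[of "(t - 1) * L" "snd x"] by (auto simp: lists_eq_set)
        then show "optimal_value nA nO H r \<theta> - policy_value H r \<theta> (fst x ! (t - 1)) = 0"
          unfolding f using opt val[OF sel] by simp
      qed
      then show ?thesis
        using regret_poly_nonneg[of "real nS" "real nA ^ m" "real nO" "real H" "1 / \<alpha>" "ln (real K / \<delta>)"] \<alpha> l0
        by (simp add: case_prod_unfold)
    qed
    then show ?thesis using prob_ge_of_bad_event[of ?p "{}" \<delta> ?A] \<delta> by simp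
  next
    case False
    have "1 \<le> nS * nA * nO * H * K" using pos by simp
    with False have X2: "2 \<le> nS * nA * nO * H * K" by linarith
    define G where "G = cover nS nA nO H (3 * H * H * K * (nS + nO))"
    have G: "finite G" "G \<noteq> {}" by (simp_all add: G_def cover_nonempty)
    show ?thesis
    proof (rule prob_ge_of_bad_event[OF root_ratio_event[OF \<theta> L_def G pos(4) \<delta>(1)]])
      fix x assume x: "x \<in> set_pmf ?p"
        and "x \<notin> {x. \<exists>k<K. \<exists>\<theta>'\<in>G. real (card G) * real K / \<delta> <
          prod_list (map (root_ratio nA nO H \<theta>' \<theta>) (take (k * L) (snd x)))}"
      then have good: "prod_list (map (root_ratio nA nO H \<theta>' \<theta>) (take (k * L) (snd x))) \<le> real (card G) * real K / \<delta>"
        if "k < K" "\<theta>' \<in> G" for k \<theta>' using that by (simp add: linorder_not_less) (meson not_le)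
      have "(\<Sum>t=1..k. optimal_value nA nO H r \<theta> - policy_value H r \<theta> (fst x ! (t - 1)))
        \<le> regret_poly (real nS) (real nA ^ m) (real nO) (real H) (1 / \<alpha>) (ln (real K / \<delta>)) * sqrt (real k)"
        if "k \<in> {1..K}" for k
        using omle_regret[OF \<delta> pos m \<alpha> \<beta> r plan \<theta> sv X2 x _ that] good
        unfolding G_def L_def by blast
      then show "x \<in> ?A" by (simp add: case_prod_unfold)
    qed
  qed
qed

end
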